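(* The following hold. (i) If $1\le p_1<p_2<\infty$ and $\theta\ge 0$, then $A_{p_1}^{\rho,\theta}\subset A_{p_2}^{\rho,\theta}$. (ii) For $1<p<\infty$ and $\theta\ge0$, $\omega\in A_p^{\rho,\theta}$ if and only if $\omega^{-\frac1{p-1}}\in A_{p'}^{\rho,\theta}$, where $1/p+1/p'=1$. (iii) If $\omega\in A_p^{\rho,\infty}$ with $1<p<\infty$, then there exists $\epsilon>0$ such that $\omega\in A_{p-\epsilon}^{\rho,\infty}$. (iv) If $f\in L_{\rm loc}(\mathbb{R}^n)$ (i.e. $f$ is locally integrable), $0<\delta<1$ and $\theta\ge 0$, then $(M_{V,\theta}f)^\delta\in A_1^{\rho,\theta}$. (v) Let $1<p<\infty$. Then $\omega\in A_p^{\rho,\infty}$ if and only if $\omega=\omega_1\omega_2^{1-p}$ for some $\omega_1,\omega_2\in A_1^{\rho,\infty}$.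
   Context: Let $n\ge3$. For $1<q<\infty$, a nonnegative function $V\in L^q_{\rm loc}(\mathbb{R}^n)$ belongs to $B_q$ if there is $C>0$ with $\left(\frac1{|B|}\int_{B}V^q\right)^{1/q}\le C\,\frac1{|B|}\int_{B}V$ for every ball $B$. Standing assumption: $V\in B_{n/2}$ and $V\not\equiv0$. Define $\rho(x)=\sup\{r>0:\ r^{2-n}\int_{B(x,r)}V(y)\,dy\le1\}\in(0,\infty)$. For a ball $B=B(x_0,r)$ and $\theta\ge0$, $\Psi_\theta(B)=(1+r/\rho(x_0))^\theta$. The maximal operator is $M_{V,\theta}f(x)=\sup_{B\ni x}\frac1{\Psi_\theta(B)|B|}\int_B|f(y)|\,dy$, supremum over balls containing $x$. A weight is a positive locally integrable function. For $1<p<\infty$, a weight $\omega$ is in $A_p^{\rho,\theta}$ if there is $C$ with $$\Big(\frac1{\Psi_\theta(B)|B|}\int_B\omega\Big)\Big(\frac1{\Psi_\theta(B)|B|}\int_B\omega^{-\frac1{p-1}}\Big)^{p-1}\le C\quad\text{for all balls }B.$$ A nonnegative function $\omega$ satisfies the $A_1^{\rho,\theta}$ condition (written $\omega\in A_1^{\rho,\theta}$) if there is $C$ with $M_{V,\theta}\omega(x)\le C\omega(x)$ for a.e. $x$. For $p\ge1$, $A_p^{\rho,\infty}=\bigcup_{\theta\ge0}A_p^{\rho,\theta}$. *)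

theory Defs
  imports "HOL-Analysis.Analysis"
begin

definition locally_integrable :: "('a::euclidean_space \<Rightarrow> real) \<Rightarrow> bool" where
  "locally_integrable f \<longleftrightarrow> (\<forall>K. compact K \<longrightarrow> f absolutely_integrable_on K)"

definition reverse_holder_class :: "real \<Rightarrow> ('a::euclidean_space \<Rightarrow> real) set" where
  "reverse_holder_class q = {V. (\<forall>x. 0 \<le> V x) \<and> V \<in> borel_measurable lebesgue
     \<and> locally_integrable (\<lambda>x. V x powr q)
     \<and> (\<exists>C>0. \<forall>x r. 0 < r \<longrightarrow>
          ((LINT y:ball x r|lebesgue. V y powr q) / measure lebesgue (ball x r)) powr (1 / q)
            \<le> C * ((LINT y:ball x r|lebesgue. V y) / measure lebesgue (ball x r)))}"

definition critical_radius :: "('a::euclidean_space \<Rightarrow> real) \<Rightarrow> 'a \<Rightarrow> real" where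
  "critical_radius V x =
     Sup {r. 0 < r \<and> r powr (2 - real DIM('a)) * (LINT y:ball x r|lebesgue. V y) \<le> 1}"

text \<open>Balls are open; a ball is given by its centre and its radius. In the definitions below
  \<open>\<rho>\<close> stands for the critical radius function.\<close>

definition Psi :: "('a::euclidean_space \<Rightarrow> real) \<Rightarrow> real \<Rightarrow> 'a \<Rightarrow> real \<Rightarrow> real" where
  "Psi \<rho> \<theta> x0 r = (1 + r / \<rho> x0) powr \<theta>"

definition Psi_average ::
  "('a::euclidean_space \<Rightarrow> real) \<Rightarrow> real \<Rightarrow> 'a \<Rightarrow> real \<Rightarrow> ('a \<Rightarrow> ennreal) \<Rightarrow> ennreal" where
  "Psi_average \<rho> \<theta> x0 r f =
     (\<integral>\<^sup>+ y\<in>ball x0 r. f y \<partial>lebesgue) / ennreal (Psi \<rho> \<theta> x0 r * measure lebesgue (ball x0 r))"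

definition maximal ::
  "('a::euclidean_space \<Rightarrow> real) \<Rightarrow> real \<Rightarrow> ('a \<Rightarrow> ennreal) \<Rightarrow> 'a \<Rightarrow> ennreal" where
  "maximal \<rho> \<theta> f x = (SUP (x0, r) \<in> {(x0, r). 0 < r \<and> x \<in> ball x0 r}. Psi_average \<rho> \<theta> x0 r f)"

text \<open>Power of an extended nonnegative number, only used with exponents \<open>a > 0\<close>,
  so that \<open>\<infinity>\<close> to the power \<open>a\<close> is \<open>\<infinity>\<close>.\<close>

definition ennreal_powr :: "ennreal \<Rightarrow> real \<Rightarrow> ennreal" where
  "ennreal_powr x a = (if x = \<infinity> then \<infinity> else ennreal (enn2real x powr a))"

definition weight :: "('a::euclidean_space \<Rightarrow> real) \<Rightarrow> bool" where
  "weight \<omega> \<longleftrightarrow> (\<forall>x. 0 < \<omega> x) \<and> locally_integrable \<omega>"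

text \<open>The \<open>A\<^sub>1\<close> condition is stated for extended-valued nonnegative functions, which need
  not be weights: a maximal function of a locally integrable function may take the value
  \<open>\<infinity>\<close>, and it vanishes if the function does.\<close>

definition A1_condition ::
  "('a::euclidean_space \<Rightarrow> real) \<Rightarrow> real \<Rightarrow> ('a \<Rightarrow> ennreal) \<Rightarrow> bool" where
  "A1_condition \<rho> \<theta> \<omega> \<longleftrightarrow> \<omega> \<in> borel_measurable lebesgue
     \<and> (\<exists>C::real. AE x in lebesgue. maximal \<rho> \<theta> \<omega> x \<le> ennreal C * \<omega> x)"

definition Ap_condition ::
  "('a::euclidean_space \<Rightarrow> real) \<Rightarrow> real \<Rightarrow> real \<Rightarrow> ('a \<Rightarrow> real) \<Rightarrow> bool" where
  "Ap_condition \<rho> p \<theta> \<omega> \<longleftrightarrow> (\<exists>C::real. \<forall>x0 r. 0 < r \<longrightarrow>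
     Psi_average \<rho> \<theta> x0 r (\<lambda>y. ennreal (\<omega> y))
       * ennreal_powr (Psi_average \<rho> \<theta> x0 r (\<lambda>y. ennreal (\<omega> y powr (- 1 / (p - 1))))) (p - 1)
     \<le> ennreal C)"

definition A_class ::
  "('a::euclidean_space \<Rightarrow> real) \<Rightarrow> real \<Rightarrow> real \<Rightarrow> ('a \<Rightarrow> real) set" where
  "A_class \<rho> p \<theta> = {\<omega>. weight \<omega> \<and>
     (p = 1 \<and> A1_condition \<rho> \<theta> (\<lambda>x. ennreal (\<omega> x)) \<or> 1 < p \<and> Ap_condition \<rho> p \<theta> \<omega>)}"

definition A_class_inf :: "('a::euclidean_space \<Rightarrow> real) \<Rightarrow> real \<Rightarrow> ('a \<Rightarrow> real) set" where
  "A_class_inf \<rho> p = (\<Union>\<theta>\<in>{0..}. A_class \<rho> p \<theta>)"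

end

theory Submission
  imports Defs
begin

text \<open>Parts (iii) to (v) rest on one maximal operator, \<open>sup\<^bsub>B \<ni> x\<^esub> (\<integral>\<^sub>B f) / w(5 B)\<close>: since
  the denominator uses the enlarged ball, Vitali's covering lemma bounds it on \<open>L\<^sup>q(w)\<close> for every
  weight \<open>w\<close>, without doubling. Lerner's pointwise estimate then bounds the maximal operator
  with parameter \<open>\<theta> p / (p - 1)\<close> on \<open>L\<^sup>p(\<omega>)\<close> for \<open>\<omega> \<in> A\<^sub>p\<close> with parameter \<open>\<theta>\<close>. With this
  bound for \<open>\<omega>\<close> and for the dual weight, an integrable fixed point \<open>u\<close> of a monotone map, found by
  iteration from zero, gives the factors \<open>\<omega>\<^sub>1 = \<omega>\<^sup>1\<^sup>/\<^sup>p u\<^sup>1\<^sup>/\<^sup>p'\<close> and \<open>\<omega>\<^sub>2 = \<omega>\<^sup>-\<^sup>1\<^sup>/\<^sup>p u\<^sup>1\<^sup>/\<^sup>p\<close> of (v).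

  Only (iii) uses more of the critical radius than its positivity. By (v) it reduces to the
  openness of \<open>A\<^sub>1\<close>: on balls below the critical radius an \<open>A\<^sub>1\<close> weight satisfies a reverse Hoelder
  inequality, by a stopping time argument with Vitali balls, and the lower bound
  \<open>\<rho>(y) \<ge> c \<rho>(x) (1 + |x - y| / \<rho>(x))\<^sup>-\<^sup>k\<close> turns the loss on large balls into a power of
  \<open>1 + r / \<rho>(x)\<close>.\<close>

section \<open>Powers of extended nonnegative numbers and the layer cake formula\<close>

text \<open>The A_p condition used here gives no uniform doubling constant: comparing the
  \<omega>-mass of 5B with that of B costs a power of \<open>1 + r / \<rho> x0\<close>. This is the
  obstacle behind the enlarged denominators. In (iii) and (v) such losses are harmless, since they
  only enlarge \<theta> and the union over \<theta> is taken. One loss is built in: the A_p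
  condition on 5B carries the p-th power of \<open>Psi\<close>, while Lerner's estimate takes a root
  of order p - 1, so \<theta> becomes \<theta> p / (p - 1).

  The exponents of the two factors come from turning both A_1 conditions into pointwise inequalities
  for one function u. For example M(\<omega>1) \<le> C \<omega>1, raised to the power p', reads
  \<omega>^(-p'/p) M(\<omega>^(1/p) u^(1/p'))^p' \<le> C' u, and the left side is a bounded
  operation on L^1 in u because M is bounded on L^p' of the dual weight.

  In \<omega> = \<omega>1 \<omega>2^(1-p) only \<omega>2 has to be improved for (iii): if its power
  1 + \<epsilon> is still A_1, then p drops to the q with (1 + \<epsilon>)(q - 1) = p - 1.\<close>

lemma ennreal_powr_ennreal: "0 \<le> a \<Longrightarrow> ennreal_powr (ennreal a) q = ennreal (a powr q)"
  by (simp add: ennreal_powr_def)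

lemma ennreal_powr_top [simp]: "ennreal_powr top q = top"
  by (simp add: ennreal_powr_def)

lemma ennreal_powr_0 [simp]: "ennreal_powr 0 q = 0"
  by (simp add: ennreal_powr_def)

lemma ennreal_powr_one [simp]: "ennreal_powr x 1 = x"
  by (cases x) (auto simp: ennreal_powr_ennreal)

lemma ennreal_powr_mono:
  assumes "x \<le> y" "0 \<le> q"
  shows "ennreal_powr x q \<le> ennreal_powr y q"
  using assms
  by (cases x; cases y) (auto simp: ennreal_powr_ennreal top_unique intro!: ennreal_leI powr_mono2)

lemma ennreal_powr_mult:
  assumes "0 < q"
  shows "ennreal_powr (x * y) q = ennreal_powr x q * ennreal_powr y q"
proof (cases x; cases y)
  fix a b :: real assume "0 \<le> a" "x = ennreal a" "0 \<le> b" "y = ennreal b"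
  then show ?thesis
    by (simp add: ennreal_powr_ennreal powr_mult flip: ennreal_mult)
next
  fix a :: real assume a: "0 \<le> a" "x = ennreal a" "y = top"
  then show ?thesis
    using assms by (cases "a = 0") (auto simp: ennreal_powr_ennreal ennreal_mult_top)
next
  fix a :: real assume a: "0 \<le> a" "y = ennreal a" "x = top"
  then show ?thesis
    using assms by (cases "a = 0") (auto simp: ennreal_powr_ennreal ennreal_top_mult)
qed (simp add: ennreal_top_mult)

lemma ennreal_powr_powr: "ennreal_powr (ennreal_powr x a) b = ennreal_powr x (a * b)"
  by (cases x) (auto simp: ennreal_powr_ennreal powr_powr)

lemma ennreal_powr_add:
  assumes "0 < a" "0 < b"
  shows "ennreal_powr x (a + b) = ennreal_powr x a * ennreal_powr x b"
  by (cases x) (auto simp: ennreal_powr_ennreal powr_add ennreal_top_mult simp flip: ennreal_mult)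

text \<open>A Galois connection between the powers \<open>q\<close> and \<open>1 / q\<close>. It
  turns a bound on the power of a supremum into bounds on its members, without cases for
  \<open>top\<close>.\<close>

lemma ennreal_powr_le_iff:
  assumes "0 < q"
  shows "ennreal_powr x q \<le> y \<longleftrightarrow> x \<le> ennreal_powr y (1 / q)"
proof
  assume "ennreal_powr x q \<le> y"
  from ennreal_powr_mono[OF this, of "1 / q"] show "x \<le> ennreal_powr y (1 / q)"
    using assms by (simp add: ennreal_powr_powr)
next
  assume "x \<le> ennreal_powr y (1 / q)"
  from ennreal_powr_mono[OF this, of q] show "ennreal_powr x q \<le> y"
    using assms by (simp add: ennreal_powr_powr)
qed

lemma ennreal_powr_SUP:
  assumes "0 < q"
  shows "ennreal_powr (SUP k\<in>K. f k) q = (SUP k\<in>K. ennreal_powr (f k) q)"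
proof (rule antisym)
  show "ennreal_powr (SUP k\<in>K. f k) q \<le> (SUP k\<in>K. ennreal_powr (f k) q)"
    unfolding ennreal_powr_le_iff[OF assms]
    by (intro SUP_least) (auto simp flip: ennreal_powr_le_iff[OF assms] intro: SUP_upper)
  show "(SUP k\<in>K. ennreal_powr (f k) q) \<le> ennreal_powr (SUP k\<in>K. f k) q"
    using assms by (intro SUP_least ennreal_powr_mono SUP_upper) auto
qed

lemma ennreal_powr_max: "0 \<le> q \<Longrightarrow> ennreal_powr (max x y) q = max (ennreal_powr x q) (ennreal_powr y q)"
  by (metis ennreal_powr_mono linorder_le_cases max.absorb1 max.absorb2)

lemma ennreal_powr_pos: "0 < ennreal_powr x q \<longleftrightarrow> 0 < x"
  by (cases x) (auto simp: ennreal_powr_ennreal)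

lemma borel_measurable_ennreal_powr [measurable (raw)]:
  "f \<in> borel_measurable M \<Longrightarrow> (\<lambda>x. ennreal_powr (f x) q) \<in> borel_measurable M"
proof -
  assume [measurable]: "f \<in> borel_measurable M"
  have "(\<lambda>x. if f x = top then top else ennreal (enn2real (f x) powr q)) \<in> borel_measurable M"
    by measurable
  then show ?thesis
    by (simp add: ennreal_powr_def)
qed

lemma ennreal_powr_divide:
  assumes "0 < c" "0 < q"
  shows "ennreal_powr (x / ennreal c) q = ennreal_powr x q / ennreal (c powr q)"
proof -
  have "x / ennreal c = x * ennreal (1 / c)" "ennreal_powr x q / ennreal (c powr q) = ennreal_powr x q * ennreal (1 / (c powr q))"
    using assms by (simp_all add: divide_ennreal_def inverse_ennreal inverse_eq_divide)
  then show ?thesis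
    using assms by (simp add: ennreal_powr_mult ennreal_powr_ennreal powr_divide)
qed

lemma ennreal_powr_layer:
  assumes "0 < q"
  shows "ennreal_powr a q =
    (\<integral>\<^sup>+l. ennreal (q * l powr (q - 1)) * indicator {l. 0 < l \<and> ennreal l < a} l \<partial>lborel)"
proof -
  have layer: "ennreal (b powr q) =
      (\<integral>\<^sup>+l. ennreal (q * l powr (q - 1)) * indicator {l. 0 < l \<and> l < b} l \<partial>lborel)"
    if "0 \<le> b" for b :: real
  proof -
    have "((\<lambda>l. q * l powr (q - 1)) has_integral q * (b powr (q - 1 + 1) / (q - 1 + 1))) {0..b}"
      using assms that by (intro has_integral_mult_right has_integral_powr_from_0) auto
    then have "(\<integral>\<^sup>+l. indicator {0..b} l * ennreal (q * l powr (q - 1)) \<partial>lborel) = ennreal (b powr q)"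
      using assms nn_integral_has_integral_lebesgue[where \<Omega> = "{0..b}" and f = "\<lambda>l. q * l powr (q - 1)"]
      by (simp add: ennreal_mult' ennreal_indicator)
    moreover have "(\<integral>\<^sup>+l. indicator {0..b} l * ennreal (q * l powr (q - 1)) \<partial>lborel) =
        (\<integral>\<^sup>+l. ennreal (q * l powr (q - 1)) * indicator {l. 0 < l \<and> l < b} l \<partial>lborel)"
    proof (rule nn_integral_cong_AE)
      have "AE l in lborel. l \<noteq> 0 \<and> l \<noteq> b"
        by (intro AE_conjI AE_lborel_singleton)
      then show "AE l in lborel. indicator {0..b} l * ennreal (q * l powr (q - 1)) =
          ennreal (q * l powr (q - 1)) * indicator {l. 0 < l \<and> l < b} l"
        by eventually_elim (auto simp: indicator_def)
    qed
    ultimately show ?thesis by simp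
  qed
  show ?thesis
  proof (cases a)
    case (real b)
    then have "{l. 0 < l \<and> ennreal l < a} = {l. 0 < l \<and> l < b}"
      by (auto simp: ennreal_less_iff)
    then show ?thesis
      using real layer[of b] by (simp add: ennreal_powr_ennreal)
  next
    \<comment> \<open>At the value \<open>top\<close> the integral diverges: the levels below
      \<open>real n powr (1 / q)\<close> alone already contribute \<open>n\<close>.\<close>
    case top
    let ?I = "\<integral>\<^sup>+l. ennreal (q * l powr (q - 1)) * indicator {l. 0 < l \<and> ennreal l < a} l \<partial>lborel"
    have "ennreal (real n) \<le> ?I" for n :: nat
    proof -
      have "ennreal (real n) = ennreal ((real n powr (1 / q)) powr q)"
        using assms by (simp add: powr_powr)
      also have "\<dots> \<le> ?I"
        unfolding layer[OF powr_ge_zero]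
        by (intro nn_integral_mono) (auto simp: indicator_def top)
      finally show ?thesis .
    qed
    then have "(SUP n. of_nat n) \<le> ?I"
      by (intro SUP_least) (simp add: ennreal_of_nat_eq_real_of_nat)
    then show ?thesis
      using top by (simp add: ennreal_SUP_of_nat_eq_top top_unique)
  qed
qed

lemma sigma_finite_lebesgue: "sigma_finite_measure (lebesgue :: 'a::euclidean_space measure)"
proof -
  obtain A :: "'a set set" where "countable A" "A \<subseteq> sets lborel" "\<Union>A = space lborel"
    "\<forall>a\<in>A. emeasure lborel a \<noteq> \<infinity>"
    using lborel.sigma_finite_countable by blast
  then show ?thesis
    by (intro sigma_finite_measure.intro exI[of _ A]) auto
qed

text \<open>The pointwise formula \<open>ennreal_powr_layer\<close> integrated against
  \<open>w\<close>, with the order of integration exchanged. The density \<open>w\<close> is kept so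
  that one formula serves all weighted norms.\<close>

lemma nn_integral_layer_cake:
  fixes f :: "'a::euclidean_space \<Rightarrow> ennreal"
  assumes [measurable]: "f \<in> borel_measurable lebesgue" "w \<in> borel_measurable lebesgue"
    and q: "0 < q"
  shows "(\<integral>\<^sup>+x. w x * ennreal_powr (f x) q \<partial>lebesgue) =
    (\<integral>\<^sup>+l. ennreal (q * l powr (q - 1)) * indicator {0<..} l *
       (\<integral>\<^sup>+x. w x * indicator {x. ennreal l < f x} x \<partial>lebesgue) \<partial>lborel)"
proof -
  interpret pair_sigma_finite "lebesgue :: 'a measure" "lborel :: real measure"
    by (intro pair_sigma_finite.intro sigma_finite_lebesgue lborel.sigma_finite_measure_axioms)
  let ?g = "\<lambda>(x, l). w x * (ennreal (q * l powr (q - 1)) * indicator {0<..} l * (if ennreal l < f x then 1 else 0))"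
  have "(\<integral>\<^sup>+x. w x * ennreal_powr (f x) q \<partial>lebesgue) = (\<integral>\<^sup>+x. \<integral>\<^sup>+l. ?g (x, l) \<partial>lborel \<partial>lebesgue)"
    unfolding ennreal_powr_layer[OF q]
    by (intro nn_integral_cong, subst nn_integral_cmult[symmetric])
      (auto intro!: nn_integral_cong simp: indicator_def)
  also have "\<dots> = (\<integral>\<^sup>+l. \<integral>\<^sup>+x. ?g (x, l) \<partial>lebesgue \<partial>lborel)"
    by (rule Fubini'[symmetric]) measurable
  also have "\<dots> = (\<integral>\<^sup>+l. ennreal (q * l powr (q - 1)) * indicator {0<..} l *
       (\<integral>\<^sup>+x. w x * indicator {x. ennreal l < f x} x \<partial>lebesgue) \<partial>lborel)"
  proof (intro nn_integral_cong)
    fix l :: real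
    have "(\<integral>\<^sup>+x. ?g (x, l) \<partial>lebesgue) = (\<integral>\<^sup>+x. ennreal (q * l powr (q - 1)) * indicator {0<..} l *
       (w x * indicator {x. ennreal l < f x} x) \<partial>lebesgue)"
      by (intro nn_integral_cong) (auto simp: indicator_def mult_ac)
    also have "\<dots> = ennreal (q * l powr (q - 1)) * indicator {0<..} l *
       (\<integral>\<^sup>+x. w x * indicator {x. ennreal l < f x} x \<partial>lebesgue)"
      by (rule nn_integral_cmult) measurable
    finally show "(\<integral>\<^sup>+x. ?g (x, l) \<partial>lebesgue) = \<dots>" .
  qed
  finally show ?thesis .
qed

lemma borel_measurable_level_integral:
  fixes f w :: "'a::euclidean_space \<Rightarrow> ennreal"
  assumes [measurable]: "f \<in> borel_measurable lebesgue" "w \<in> borel_measurable lebesgue"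
  shows "(\<lambda>l. \<integral>\<^sup>+x. w x * indicator {x. ennreal l < f x} x \<partial>lebesgue) \<in> borel_measurable lborel"
proof -
  interpret sigma_finite_measure "lebesgue :: 'a measure" by (rule sigma_finite_lebesgue)
  have "(\<lambda>l. \<integral>\<^sup>+x. w x * (if ennreal l < f x then 1 else 0) \<partial>lebesgue) \<in> borel_measurable lborel"
    by measurable
  also have "(\<lambda>l. \<integral>\<^sup>+x. w x * (if ennreal l < f x then 1 else 0) \<partial>lebesgue) =
      (\<lambda>l. \<integral>\<^sup>+x. w x * indicator {x. ennreal l < f x} x \<partial>lebesgue)"
    by (intro ext nn_integral_cong) (auto simp: indicator_def)
  finally show ?thesis .
qed

section \<open>Jensen's inequality for powers\<close>

lemma powr_tangent:
  fixes a t q :: real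
  assumes a: "0 < a" and t: "0 < t" and q: "1 \<le> q"
  shows "q * t powr (q - 1) * (a - t) \<le> a powr q - t powr q"
proof (rule convex_on_imp_above_tangent[where A = "{0<..}" and f = "\<lambda>x. x powr q"])
  show "convex_on {0<..} (\<lambda>x. x powr q)"
    using q by (rule powr_convex)
  show "((\<lambda>x. x powr q) has_field_derivative q * t powr (q - 1)) (at t within {0<..})"
    by (rule has_field_derivative_at_within[OF has_real_derivative_powr[OF t]])
  show "t \<in> interior {0<..}"
    using t by (subst interior_open) auto
  show "a \<in> {0<..}" using a by simp
  show "connected {0::real<..}" by (rule connected_Ioi)
qed

text \<open>The tangent to the q-th power at a height \<open>t\<close> bounds \<open>f\<close> by an
  affine function of its own q-th power. Integrating this over \<open>E\<close> and choosing the
  best \<open>t\<close> gives Jensen's inequality.\<close>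

lemma nn_integral_power_mean:
  assumes [measurable]: "f \<in> borel_measurable M" "E \<in> sets M"
    and m: "emeasure M E = ennreal m" "0 < m" and q: "1 \<le> q"
  shows "ennreal_powr (\<integral>\<^sup>+x\<in>E. f x \<partial>M) q \<le> ennreal (m powr (q - 1)) * (\<integral>\<^sup>+x\<in>E. ennreal_powr (f x) q \<partial>M)"
proof (cases "(\<integral>\<^sup>+x\<in>E. ennreal_powr (f x) q \<partial>M)")
  case top
  then show ?thesis
    using m by (simp add: ennreal_mult_top)
next
  case (real G)
  show ?thesis
  proof (cases "G = 0")
    case True
    then have "AE x in M. ennreal_powr (f x) q * indicator E x = 0"
      using real by (subst nn_integral_0_iff_AE[symmetric]) auto
    then have "AE x in M. f x * indicator E x = 0"
      by eventually_elim (metis ennreal_powr_pos mult_eq_0_iff not_gr_zero)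
    then have "(\<integral>\<^sup>+x\<in>E. f x \<partial>M) = 0"
      by (subst nn_integral_0_iff_AE) auto
    then show ?thesis by simp
  next
    case False
    with real have G: "0 < G" by simp
    \<comment> \<open>The constant \<open>t\<close> has the same integral of the q-th power over
      \<open>E\<close> as \<open>f\<close>. At this height the two integrated terms add up to
      \<open>t * m\<close>.\<close>
    define t where "t = (G / m) powr (1 / q)"
    have t: "0 < t" using G m by (simp add: t_def)
    have tq: "t powr q = G / m"
      using G m q by (simp add: t_def powr_powr)
    have young: "a \<le> (1 / q) * t powr (1 - q) * a powr q + (1 - 1 / q) * t" if "0 \<le> a" for a :: real
    proof (cases "a = 0")
      case True
      then show ?thesis using t q by simp
    next
      case False
      with that have a: "0 < a" by simp
      have "q * t powr (q - 1) * (a - t) \<le> a powr q - t powr q"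
        by (rule powr_tangent[OF a t q])
      then have "t powr (1 - q) * (q * t powr (q - 1) * (a - t)) \<le> t powr (1 - q) * (a powr q - t powr q)"
        by (intro mult_left_mono) auto
      moreover have "t powr (1 - q) * (q * t powr (q - 1) * (a - t)) = q * (a - t)"
        using t by (simp add: powr_diff powr_minus field_simps)
      moreover have "t powr (1 - q) * (a powr q - t powr q) = t powr (1 - q) * a powr q - t"
        using t by (simp add: powr_diff field_simps)
      ultimately have "q * (a - t) \<le> t powr (1 - q) * a powr q - t" by simp
      then have "a \<le> (t powr (1 - q) * a powr q - t + q * t) / q"
        using q by (simp add: pos_le_divide_eq algebra_simps)
      also have "\<dots> = (1 / q) * t powr (1 - q) * a powr q + (1 - 1 / q) * t"
        using q by (simp add: add_divide_distrib diff_divide_distrib algebra_simps)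
      finally show ?thesis .
    qed
    have "(\<integral>\<^sup>+x\<in>E. f x \<partial>M) \<le> (\<integral>\<^sup>+x. ennreal ((1 / q) * t powr (1 - q)) * (ennreal_powr (f x) q * indicator E x)
        + ennreal ((1 - 1 / q) * t) * indicator E x \<partial>M)"
    proof (intro nn_integral_mono)
      fix x
      show "f x * indicator E x \<le> ennreal ((1 / q) * t powr (1 - q)) * (ennreal_powr (f x) q * indicator E x)
        + ennreal ((1 - 1 / q) * t) * indicator E x"
      proof (cases "f x")
        case (real a)
        then show ?thesis
          using young[of a] q t
          by (auto simp: indicator_def ennreal_powr_ennreal simp flip: ennreal_mult ennreal_plus)
      next
        case top
        then show ?thesis
          using q t by (auto simp: indicator_def ennreal_mult_top)
      qed
    qed
    also have "\<dots> = ennreal ((1 / q) * t powr (1 - q)) * ennreal G + ennreal ((1 - 1 / q) * t) * ennreal m"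
      using real m by (simp add: nn_integral_add nn_integral_cmult)
    also have "\<dots> = ennreal ((1 / q) * t powr (1 - q) * G + (1 - 1 / q) * t * m)"
      using q t G m by (simp flip: ennreal_mult ennreal_plus)
    also have "(1 / q) * t powr (1 - q) * G + (1 - 1 / q) * t * m = t * m"
    proof -
      have "t powr (1 - q) * G = t * m"
        using t tq m G by (simp add: powr_diff)
      then show ?thesis using q by (simp add: field_simps)
    qed
    finally have "ennreal_powr (\<integral>\<^sup>+x\<in>E. f x \<partial>M) q \<le> ennreal_powr (ennreal (t * m)) q"
      using q by (intro ennreal_powr_mono) auto
    also have "\<dots> = ennreal (m powr (q - 1) * G)"
      using t m tq by (simp add: ennreal_powr_ennreal powr_mult powr_diff mult.commute)
    finally show ?thesis
      using real m by (simp add: ennreal_mult)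
  qed
qed

section \<open>A maximal operator with enlarged denominators\<close>

abbreviation vol :: "'a::euclidean_space \<Rightarrow> real \<Rightarrow> real" where
  "vol z r \<equiv> measure lebesgue (ball z r)"

abbreviation ball_integral :: "('a::euclidean_space \<Rightarrow> ennreal) \<Rightarrow> 'a \<Rightarrow> real \<Rightarrow> ennreal" where
  "ball_integral f z r \<equiv> \<integral>\<^sup>+y\<in>ball z r. f y \<partial>lebesgue"

abbreviation mass :: "('a::euclidean_space \<Rightarrow> real) \<Rightarrow> 'a \<Rightarrow> real \<Rightarrow> ennreal" where
  "mass w z r \<equiv> \<integral>\<^sup>+y\<in>ball z r. ennreal (w y) \<partial>lebesgue"

lemma measure_lebesgue_ball:
  "0 \<le> r \<Longrightarrow> measure lebesgue (ball (x::'a::euclidean_space) r) = unit_ball_vol (real DIM('a)) * r ^ DIM('a)"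
  using content_ball[of r x] by simp

lemma measure_lebesgue_ball_pos: "0 < r \<Longrightarrow> 0 < measure lebesgue (ball (x::'a::euclidean_space) r)"
  by (simp add: measure_lebesgue_ball)

lemma emeasure_lebesgue_ball: "emeasure lebesgue (ball (x::'a::euclidean_space) r) = ennreal (vol x r)"
  by (rule emeasure_eq_ennreal_measure) (use emeasure_lborel_ball_finite[of x r] in auto)

lemma measure_lebesgue_ball_scale:
  "0 \<le> r \<Longrightarrow> 0 \<le> k \<Longrightarrow> measure lebesgue (ball (z::'a::euclidean_space) (k * r)) = k ^ DIM('a) * measure lebesgue (ball (x::'a) r)"
  using measure_lebesgue_ball[of "k * r" z] measure_lebesgue_ball[of r x] by (simp add: power_mult_distrib)

text \<open>Lower semicontinuity: a point lies above level \<open>l\<close> exactly when some ball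
  around it has \<open>l < a z r\<close>, so the set is a union of open balls whatever
  \<open>a\<close> is. All maximal functions are measurable for this reason.\<close>

lemma open_SUP_balls:
  fixes a :: "'a::metric_space \<Rightarrow> real \<Rightarrow> ennreal"
  shows "open {x. l < (SUP (z, r) \<in> {(z, r). 0 < r \<and> x \<in> ball z r}. a z r)}"
proof -
  have "{x. l < (SUP (z, r) \<in> {(z, r). 0 < r \<and> x \<in> ball z r}. a z r)} =
      (\<Union>(z, r) \<in> {(z, r). 0 < r \<and> l < a z r}. ball z r)"
    by (fastforce simp: less_SUP_iff)
  then show ?thesis by auto
qed

lemma measurable_SUP_balls:
  fixes a :: "'a::euclidean_space \<Rightarrow> real \<Rightarrow> ennreal"
  shows "(\<lambda>x. SUP (z, r) \<in> {(z, r). 0 < r \<and> x \<in> ball z r}. a z r) \<in> borel_measurable lebesgue"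
proof (rule borel_measurableI_greater)
  fix l :: ennreal
  have "{x. l < (SUP (z, r) \<in> {(z, r). 0 < r \<and> x \<in> ball z r}. a z r)} \<in> sets lebesgue"
    by (simp only: lebesgue_openin open_SUP_balls borel_open sets_completionI_sets sets_lborel)
  then show "{x \<in> space lebesgue. l < (SUP (z, r) \<in> {(z, r). 0 < r \<and> x \<in> ball z r}. a z r)} \<in> sets lebesgue"
    by (simp only: space_completion space_lborel space_borel UNIV_I simp_thms)
qed

text \<open>Vitali's lemma delivers a countable set of pairs instead of a sequence, so the sum in
  countable subadditivity is written as an integral over \<open>count_space I\<close>.\<close>

lemma emeasure_UN_countable_le:
  assumes [measurable]: "\<And>i. i \<in> I \<Longrightarrow> X i \<in> sets M" and "countable I"
  shows "emeasure M (\<Union>i\<in>I. X i) \<le> (\<integral>\<^sup>+i. emeasure M (X i) \<partial>count_space I)"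
proof -
  have "(\<Union>i\<in>I. X i) \<in> sets M"
    using assms by auto
  then have "emeasure M (\<Union>i\<in>I. X i) = (\<integral>\<^sup>+x. indicator (\<Union>i\<in>I. X i) x \<partial>M)"
    by simp
  also have "\<dots> \<le> (\<integral>\<^sup>+x. \<integral>\<^sup>+i. indicator (X i) x \<partial>count_space I \<partial>M)"
  proof (intro nn_integral_mono)
    fix x
    show "indicator (\<Union>i\<in>I. X i) x \<le> (\<integral>\<^sup>+i. indicator (X i) x \<partial>count_space I)"
    proof (cases "x \<in> (\<Union>i\<in>I. X i)")
      case True
      then obtain i where "i \<in> I" "x \<in> X i" by auto
      then show ?thesis
        using nn_integral_ge_point[of i I "\<lambda>i. indicator (X i) x"] by (simp add: indicator_def)
    qed simp
  qed
  also have "\<dots> = (\<integral>\<^sup>+i. \<integral>\<^sup>+x. indicator (X i) x \<partial>M \<partial>count_space I)"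
    by (rule nn_integral_count_space_nn_integral) (use assms in auto)
  also have "\<dots> = (\<integral>\<^sup>+i. emeasure M (X i) \<partial>count_space I)"
    by (intro nn_integral_cong) auto
  finally show ?thesis .
qed

text \<open>The denominator uses the ball with five times the radius, so that Vitali's covering lemma
  gives the weak type inequality for every weight \<open>w\<close>, doubling or not.\<close>

definition vitali_maximal ::
  "('a::euclidean_space \<Rightarrow> ennreal) \<Rightarrow> ('a \<Rightarrow> ennreal) \<Rightarrow> 'a \<Rightarrow> ennreal" where
  "vitali_maximal w f x = (SUP (z, r) \<in> {(z, r). 0 < r \<and> x \<in> ball z r}.
     ball_integral f z r / ball_integral w z (5 * r))"

lemma borel_measurable_vitali_maximal [measurable]: "vitali_maximal w f \<in> borel_measurable lebesgue"
  using measurable_SUP_balls[of "\<lambda>z r. ball_integral f z r / ball_integral w z (5 * r)"]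
  by (simp add: vitali_maximal_def[abs_def])

lemma vitali_maximal_ge:
  assumes "0 < r" "x \<in> ball z r"
  shows "ball_integral f z r / ball_integral w z (5 * r) \<le> vitali_maximal w f x"
  unfolding vitali_maximal_def using assms by (intro SUP_upper2[of "(z, r)"]) auto

lemma ball_in_sets_lebesgue [measurable, simp]: "ball (z::'a::euclidean_space) r \<in> sets lebesgue"
  by simp

lemma ennreal_less_divideD:
  fixes a b l :: ennreal
  assumes "l < a / b"
  shows "l * b \<le> a"
proof (rule ccontr)
  assume "\<not> ?thesis"
  then have "a < l * b" by simp
  moreover from this have "0 < b"
    by (auto intro: gr_zeroI)
  ultimately have "a / b \<le> l"
    by (intro divide_le_posI_ennreal) (auto simp: mult.commute)
  with assms show False by simp
qed

lemma vitali_maximal_weak_type: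
  fixes f w :: "'a::euclidean_space \<Rightarrow> ennreal"
  assumes [measurable]: "f \<in> borel_measurable lebesgue" "w \<in> borel_measurable lebesgue"
  shows "ennreal l * (\<integral>\<^sup>+x. w x * indicator {x. ennreal l < vitali_maximal w f x} x \<partial>lebesgue) \<le> (\<integral>\<^sup>+x. f x \<partial>lebesgue)"
proof -
  let ?D = "density lebesgue w" and ?F = "density lebesgue f"
  define Q where "Q z r = ball_integral f z r / ball_integral w z (5 * r)" for z r
  \<comment> \<open>Vitali's lemma asks for bounded radii, hence the cut at \<open>n\<close>;
    continuity from below along \<open>incseq E\<close> removes it at the end.\<close>
  define K where "K n = {(z, r). 0 < r \<and> r \<le> real n \<and> ennreal l < Q z r}" for n :: nat
  define E where "E n = (\<Union>(z, r) \<in> K n. ball z r)" for n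
  have E_open: "open (E n)" for n
    unfolding E_def by (auto split: prod.split)
  then have E_sets [measurable]: "E n \<in> sets lebesgue" for n
    by (simp add: lebesgue_openin)
  have level: "{x. ennreal l < vitali_maximal w f x} = (\<Union>n. E n)"
  proof (intro set_eqI iffI)
    fix x assume "x \<in> {x. ennreal l < vitali_maximal w f x}"
    then obtain z r where zr: "0 < r" "x \<in> ball z r" "ennreal l < Q z r"
      unfolding vitali_maximal_def Q_def by (auto simp: less_SUP_iff)
    obtain n :: nat where "r \<le> real n"
      using real_arch_simple by blast
    with zr show "x \<in> (\<Union>n. E n)"
      by (auto simp: E_def K_def)
  next
    fix x assume "x \<in> (\<Union>n. E n)"
    then obtain z r where zr: "0 < r" "x \<in> ball z r" "ennreal l < Q z r"
      by (auto simp: E_def K_def)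
    then show "x \<in> {x. ennreal l < vitali_maximal w f x}"
      using vitali_maximal_ge[of r x z f w] by (auto simp: Q_def)
  qed
  have "incseq E"
    by (rule incseq_SucI) (force simp: E_def K_def)
  have bound: "ennreal l * emeasure ?D (E n) \<le> (\<integral>\<^sup>+x. f x \<partial>lebesgue)" for n
  proof -
    have cov: "E n \<subseteq> (\<Union>i\<in>K n. ball (fst i) (snd i))"
      by (auto simp: E_def)
    have rad: "0 < snd i \<and> snd i \<le> real n" if "i \<in> K n" for i
      using that by (auto simp: K_def)
    obtain C where C: "countable C" "C \<subseteq> K n"
        "pairwise (\<lambda>i j. disjnt (ball (fst i) (snd i)) (ball (fst j) (snd j))) C"
        "E n \<subseteq> (\<Union>i\<in>C. ball (fst i) (5 * snd i))"
      by (rule Vitali_covering_lemma_balls[OF cov rad]) (assumption, rule that)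
    have "ennreal l * emeasure ?D (E n) \<le> ennreal l * emeasure ?D (\<Union>i\<in>C. ball (fst i) (5 * snd i))"
      using C by (intro mult_left_mono emeasure_mono) auto
    also have "\<dots> \<le> ennreal l * (\<integral>\<^sup>+i. emeasure ?D (ball (fst i) (5 * snd i)) \<partial>count_space C)"
      using C by (intro mult_left_mono emeasure_UN_countable_le) auto
    also have "\<dots> = (\<integral>\<^sup>+i. ennreal l * emeasure ?D (ball (fst i) (5 * snd i)) \<partial>count_space C)"
      by (simp add: nn_integral_cmult)
    also have "\<dots> \<le> (\<integral>\<^sup>+i. emeasure ?F (ball (fst i) (snd i)) \<partial>count_space C)"
    proof (intro nn_integral_mono)
      fix i assume "i \<in> space (count_space C)"
      then have "ennreal l < Q (fst i) (snd i)"
        using C by (auto simp: K_def)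
      then show "ennreal l * emeasure ?D (ball (fst i) (5 * snd i)) \<le> emeasure ?F (ball (fst i) (snd i))"
        by (intro ennreal_less_divideD) (simp add: Q_def emeasure_density)
    qed
    also have "\<dots> = emeasure ?F (\<Union>i\<in>C. ball (fst i) (snd i))"
      using C by (intro emeasure_UN_countable[symmetric])
        (auto simp: disjoint_family_on_def pairwise_def disjnt_def)
    also have "\<dots> \<le> emeasure ?F (space ?F)"
      by (rule emeasure_space)
    also have "\<dots> = (\<integral>\<^sup>+x. f x \<partial>lebesgue)"
      by (simp add: emeasure_density)
    finally show ?thesis .
  qed
  have "(\<integral>\<^sup>+x. w x * indicator {x. ennreal l < vitali_maximal w f x} x \<partial>lebesgue) = emeasure ?D (\<Union>n. E n)"
    unfolding level by (subst emeasure_density) auto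
  also have "\<dots> = (SUP n. emeasure ?D (E n))"
    by (rule SUP_emeasure_incseq[symmetric]) (use \<open>incseq E\<close> in auto)
  finally show ?thesis
    using bound by (simp add: SUP_mult_left_ennreal SUP_le_iff)
qed

text \<open>The part of \<open>h\<close> below height l / 2 adds at most l / 2 to each quotient,
  because the w-mass of B is at most that of 5B. The part above must supply the rest.\<close>

lemma vitali_maximal_truncate:
  fixes h w :: "'a::euclidean_space \<Rightarrow> ennreal"
  assumes [measurable]: "h \<in> borel_measurable lebesgue" "w \<in> borel_measurable lebesgue"
  assumes l: "0 < l" and x: "ennreal l < vitali_maximal w (\<lambda>y. h y * w y) x"
  shows "ennreal (l / 2) < vitali_maximal w (\<lambda>y. h y * indicator {y. ennreal (l / 2) < h y} y * w y) x"
proof (rule ccontr)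
  let ?h = "\<lambda>y. h y * indicator {y. ennreal (l / 2) < h y} y"
  assume "\<not> ?thesis"
  then have le: "vitali_maximal w (\<lambda>y. ?h y * w y) x \<le> ennreal (l / 2)" by simp
  have "vitali_maximal w (\<lambda>y. h y * w y) x \<le> ennreal l"
    unfolding vitali_maximal_def
  proof (intro SUP_least, clarify)
    fix z r assume zr: "0 < r" "x \<in> ball z r"
    have "ball_integral (\<lambda>y. h y * w y) z r
        \<le> (\<integral>\<^sup>+ y. (?h y * w y) * indicator (ball z r) y + ennreal (l / 2) * (w y * indicator (ball z r) y) \<partial>lebesgue)"
      by (intro nn_integral_mono) (auto simp: indicator_def not_less mult_right_mono)
    also have "\<dots> = ball_integral (\<lambda>y. ?h y * w y) z r + ennreal (l / 2) * ball_integral w z r"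
      by (simp add: nn_integral_add nn_integral_cmult)
    finally have "ball_integral (\<lambda>y. h y * w y) z r / ball_integral w z (5 * r)
       \<le> ball_integral (\<lambda>y. ?h y * w y) z r / ball_integral w z (5 * r) +
         ennreal (l / 2) * (ball_integral w z r / ball_integral w z (5 * r))"
      unfolding ennreal_times_divide add_divide_distrib_ennreal[symmetric]
      by (rule divide_right_mono_ennreal)
    also have "\<dots> \<le> ennreal (l / 2) + ennreal (l / 2) * 1"
    proof (intro add_mono mult_left_mono)
      show "ball_integral (\<lambda>y. ?h y * w y) z r / ball_integral w z (5 * r) \<le> ennreal (l / 2)"
        using vitali_maximal_ge[OF zr] le by (rule order_trans)
      have "ball_integral w z r \<le> ball_integral w z (5 * r)"
        using zr by (intro nn_integral_mono) (auto simp: indicator_def)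
      \<comment> \<open>If the mass of 5B vanishes, so does that of B, and the quotient is 0 by the
        convention 0 / 0 = 0.\<close>
      then show "ball_integral w z r / ball_integral w z (5 * r) \<le> 1"
        by (cases "ball_integral w z (5 * r) = 0")
          (auto intro!: divide_le_posI_ennreal simp: zero_less_iff_neq_zero)
    qed auto
    also have "\<dots> = ennreal l"
      using l by (simp flip: ennreal_plus)
    finally show "ball_integral (\<lambda>y. h y * w y) z r / ball_integral w z (5 * r) \<le> ennreal l" .
  qed
  with x show False by simp
qed

text \<open>Marcinkiewicz interpolation. The weak type bound for the part of \<open>h\<close> above
  l / 2 leaves a factor 2 / l, and a second layer cake, read backwards with density h w, function 2
  h and exponent \<open>q - 1\<close>, closes the estimate. Writing the function as a density
  \<open>h\<close> against \<open>w\<close> puts both sides into L^q of the same measure.\<close>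

lemma vitali_maximal_strong_type:
  fixes h w :: "'a::euclidean_space \<Rightarrow> ennreal"
  assumes [measurable]: "h \<in> borel_measurable lebesgue" "w \<in> borel_measurable lebesgue"
  assumes q: "1 < q"
  shows "(\<integral>\<^sup>+x. w x * ennreal_powr (vitali_maximal w (\<lambda>y. h y * w y) x) q \<partial>lebesgue)
     \<le> ennreal (q / (q - 1) * 2 powr q) * (\<integral>\<^sup>+x. w x * ennreal_powr (h x) q \<partial>lebesgue)"
proof -
  let ?N = "vitali_maximal w (\<lambda>y. h y * w y)"
  have level: "(\<integral>\<^sup>+x. w x * indicator {x. ennreal l < ?N x} x \<partial>lebesgue)
      \<le> ennreal (2 / l) * (\<integral>\<^sup>+x. h x * w x * indicator {x. ennreal l < 2 * h x} x \<partial>lebesgue)"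
    if l: "0 < l" for l
  proof -
    let ?h = "\<lambda>y. h y * indicator {y. ennreal (l / 2) < h y} y"
    let ?S = "\<integral>\<^sup>+x. w x * indicator {x. ennreal (l / 2) < vitali_maximal w (\<lambda>y. ?h y * w y) x} x \<partial>lebesgue"
    have half: "ennreal (l / 2) < h y \<longleftrightarrow> ennreal l < 2 * h y" for y
    proof (cases "h y")
      case (real b)
      have "2 * ennreal b = ennreal (2 * b)"
        using real by (simp add: ennreal_mult)
      then show ?thesis
        using real l by (simp add: ennreal_less_iff field_simps)
    qed (auto simp: ennreal_mult_top)
    have "(\<integral>\<^sup>+x. w x * indicator {x. ennreal l < ?N x} x \<partial>lebesgue) \<le> ?S"
      using vitali_maximal_truncate[OF assms(1,2) l]
      by (intro nn_integral_mono) (auto simp: indicator_def)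
    also have "\<dots> = ennreal (2 / l) * (ennreal (l / 2) * ?S)"
      using l by (simp add: mult.assoc[symmetric] flip: ennreal_mult)
    also have "\<dots> \<le> ennreal (2 / l) * (\<integral>\<^sup>+x. ?h x * w x \<partial>lebesgue)"
      by (intro mult_left_mono vitali_maximal_weak_type) auto
    also have "(\<integral>\<^sup>+x. ?h x * w x \<partial>lebesgue) = (\<integral>\<^sup>+x. h x * w x * indicator {x. ennreal l < 2 * h x} x \<partial>lebesgue)"
      by (intro nn_integral_cong) (auto simp: half indicator_def)
    finally show ?thesis .
  qed
  have "(\<integral>\<^sup>+x. w x * ennreal_powr (?N x) q \<partial>lebesgue) =
    (\<integral>\<^sup>+l. ennreal (q * l powr (q - 1)) * indicator {0<..} l *
       (\<integral>\<^sup>+x. w x * indicator {x. ennreal l < ?N x} x \<partial>lebesgue) \<partial>lborel)"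
    using q by (intro nn_integral_layer_cake) auto
  also have "\<dots> \<le> (\<integral>\<^sup>+l. ennreal (2 * q / (q - 1)) * (ennreal ((q - 1) * l powr (q - 1 - 1)) * indicator {0<..} l *
       (\<integral>\<^sup>+x. h x * w x * indicator {x. ennreal l < 2 * h x} x \<partial>lebesgue)) \<partial>lborel)"
  proof (intro nn_integral_mono)
    fix l :: real
    let ?I = "\<integral>\<^sup>+x. h x * w x * indicator {x. ennreal l < 2 * h x} x \<partial>lebesgue"
    show "ennreal (q * l powr (q - 1)) * indicator {0<..} l *
       (\<integral>\<^sup>+x. w x * indicator {x. ennreal l < ?N x} x \<partial>lebesgue) \<le>
       ennreal (2 * q / (q - 1)) * (ennreal ((q - 1) * l powr (q - 1 - 1)) * indicator {0<..} l * ?I)"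
    proof (cases "0 < l")
      case True
      then have "ennreal (q * l powr (q - 1)) * (\<integral>\<^sup>+x. w x * indicator {x. ennreal l < ?N x} x \<partial>lebesgue)
        \<le> ennreal (q * l powr (q - 1)) * (ennreal (2 / l) * ?I)"
        by (intro mult_left_mono level) auto
      also have "\<dots> = ennreal (2 * q / (q - 1)) * (ennreal ((q - 1) * l powr (q - 1 - 1)) * ?I)"
      proof -
        have "q * l powr (q - 1) * (2 / l) = 2 * q / (q - 1) * ((q - 1) * l powr (q - 1 - 1))"
          using True q powr_diff[of l "q - 1" 1] by simp
        moreover have "ennreal (q * l powr (q - 1)) * ennreal (2 / l) = ennreal (q * l powr (q - 1) * (2 / l))"
          using True q by (intro ennreal_mult[symmetric]) auto
        moreover have "ennreal (2 * q / (q - 1)) * ennreal ((q - 1) * l powr (q - 1 - 1)) =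
            ennreal (2 * q / (q - 1) * ((q - 1) * l powr (q - 1 - 1)))"
          using True q by (intro ennreal_mult[symmetric]) auto
        ultimately show ?thesis
          by (simp only: mult.assoc[symmetric])
      qed
      finally show ?thesis using True by simp
    qed simp
  qed
  also have "\<dots> = ennreal (2 * q / (q - 1)) * (\<integral>\<^sup>+l. ennreal ((q - 1) * l powr (q - 1 - 1)) * indicator {0<..} l *
       (\<integral>\<^sup>+x. h x * w x * indicator {x. ennreal l < 2 * h x} x \<partial>lebesgue) \<partial>lborel)"
  proof (rule nn_integral_cmult)
    have [measurable]: "(\<lambda>l. \<integral>\<^sup>+x. h x * w x * indicator {x. ennreal l < 2 * h x} x \<partial>lebesgue) \<in> borel_measurable lborel"
      by (rule borel_measurable_level_integral) measurable
    show "(\<lambda>l. ennreal ((q - 1) * l powr (q - 1 - 1)) * indicator {0<..} l *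
       (\<integral>\<^sup>+x. h x * w x * indicator {x. ennreal l < 2 * h x} x \<partial>lebesgue)) \<in> borel_measurable lborel"
      by measurable
  qed
  also have "(\<integral>\<^sup>+l. ennreal ((q - 1) * l powr (q - 1 - 1)) * indicator {0<..} l *
       (\<integral>\<^sup>+x. h x * w x * indicator {x. ennreal l < 2 * h x} x \<partial>lebesgue) \<partial>lborel)
     = (\<integral>\<^sup>+x. h x * w x * ennreal_powr (2 * h x) (q - 1) \<partial>lebesgue)"
    using q by (intro nn_integral_layer_cake[symmetric]) auto
  also have "\<dots> = (\<integral>\<^sup>+x. ennreal (2 powr (q - 1)) * (w x * ennreal_powr (h x) q) \<partial>lebesgue)"
  proof (intro nn_integral_cong)
    fix x
    have "ennreal_powr 2 (q - 1) = ennreal (2 powr (q - 1))"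
      using ennreal_powr_ennreal[of 2 "q - 1"] by simp
    moreover have "ennreal_powr (h x) q = h x * ennreal_powr (h x) (q - 1)"
      using ennreal_powr_add[of 1 "q - 1" "h x"] q by simp
    ultimately show "h x * w x * ennreal_powr (2 * h x) (q - 1) = ennreal (2 powr (q - 1)) * (w x * ennreal_powr (h x) q)"
      using q by (simp add: ennreal_powr_mult mult_ac)
  qed
  also have "\<dots> = ennreal (2 powr (q - 1)) * (\<integral>\<^sup>+x. w x * ennreal_powr (h x) q \<partial>lebesgue)"
    by (rule nn_integral_cmult) measurable
  also have "ennreal (2 * q / (q - 1)) * (ennreal (2 powr (q - 1)) * (\<integral>\<^sup>+x. w x * ennreal_powr (h x) q \<partial>lebesgue))
     = ennreal (q / (q - 1) * 2 powr q) * (\<integral>\<^sup>+x. w x * ennreal_powr (h x) q \<partial>lebesgue)"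
  proof -
    have "2 * q / (q - 1) * 2 powr (q - 1) = q / (q - 1) * 2 powr q"
      using q by (simp add: powr_diff divide_simps)
    moreover have "ennreal (2 * q / (q - 1)) * ennreal (2 powr (q - 1)) = ennreal (2 * q / (q - 1) * 2 powr (q - 1))"
      using q by (intro ennreal_mult[symmetric]) auto
    ultimately show ?thesis
      by (simp only: mult.assoc[symmetric])
  qed
  finally show ?thesis .
qed

section \<open>Balls weighted by the critical radius; boundedness of the maximal operator\<close>

lemma locally_integrable_measurable:
  fixes f :: "'a::euclidean_space \<Rightarrow> real"
  assumes "locally_integrable f"
  shows "f \<in> borel_measurable lebesgue"
proof (rule borel_measurable_LIMSEQ_real)
  fix n :: nat
  have "f absolutely_integrable_on cball 0 (real n)"
    using assms by (simp add: locally_integrable_def)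
  then show "(\<lambda>x. indicator (cball 0 (real n)) x *\<^sub>R f x) \<in> borel_measurable lebesgue"
    unfolding set_integrable_def by (rule borel_measurable_integrable)
next
  fix x :: 'a
  obtain N :: nat where "norm x \<le> real N"
    using real_arch_simple by blast
  then have "\<forall>n\<ge>N. indicator (cball 0 (real n)) x *\<^sub>R f x = f x"
    by (auto simp: indicator_def)
  then show "(\<lambda>n. indicator (cball 0 (real n)) x *\<^sub>R f x) \<longlonglongrightarrow> f x"
    by (intro tendsto_eventually) (auto simp: eventually_sequentially)
qed

lemma locally_integrable_ball:
  fixes f :: "'a::euclidean_space \<Rightarrow> real"
  assumes "locally_integrable f"
  shows "ball_integral (\<lambda>x. ennreal \<bar>f x\<bar>) z r < \<infinity>"
proof -
  have "f absolutely_integrable_on cball z r"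
    using assms by (simp add: locally_integrable_def)
  then have "(\<integral>\<^sup>+x. ennreal (norm (indicator (cball z r) x *\<^sub>R f x)) \<partial>lebesgue) < \<infinity>"
    unfolding set_integrable_def integrable_iff_bounded by simp
  moreover have "ball_integral (\<lambda>x. ennreal \<bar>f x\<bar>) z r \<le> (\<integral>\<^sup>+x. ennreal (norm (indicator (cball z r) x *\<^sub>R f x)) \<partial>lebesgue)"
    by (intro nn_integral_mono) (auto simp: indicator_def)
  ultimately show ?thesis by simp
qed

lemma locally_integrableI:
  fixes f :: "'a::euclidean_space \<Rightarrow> real"
  assumes [measurable]: "f \<in> borel_measurable lebesgue" and "\<And>x. 0 \<le> f x"
    and fin: "\<And>r. 0 < r \<Longrightarrow> mass f 0 r < \<infinity>"
  shows "locally_integrable f"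
  unfolding locally_integrable_def
proof (intro allI impI)
  fix K :: "'a set" assume K: "compact K"
  then obtain r where r: "0 < r" "K \<subseteq> ball 0 r"
    using compact_imp_bounded bounded_subset_ballD by blast
  have [measurable]: "K \<in> sets lebesgue"
    using K by (simp add: compact_imp_closed)
  have "(\<integral>\<^sup>+x. ennreal (norm (indicator K x *\<^sub>R f x)) \<partial>lebesgue) \<le> mass f 0 r"
    using r assms by (intro nn_integral_mono) (auto simp: indicator_def)
  also have "\<dots> < \<infinity>" using fin r by simp
  finally show "f absolutely_integrable_on K"
    unfolding set_integrable_def integrable_iff_bounded by simp
qed

lemma weightD:
  assumes "weight \<omega>"
  shows "\<omega> \<in> borel_measurable lebesgue" "0 < \<omega> x" "0 \<le> \<omega> x"
    "mass \<omega> z r < \<infinity>"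
proof -
  have pos: "0 < \<omega> x" for x
    using assms by (simp add: weight_def)
  show "\<omega> \<in> borel_measurable lebesgue"
    using assms by (auto simp: weight_def intro: locally_integrable_measurable)
  show "0 < \<omega> x" "0 \<le> \<omega> x"
    using pos[of x] by simp_all
  show "mass \<omega> z r < \<infinity>"
    using locally_integrable_ball[of \<omega> z r] assms pos by (simp add: weight_def abs_of_pos)
qed

lemma nn_integral_ball_pos:
  fixes f :: "'a::euclidean_space \<Rightarrow> ennreal"
  assumes [measurable]: "f \<in> borel_measurable lebesgue" and "\<And>x. 0 < f x" "0 < r"
  shows "0 < ball_integral f z r"
proof (rule ccontr)
  assume "\<not> ?thesis"
  then have "ball_integral f z r = 0" by simp
  then have "AE x in lebesgue. f x * indicator (ball z r) x = 0"
    by (subst (asm) nn_integral_0_iff_AE) auto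
  then have "AE x in lebesgue. x \<notin> ball z r"
  proof (rule eventually_mono)
    fix x assume "f x * indicator (ball z r) x = 0"
    then show "x \<notin> ball z r"
      using assms(2)[of x] by (auto simp: indicator_def split: if_splits)
  qed
  then have "emeasure lebesgue (ball z r) = 0"
    by (subst (asm) AE_iff_measurable[of "ball z r"]) auto
  then show False
    using measure_lebesgue_ball_pos[OF assms(3), of z] by (simp add: emeasure_lebesgue_ball del: emeasure_completion)
qed

lemma weight_integral_real:
  assumes "weight \<omega>" "0 < r"
  obtains a where "0 < a" "mass \<omega> z r = ennreal a"
proof (cases "mass \<omega> z r")
  case (real a)
  moreover have "0 < mass \<omega> z r"
    using weightD(1,2)[OF assms(1)] assms(2) by (intro nn_integral_ball_pos) auto
  ultimately have "0 < a" by auto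
  with real that show ?thesis by blast
qed (use weightD(4)[OF assms(1), of z r] in simp)

section \<open>Averages and the maximal operator for a positive radius function\<close>

locale radius_function =
  fixes \<rho> :: "'a::euclidean_space \<Rightarrow> real"
  assumes rho_pos: "0 < \<rho> x"
begin

lemma Psi_ge_1: "0 \<le> \<theta> \<Longrightarrow> 0 \<le> r \<Longrightarrow> 1 \<le> Psi \<rho> \<theta> x r"
  unfolding Psi_def using rho_pos[of x] by (intro ge_one_powr_ge_zero) auto

lemma Psi_pos: "0 \<le> r \<Longrightarrow> 0 < Psi \<rho> \<theta> x r"
  unfolding Psi_def using rho_pos[of x] divide_nonneg_pos[of r "\<rho> x"]
  by (metis add.commute add_nonneg_eq_0_iff less_eq_real_def powr_gt_zero zero_le_one zero_neq_one)

lemma Psi_mono: "\<theta> \<le> \<theta>' \<Longrightarrow> 0 \<le> r \<Longrightarrow> Psi \<rho> \<theta> x r \<le> Psi \<rho> \<theta>' x r"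
  unfolding Psi_def using rho_pos[of x] by (intro powr_mono) auto

lemma Psi_scale:
  assumes "1 \<le> k" "0 \<le> \<theta>" "0 \<le> r"
  shows "Psi \<rho> \<theta> z (k * r) \<le> k powr \<theta> * Psi \<rho> \<theta> z r"
proof -
  have "0 \<le> r / \<rho> z"
    using assms rho_pos[of z] by simp
  moreover from this have "1 + k * r / \<rho> z \<le> k * (1 + r / \<rho> z)"
    using assms by (simp add: algebra_simps)
  moreover have "0 \<le> k * r / \<rho> z"
    using assms rho_pos[of z] by simp
  ultimately have "(1 + k * r / \<rho> z) powr \<theta> \<le> (k * (1 + r / \<rho> z)) powr \<theta>"
    using assms by (intro powr_mono2) (auto intro!: add_nonneg_nonneg)
  then show ?thesis
    unfolding Psi_def using assms \<open>0 \<le> r / \<rho> z\<close> by (simp add: powr_mult)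
qed

lemma denominator_pos: "0 < r \<Longrightarrow> 0 < Psi \<rho> \<theta> z r * vol z r"
  using Psi_pos[of r \<theta> z] measure_lebesgue_ball_pos[of r z] by simp

lemma maximal_ge:
  "0 < r \<Longrightarrow> x \<in> ball z r \<Longrightarrow> Psi_average \<rho> \<theta> z r f \<le> maximal \<rho> \<theta> f x"
  unfolding maximal_def by (intro SUP_upper2[of "(z, r)"]) auto

lemma maximal_le:
  "(\<And>z r. 0 < r \<Longrightarrow> x \<in> ball z r \<Longrightarrow> Psi_average \<rho> \<theta> z r f \<le> c) \<Longrightarrow> maximal \<rho> \<theta> f x \<le> c"
  unfolding maximal_def by (intro SUP_least) auto

lemma borel_measurable_maximal [measurable]: "maximal \<rho> \<theta> f \<in> borel_measurable lebesgue"
  using measurable_SUP_balls[of "\<lambda>z r. Psi_average \<rho> \<theta> z r f"]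
  by (simp add: maximal_def[abs_def])

lemma Psi_average_cong_AE:
  assumes "AE x in lebesgue. x \<in> ball z r \<longrightarrow> f x = g x"
  shows "Psi_average \<rho> \<theta> z r f = Psi_average \<rho> \<theta> z r g"
  unfolding Psi_average_def
  by (intro arg_cong2[where f = "(/)"] nn_integral_cong_AE refl eventually_mono[OF assms]) (auto simp: indicator_def)

lemma Psi_average_mono_AE:
  assumes "AE x in lebesgue. x \<in> ball z r \<longrightarrow> f x \<le> g x"
  shows "Psi_average \<rho> \<theta> z r f \<le> Psi_average \<rho> \<theta> z r g"
  unfolding Psi_average_def
  by (intro divide_right_mono_ennreal nn_integral_mono_AE eventually_mono[OF assms]) (auto simp: indicator_def)

lemma Psi_average_cmult:
  assumes "f \<in> borel_measurable lebesgue"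
  shows "Psi_average \<rho> \<theta> z r (\<lambda>x. c * f x) = c * Psi_average \<rho> \<theta> z r f"
  unfolding Psi_average_def using assms
  by (simp add: mult.assoc nn_integral_cmult ennreal_times_divide)

lemma Psi_average_mono_theta:
  assumes "\<theta> \<le> \<theta>'" "0 < r"
  shows "Psi_average \<rho> \<theta>' z r f \<le> Psi_average \<rho> \<theta> z r f"
proof -
  have "Psi \<rho> \<theta> z r * vol z r \<le> Psi \<rho> \<theta>' z r * vol z r"
    using assms by (intro mult_right_mono Psi_mono) auto
  then have "inverse (ennreal (Psi \<rho> \<theta>' z r * vol z r)) \<le> inverse (ennreal (Psi \<rho> \<theta> z r * vol z r))"
    using denominator_pos[OF assms(2), of \<theta> z] denominator_pos[OF assms(2), of \<theta>' z]
    by (simp only: inverse_ennreal) (intro ennreal_leI le_imp_inverse_le)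
  then show ?thesis
    unfolding Psi_average_def divide_ennreal_def by (intro mult_left_mono) auto
qed

lemma maximal_mono_theta:
  assumes "\<theta> \<le> \<theta>'"
  shows "maximal \<rho> \<theta>' f x \<le> maximal \<rho> \<theta> f x"
  using assms by (intro maximal_le order_trans[OF Psi_average_mono_theta maximal_ge]) auto

lemma maximal_mono_AE:
  assumes "AE x in lebesgue. f x \<le> g x"
  shows "maximal \<rho> \<theta> f x \<le> maximal \<rho> \<theta> g x"
  by (intro maximal_le order_trans[OF Psi_average_mono_AE maximal_ge])
    (use assms in \<open>auto elim: eventually_mono\<close>)

text \<open>Monotone convergence on each single ball. It carries the iteration for the factorization
  to its limit.\<close>

lemma maximal_SUP:
  fixes f :: "nat \<Rightarrow> 'a \<Rightarrow> ennreal"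
  assumes [measurable]: "\<And>k. f k \<in> borel_measurable lebesgue" and "incseq f"
  shows "maximal \<rho> \<theta> (\<lambda>x. SUP k. f k x) x \<le> (SUP k. maximal \<rho> \<theta> (f k) x)"
proof (rule maximal_le)
  fix z r assume zr: "0 < r" "x \<in> ball z r"
  have "ball_integral (\<lambda>y. SUP k. f k y) z r = (\<integral>\<^sup>+y. (SUP k. f k y * indicator (ball z r) y) \<partial>lebesgue)"
    by (simp add: SUP_mult_right_ennreal)
  also have "\<dots> = (SUP k. ball_integral (f k) z r)"
    using assms(2) by (intro nn_integral_monotone_convergence_SUP)
      (auto simp: incseq_def le_fun_def intro!: mult_right_mono)
  finally have "Psi_average \<rho> \<theta> z r (\<lambda>x. SUP k. f k x) = (SUP k. Psi_average \<rho> \<theta> z r (f k))"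
    by (simp add: Psi_average_def SUP_divide_ennreal)
  also have "\<dots> \<le> (SUP k. maximal \<rho> \<theta> (f k) x)"
    using zr by (intro SUP_mono' maximal_ge)
  finally show "Psi_average \<rho> \<theta> z r (\<lambda>x. SUP k. f k x) \<le> (SUP k. maximal \<rho> \<theta> (f k) x)" .
qed

text \<open>The denominators of the two averages enter with the powers 1 and p - 1. Cleared to a
  single p-th power on the right, the condition involves no extended division.\<close>

lemma Ap_condition_alt:
  assumes "1 < p" "0 \<le> C"
  shows "(\<forall>z r. 0 < r \<longrightarrow>
     Psi_average \<rho> \<theta> z r (\<lambda>y. ennreal (\<omega> y))
       * ennreal_powr (Psi_average \<rho> \<theta> z r (\<lambda>y. ennreal (\<omega> y powr (- 1 / (p - 1))))) (p - 1) \<le> ennreal C)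
   \<longleftrightarrow> (\<forall>z r. 0 < r \<longrightarrow> mass \<omega> z r
       * ennreal_powr (mass (\<lambda>y. \<omega> y powr (- 1 / (p - 1))) z r) (p - 1)
     \<le> ennreal (C * (Psi \<rho> \<theta> z r * vol z r) powr p))"
proof -
  have "Psi_average \<rho> \<theta> z r f * ennreal_powr (Psi_average \<rho> \<theta> z r g) (p - 1) \<le> ennreal C \<longleftrightarrow>
      ball_integral f z r * ennreal_powr (ball_integral g z r) (p - 1)
       \<le> ennreal (C * (Psi \<rho> \<theta> z r * vol z r) powr p)"
    if "0 < r" for z r f g
  proof -
    define D where "D = Psi \<rho> \<theta> z r * vol z r"
    define X where "X = ball_integral f z r * ennreal_powr (ball_integral g z r) (p - 1)"
    have D: "0 < D" unfolding D_def by (rule denominator_pos[OF that])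
    have Dp: "D powr p = D * D powr (p - 1)"
      using D by (simp add: powr_diff)
    have "Psi_average \<rho> \<theta> z r f * ennreal_powr (Psi_average \<rho> \<theta> z r g) (p - 1) = X / ennreal (D powr p)"
    proof -
      have "inverse (ennreal (D * D powr (p - 1))) = inverse (ennreal D) * inverse (ennreal (D powr (p - 1)))"
        using D by (simp add: inverse_ennreal flip: ennreal_mult)
      moreover have "ennreal_powr (Psi_average \<rho> \<theta> z r g) (p - 1) =
          ennreal_powr (ball_integral g z r) (p - 1) * inverse (ennreal (D powr (p - 1)))"
        unfolding Psi_average_def D_def[symmetric] using D assms
        by (subst ennreal_powr_divide) (simp_all only: divide_ennreal_def diff_gt_0_iff_gt)
      ultimately show ?thesis
        unfolding Dp X_def by (simp only: Psi_average_def D_def[symmetric] divide_ennreal_def mult_ac)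
    qed
    moreover have "X / ennreal (D powr p) \<le> ennreal C \<longleftrightarrow> X \<le> ennreal (C * D powr p)"
    proof (cases X)
      case (real a)
      then show ?thesis
        using D assms by (simp add: divide_ennreal divide_le_eq)
    next
      case top
      then show ?thesis using D
        by (auto simp: ennreal_top_divide top_unique)
    qed
    ultimately show ?thesis unfolding X_def D_def by simp
  qed
  then show ?thesis by simp
qed

lemma Ap_condition_iff:
  assumes "1 < p"
  shows "Ap_condition \<rho> p \<theta> \<omega> \<longleftrightarrow> (\<exists>C\<ge>0. \<forall>z r. 0 < r \<longrightarrow> mass \<omega> z r
       * ennreal_powr (mass (\<lambda>y. \<omega> y powr (- 1 / (p - 1))) z r) (p - 1)
     \<le> ennreal (C * (Psi \<rho> \<theta> z r * vol z r) powr p))"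
proof -
  let ?P = "\<lambda>C. \<forall>z r. 0 < r \<longrightarrow>
     Psi_average \<rho> \<theta> z r (\<lambda>y. ennreal (\<omega> y))
       * ennreal_powr (Psi_average \<rho> \<theta> z r (\<lambda>y. ennreal (\<omega> y powr (- 1 / (p - 1))))) (p - 1) \<le> ennreal C"
  \<comment> \<open>A negative constant acts as 0, because \<open>ennreal\<close> sends negative
    reals to 0.\<close>
  have "?P (max 0 C)" if "?P C" for C
  proof -
    have "ennreal (max 0 C) = ennreal C"
      by (auto simp: max_def ennreal_neg)
    with that show ?thesis by simp
  qed
  then have "(\<exists>C. ?P C) \<longleftrightarrow> (\<exists>C\<ge>0. ?P C)"
    by (metis max.cobounded1)
  also have "\<dots> \<longleftrightarrow> (\<exists>C\<ge>0. \<forall>z r. 0 < r \<longrightarrow> mass \<omega> z r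
       * ennreal_powr (mass (\<lambda>y. \<omega> y powr (- 1 / (p - 1))) z r) (p - 1)
     \<le> ennreal (C * (Psi \<rho> \<theta> z r * vol z r) powr p))"
    using Ap_condition_alt[OF assms] by (intro ex_cong1 conj_cong refl) blast
  finally show ?thesis unfolding Ap_condition_def .
qed

text \<open>Local integrability is forced by the A_p bound: the mass of \<omega> on a ball is
  positive, so an infinite dual mass would make the product infinite.\<close>

lemma weight_dual:
  assumes \<omega>: "weight \<omega>" and p: "1 < p" and Ap: "Ap_condition \<rho> p \<theta> \<omega>"
  shows "weight (\<lambda>x. \<omega> x powr (- 1 / (p - 1)))"
proof -
  note [measurable] = weightD(1)[OF \<omega>]
  have pos: "0 < \<omega> x" for x by (rule weightD(2)[OF \<omega>])
  obtain C where C: "\<And>z r. 0 < r \<Longrightarrow> mass \<omega> z r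
       * ennreal_powr (mass (\<lambda>y. \<omega> y powr (- 1 / (p - 1))) z r) (p - 1)
     \<le> ennreal (C * (Psi \<rho> \<theta> z r * vol z r) powr p)"
    using Ap unfolding Ap_condition_iff[OF p] by blast
  have "locally_integrable (\<lambda>x. \<omega> x powr (- 1 / (p - 1)))"
  proof (rule locally_integrableI)
    fix r :: real assume r: "0 < r"
    show "mass (\<lambda>x. \<omega> x powr (- 1 / (p - 1))) 0 r < \<infinity>"
    proof (rule ccontr)
      assume "\<not> ?thesis"
      moreover obtain a where "0 < a" "mass \<omega> 0 r = ennreal a"
        using weight_integral_real[OF \<omega> r] by blast
      ultimately show False
        using C[OF r, of 0] by (simp add: not_less top_unique ennreal_mult_top)
    qed
  qed auto
  moreover have "0 < \<omega> x powr (- 1 / (p - 1))" for x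
    using pos[of x] by simp
  ultimately show ?thesis
    by (simp only: weight_def) simp
qed

lemma dual_powr:
  fixes a p :: real
  assumes "0 < a" "1 < p"
  shows "(a powr (- 1 / (p - 1))) powr (1 - p) = a"
proof -
  have "- 1 / (p - 1) * (1 - p) = 1" using assms by (simp add: field_simps)
  then show ?thesis using assms by (simp add: powr_powr)
qed

text \<open>Lerner's pointwise bound: \<open>(\<integral>\<^sub>B f / \<sigma>(5B))\<^sup>p\<^sup>-\<^sup>1\<close> is at most the infimum over \<open>B\<close> of
  \<open>(vitali_maximal \<sigma> f)\<^sup>p\<^sup>-\<^sup>1\<close>, and the \<open>A\<^sub>p\<close> condition on \<open>5B\<close> turns the remaining factor
  into an average over \<open>B\<close> with denominator \<open>\<omega>(5B)\<close>.\<close>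

lemma maximal_le_vitali_maximal:
  assumes \<omega>: "weight \<omega>" and p: "1 < p" and \<theta>: "0 \<le> \<theta>" and Ap: "Ap_condition \<rho> p \<theta> \<omega>"
  defines "\<sigma> \<equiv> \<lambda>x. \<omega> x powr (- 1 / (p - 1))"
  shows "\<exists>K\<ge>0. \<forall>f\<in>borel_measurable lebesgue. \<forall>x.
    ennreal_powr (maximal \<rho> (\<theta> * p / (p - 1)) f x) (p - 1)
      \<le> ennreal K * vitali_maximal (\<lambda>y. ennreal (\<omega> y)) (\<lambda>y. ennreal_powr (vitali_maximal (\<lambda>y. ennreal (\<sigma> y)) f y) (p - 1)) x"
proof -
  have \<sigma>: "weight \<sigma>"
    unfolding \<sigma>_def by (rule weight_dual[OF \<omega> p Ap])
  obtain C where C0: "0 \<le> C" and C: "\<And>z r. 0 < r \<Longrightarrow> mass \<omega> z r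
       * ennreal_powr (mass \<sigma> z r) (p - 1)
     \<le> ennreal (C * (Psi \<rho> \<theta> z r * vol z r) powr p)"
    using Ap unfolding Ap_condition_iff[OF p] \<sigma>_def by blast
  let ?n = "DIM('a)"
  \<comment> \<open>Dilation by 5 costs at most \<open>5 powr \<theta>\<close> in \<open>Psi\<close>
    and \<open>5 ^ ?n\<close> in volume; the A_p condition takes the p-th power of both.\<close>
  define K where "K = C * (5 powr \<theta> * 5 ^ ?n) powr p"
  show ?thesis
  proof (intro exI[of _ K] conjI ballI allI)
    show "0 \<le> K" using C0 by (simp add: K_def)
    fix f :: "'a \<Rightarrow> ennreal" and x assume [measurable]: "f \<in> borel_measurable lebesgue"
    let ?\<theta> = "\<theta> * p / (p - 1)"
    let ?G = "\<lambda>y. ennreal_powr (vitali_maximal (\<lambda>y. ennreal (\<sigma> y)) f y) (p - 1)"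
    \<comment> \<open>With the root moved to the right, the supremum can be bounded ball by
      ball.\<close>
    have le_iff: "ennreal_powr (maximal \<rho> ?\<theta> f x) (p - 1) \<le> c \<longleftrightarrow> maximal \<rho> ?\<theta> f x \<le> ennreal_powr c (1 / (p - 1))" for c
      using p by (intro ennreal_powr_le_iff) auto
    show "ennreal_powr (maximal \<rho> ?\<theta> f x) (p - 1) \<le> ennreal K * vitali_maximal (\<lambda>y. ennreal (\<omega> y)) ?G x"
      unfolding le_iff
    proof (rule maximal_le)
      fix z r assume r: "0 < r" and xB: "x \<in> ball z r"
      define m where "m = vol z r"
      define F where "F = ball_integral f z r"
      define \<psi> where "\<psi> = Psi \<rho> \<theta> z r"
      have m: "0 < m" unfolding m_def by (rule measure_lebesgue_ball_pos[OF r])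
      have \<psi>: "0 < \<psi>" unfolding \<psi>_def using r by (simp add: Psi_pos)
      from r have r5: "0 < 5 * r" by simp
      obtain w where w: "0 < w" "mass \<omega> z (5 * r) = ennreal w"
        using weight_integral_real[OF \<omega> r5] by blast
      obtain s where s: "0 < s" "mass \<sigma> z (5 * r) = ennreal s"
        using weight_integral_real[OF \<sigma> r5] by blast
      have "w * s powr (p - 1) \<le> C * (Psi \<rho> \<theta> z (5 * r) * vol z (5 * r)) powr p"
        using C[OF r5, of z] w s C0 by (simp add: ennreal_powr_ennreal flip: ennreal_mult)
      also have "\<dots> \<le> C * ((5 powr \<theta> * \<psi>) * (5 ^ ?n * m)) powr p"
      proof (intro mult_left_mono powr_mono2 mult_mono)
        show "Psi \<rho> \<theta> z (5 * r) \<le> 5 powr \<theta> * \<psi>"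
          unfolding \<psi>_def using \<theta> r by (intro Psi_scale) auto
        show "vol z (5 * r) \<le> 5 ^ ?n * m"
          unfolding m_def using r by (subst measure_lebesgue_ball_scale[where x = z]) auto
      qed (use C0 p r \<psi> m in \<open>auto simp: less_imp_le Psi_pos\<close>)
      also have "\<dots> = K * (\<psi> powr p * m powr p)"
        using \<psi> m by (simp add: K_def powr_mult mult_ac)
      finally have ws: "w * s powr (p - 1) \<le> K * (\<psi> powr p * m powr p)" .
      \<comment> \<open>This identity determines the parameter \<theta> p / (p - 1): its factor,
        raised to p - 1, must match the p-th power in the A_p condition.\<close>
      have \<psi>': "Psi \<rho> ?\<theta> z r powr (p - 1) = \<psi> powr p"
        using p by (simp add: \<psi>_def Psi_def powr_powr)
      have "Psi_average \<rho> ?\<theta> z r f = F / ennreal (Psi \<rho> ?\<theta> z r * m)"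
        by (simp add: Psi_average_def F_def m_def)
      then have "ennreal_powr (Psi_average \<rho> ?\<theta> z r f) (p - 1) = ennreal_powr F (p - 1) / ennreal ((Psi \<rho> ?\<theta> z r * m) powr (p - 1))"
        using p m Psi_pos[of r ?\<theta> z] r by (simp add: ennreal_powr_divide)
      also have "(Psi \<rho> ?\<theta> z r * m) powr (p - 1) = \<psi> powr p * m powr (p - 1)"
        using p m Psi_pos[of r ?\<theta> z] r \<psi>' by (simp add: powr_mult)
      also have "ennreal_powr F (p - 1) / ennreal (\<psi> powr p * m powr (p - 1))
          = ennreal_powr F (p - 1) * ennreal (1 / (\<psi> powr p * m powr (p - 1)))"
        using \<psi> m by (simp add: divide_ennreal_def inverse_ennreal inverse_eq_divide)
      also have "\<dots> \<le> ennreal_powr F (p - 1) * ennreal (K * m / (s powr (p - 1) * w))"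
      proof (intro mult_left_mono ennreal_leI)
        have "m powr p = m * m powr (p - 1)"
          using m by (simp add: powr_diff)
        then show "1 / (\<psi> powr p * m powr (p - 1)) \<le> K * m / (s powr (p - 1) * w)"
          using ws \<psi> m s w by (simp add: divide_simps mult_ac)
      qed auto
      also have "\<dots> = ennreal K * ((ennreal_powr (F / ennreal s) (p - 1) * ennreal m) / ennreal w)"
      proof -
        have "ennreal (K * m / (s powr (p - 1) * w)) = ennreal K * (inverse (ennreal (s powr (p - 1))) * ennreal m * inverse (ennreal w))"
          using C0 m s w by (simp add: inverse_ennreal K_def field_simps flip: ennreal_mult)
        moreover have "ennreal_powr (F / ennreal s) (p - 1) = ennreal_powr F (p - 1) * inverse (ennreal (s powr (p - 1)))"
          using s p by (subst ennreal_powr_divide) (simp_all only: divide_ennreal_def diff_gt_0_iff_gt)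
        ultimately show ?thesis
          by (simp only: divide_ennreal_def mult_ac)
      qed
      also have "\<dots> \<le> ennreal K * vitali_maximal (\<lambda>y. ennreal (\<omega> y)) ?G x"
      proof (intro mult_left_mono)
        \<comment> \<open>\<open>F / ennreal s\<close> is among the quotients in the supremum at
          every point of the ball, so the constant lies below \<open>?G\<close> on the whole ball
          and may be replaced by it under the integral.\<close>
        have "ennreal_powr (F / ennreal s) (p - 1) * ennreal m = ball_integral (\<lambda>y. ennreal_powr (F / ennreal s) (p - 1)) z r"
          by (subst nn_integral_cmult_indicator) (auto simp: m_def emeasure_lebesgue_ball simp del: emeasure_completion)
        also have "\<dots> \<le> ball_integral ?G z r"
        proof (intro nn_integral_mono)
          fix y
          show "ennreal_powr (F / ennreal s) (p - 1) * indicator (ball z r) y \<le> ?G y * indicator (ball z r) y"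
            using vitali_maximal_ge[OF r, of y z f "\<lambda>y. ennreal (\<sigma> y)"] p
            by (auto simp: indicator_def F_def s(2)[symmetric] intro!: ennreal_powr_mono)
        qed
        finally have "(ennreal_powr (F / ennreal s) (p - 1) * ennreal m) / ennreal w \<le> ball_integral ?G z r / ennreal w"
          by (rule divide_right_mono_ennreal)
        also have "\<dots> \<le> vitali_maximal (\<lambda>y. ennreal (\<omega> y)) ?G x"
          unfolding w(2)[symmetric] by (rule vitali_maximal_ge[OF r xB])
        finally show "(ennreal_powr (F / ennreal s) (p - 1) * ennreal m) / ennreal w \<le> vitali_maximal (\<lambda>y. ennreal (\<omega> y)) ?G x" .
      qed auto
      finally show "Psi_average \<rho> ?\<theta> z r f \<le> ennreal_powr (ennreal K * vitali_maximal (\<lambda>y. ennreal (\<omega> y)) ?G x) (1 / (p - 1))"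
        using p by (subst ennreal_powr_le_iff[symmetric]) auto
    qed
  qed
qed

lemma ennreal_mult_inverse_weight:
  "0 < a \<Longrightarrow> x * ennreal (1 / a) * ennreal a = x"
  by (simp add: mult.assoc flip: ennreal_mult)

text \<open>M^p is the p'-th power of M^(p-1). The pointwise bound is followed by the strong type of
  the \<omega>-operator at exponent p' and then of the \<sigma>-operator at exponent p. The
  identities \<omega>^(1-p') = \<sigma> and \<sigma>^(1-p) = \<omega> change the weight between the
  two and back at the end.\<close>

lemma maximal_strong_type:
  assumes \<omega>: "weight \<omega>" and p: "1 < p" and \<theta>: "0 \<le> \<theta>" and Ap: "Ap_condition \<rho> p \<theta> \<omega>"
  shows "\<exists>C\<ge>0. \<forall>f\<in>borel_measurable lebesgue.
    (\<integral>\<^sup>+x. ennreal (\<omega> x) * ennreal_powr (maximal \<rho> (\<theta> * p / (p - 1)) f x) p \<partial>lebesgue)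
      \<le> ennreal C * (\<integral>\<^sup>+x. ennreal (\<omega> x) * ennreal_powr (f x) p \<partial>lebesgue)"
proof -
  define \<sigma> where "\<sigma> = (\<lambda>x. \<omega> x powr (- 1 / (p - 1)))"
  define p' where "p' = p / (p - 1)"
  have p': "1 < p'" "(p - 1) * p' = p" "1 - p' = - 1 / (p - 1)"
    using p by (simp_all add: p'_def field_simps)
  have \<sigma>: "weight \<sigma>"
    unfolding \<sigma>_def by (rule weight_dual[OF \<omega> p Ap])
  note [measurable] = weightD(1)[OF \<omega>] weightD(1)[OF \<sigma>]
  have \<omega>_pos: "0 < \<omega> x" and \<sigma>_pos: "0 < \<sigma> x" for x
    using weightD(2)[OF \<omega>] weightD(2)[OF \<sigma>] by auto
  obtain K where K: "0 \<le> K" "\<And>f x. f \<in> borel_measurable lebesgue \<Longrightarrow>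
    ennreal_powr (maximal \<rho> (\<theta> * p / (p - 1)) f x) (p - 1)
      \<le> ennreal K * vitali_maximal (\<lambda>y. ennreal (\<omega> y)) (\<lambda>y. ennreal_powr (vitali_maximal (\<lambda>y. ennreal (\<sigma> y)) f y) (p - 1)) x"
    using maximal_le_vitali_maximal[OF \<omega> p \<theta> Ap] unfolding \<sigma>_def by blast
  define C1 where "C1 = p' / (p' - 1) * 2 powr p'"
  define C2 where "C2 = p / (p - 1) * 2 powr p"
  show ?thesis
  proof (intro exI[of _ "K powr p' * (C1 * C2)"] conjI ballI)
    show "0 \<le> K powr p' * (C1 * C2)"
      using p p' by (simp add: C1_def C2_def)
    fix f :: "'a \<Rightarrow> ennreal" assume [measurable]: "f \<in> borel_measurable lebesgue"
    let ?N\<sigma> = "vitali_maximal (\<lambda>y. ennreal (\<sigma> y)) f"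
    let ?G = "\<lambda>y. ennreal_powr (?N\<sigma> y) (p - 1)"
    \<comment> \<open>Dividing by the weights brings \<open>?G\<close> and \<open>f\<close> into the
      density form of \<open>vitali_maximal_strong_type\<close>.\<close>
    let ?h = "\<lambda>y. ?G y * ennreal (1 / \<omega> y)"
    let ?k = "\<lambda>y. f y * ennreal (1 / \<sigma> y)"
    let ?N\<omega> = "vitali_maximal (\<lambda>y. ennreal (\<omega> y)) (\<lambda>y. ?h y * ennreal (\<omega> y))"
    have hG: "(\<lambda>y. ?h y * ennreal (\<omega> y)) = ?G"
      using \<omega>_pos by (intro ext ennreal_mult_inverse_weight)
    have kf: "(\<lambda>y. ?k y * ennreal (\<sigma> y)) = f"
      using \<sigma>_pos by (intro ext ennreal_mult_inverse_weight)
    have "(\<integral>\<^sup>+x. ennreal (\<omega> x) * ennreal_powr (maximal \<rho> (\<theta> * p / (p - 1)) f x) p \<partial>lebesgue)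
      \<le> (\<integral>\<^sup>+x. ennreal (K powr p') * (ennreal (\<omega> x) * ennreal_powr (?N\<omega> x) p') \<partial>lebesgue)"
    proof (intro nn_integral_mono)
      fix x
      have "ennreal_powr (maximal \<rho> (\<theta> * p / (p - 1)) f x) p = ennreal_powr (ennreal_powr (maximal \<rho> (\<theta> * p / (p - 1)) f x) (p - 1)) p'"
        by (simp add: ennreal_powr_powr p')
      also have "\<dots> \<le> ennreal_powr (ennreal K * ?N\<omega> x) p'"
        unfolding hG using p' by (intro ennreal_powr_mono K(2)) auto
      also have "\<dots> = ennreal (K powr p') * ennreal_powr (?N\<omega> x) p'"
        using p' K(1) by (simp add: ennreal_powr_mult ennreal_powr_ennreal)
      finally show "ennreal (\<omega> x) * ennreal_powr (maximal \<rho> (\<theta> * p / (p - 1)) f x) p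
          \<le> ennreal (K powr p') * (ennreal (\<omega> x) * ennreal_powr (?N\<omega> x) p')"
        by (subst mult.left_commute) (intro mult_left_mono, auto)
    qed
    also have "\<dots> = ennreal (K powr p') * (\<integral>\<^sup>+x. ennreal (\<omega> x) * ennreal_powr (?N\<omega> x) p' \<partial>lebesgue)"
      by (rule nn_integral_cmult) measurable
    also have "\<dots> \<le> ennreal (K powr p') * (ennreal C1 * (\<integral>\<^sup>+x. ennreal (\<omega> x) * ennreal_powr (?h x) p' \<partial>lebesgue))"
      unfolding C1_def using p' by (intro mult_left_mono vitali_maximal_strong_type) auto
    also have "(\<integral>\<^sup>+x. ennreal (\<omega> x) * ennreal_powr (?h x) p' \<partial>lebesgue) =
        (\<integral>\<^sup>+x. ennreal (\<sigma> x) * ennreal_powr (vitali_maximal (\<lambda>y. ennreal (\<sigma> y)) (\<lambda>y. ?k y * ennreal (\<sigma> y)) x) p \<partial>lebesgue)"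
      unfolding kf
    proof (intro nn_integral_cong)
      fix x
      have "ennreal (\<omega> x) * ennreal ((1 / \<omega> x) powr p') = ennreal (\<omega> x powr (1 - p'))"
        using \<omega>_pos[of x] by (simp add: powr_diff powr_divide flip: ennreal_mult)
      also have "\<dots> = ennreal (\<sigma> x)"
        by (simp add: \<sigma>_def p')
      finally have *: "ennreal (\<omega> x) * ennreal ((1 / \<omega> x) powr p') = ennreal (\<sigma> x)" .
      have "ennreal_powr (?h x) p' = ennreal_powr (?N\<sigma> x) p * ennreal ((1 / \<omega> x) powr p')"
        using \<omega>_pos[of x] p' by (simp add: ennreal_powr_mult ennreal_powr_ennreal ennreal_powr_powr)
      then have "ennreal (\<omega> x) * ennreal_powr (?h x) p' = (ennreal (\<omega> x) * ennreal ((1 / \<omega> x) powr p')) * ennreal_powr (?N\<sigma> x) p"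
        by (simp only: mult_ac)
      then show "ennreal (\<omega> x) * ennreal_powr (?h x) p' = ennreal (\<sigma> x) * ennreal_powr (?N\<sigma> x) p"
        by (simp only: *)
    qed
    also have "\<dots> \<le> ennreal C2 * (\<integral>\<^sup>+x. ennreal (\<sigma> x) * ennreal_powr (?k x) p \<partial>lebesgue)"
      unfolding C2_def using p by (intro vitali_maximal_strong_type) auto
    also have "(\<integral>\<^sup>+x. ennreal (\<sigma> x) * ennreal_powr (?k x) p \<partial>lebesgue) = (\<integral>\<^sup>+x. ennreal (\<omega> x) * ennreal_powr (f x) p \<partial>lebesgue)"
    proof (intro nn_integral_cong)
      fix x
      have "ennreal (\<sigma> x) * ennreal ((1 / \<sigma> x) powr p) = ennreal (\<sigma> x powr (1 - p))"
        using \<sigma>_pos[of x] by (simp add: powr_diff powr_divide flip: ennreal_mult)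
      also have "\<dots> = ennreal (\<omega> x)"
        unfolding \<sigma>_def by (subst dual_powr[OF \<omega>_pos p]) (rule refl)
      finally have *: "ennreal (\<sigma> x) * ennreal ((1 / \<sigma> x) powr p) = ennreal (\<omega> x)" .
      have "ennreal_powr (?k x) p = ennreal_powr (f x) p * ennreal ((1 / \<sigma> x) powr p)"
        using \<sigma>_pos[of x] p by (simp add: ennreal_powr_mult ennreal_powr_ennreal)
      then have "ennreal (\<sigma> x) * ennreal_powr (?k x) p = (ennreal (\<sigma> x) * ennreal ((1 / \<sigma> x) powr p)) * ennreal_powr (f x) p"
        by (simp only: mult_ac)
      then show "ennreal (\<sigma> x) * ennreal_powr (?k x) p = ennreal (\<omega> x) * ennreal_powr (f x) p"
        by (simp only: *)
    qed
    finally have "(\<integral>\<^sup>+x. ennreal (\<omega> x) * ennreal_powr (maximal \<rho> (\<theta> * p / (p - 1)) f x) p \<partial>lebesgue)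
      \<le> ennreal (K powr p') * (ennreal C1 * (ennreal C2 * (\<integral>\<^sup>+x. ennreal (\<omega> x) * ennreal_powr (f x) p \<partial>lebesgue)))"
      by (simp add: mult_left_mono)
    moreover have "ennreal (K powr p' * (C1 * C2)) = ennreal (K powr p') * (ennreal C1 * ennreal C2)"
    proof -
      have "0 \<le> C1" "0 \<le> C2" using p p' by (simp_all add: C1_def C2_def)
      then show ?thesis by (simp add: ennreal_mult)
    qed
    ultimately show "(\<integral>\<^sup>+x. ennreal (\<omega> x) * ennreal_powr (maximal \<rho> (\<theta> * p / (p - 1)) f x) p \<partial>lebesgue)
      \<le> ennreal (K powr p' * (C1 * C2)) * (\<integral>\<^sup>+x. ennreal (\<omega> x) * ennreal_powr (f x) p \<partial>lebesgue)"
      by (simp only: mult.assoc)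
  qed
qed

end

section \<open>Elementary properties of the weight classes\<close>

text \<open>Raising the A_p product to the power 1 / (p - 1) = p' - 1 exchanges its two factors and
  turns the p-th power of the denominator into the p'-th.\<close>

lemma (in radius_function) Ap_condition_dual:
  assumes \<omega>: "weight \<omega>" and p: "1 < p" and Ap: "Ap_condition \<rho> p \<theta> \<omega>"
  shows "Ap_condition \<rho> (p / (p - 1)) \<theta> (\<lambda>x. \<omega> x powr (- 1 / (p - 1)))"
proof -
  define p' where "p' = p / (p - 1)"
  have p': "1 < p'" "p' - 1 = 1 / (p - 1)" "- 1 / (p' - 1) = 1 - p"
    using p by (simp_all add: p'_def field_simps)
  have pos: "0 < \<omega> x" for x by (rule weightD(2)[OF \<omega>])
  have undual: "(\<omega> x powr (- 1 / (p - 1))) powr (- 1 / (p' - 1)) = \<omega> x" for x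
    unfolding p'(3) by (rule dual_powr[OF pos p])
  obtain C where C0: "0 \<le> C" and C: "\<And>z r. 0 < r \<Longrightarrow> mass \<omega> z r
       * ennreal_powr (mass (\<lambda>y. \<omega> y powr (- 1 / (p - 1))) z r) (p - 1)
     \<le> ennreal (C * (Psi \<rho> \<theta> z r * vol z r) powr p)"
    using Ap unfolding Ap_condition_iff[OF p] by blast
  have "Ap_condition \<rho> p' \<theta> (\<lambda>x. \<omega> x powr (- 1 / (p - 1)))"
    unfolding Ap_condition_iff[OF p'(1)] undual
  proof (intro exI[of _ "C powr (1 / (p - 1))"] conjI allI impI)
    fix z r assume r: "0 < (r::real)"
    let ?W = "mass \<omega> z r"
    let ?S = "mass (\<lambda>y. \<omega> y powr (- 1 / (p - 1))) z r"
    let ?D = "Psi \<rho> \<theta> z r * vol z r"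
    have D: "0 < ?D" by (rule denominator_pos[OF r])
    have "?S * ennreal_powr ?W (p' - 1) = ennreal_powr (?W * ennreal_powr ?S (p - 1)) (1 / (p - 1))"
      using p by (simp add: ennreal_powr_mult ennreal_powr_powr p' mult.commute)
    also have "\<dots> \<le> ennreal_powr (ennreal (C * ?D powr p)) (1 / (p - 1))"
      using p by (intro ennreal_powr_mono C r) auto
    also have "\<dots> = ennreal (C powr (1 / (p - 1)) * ?D powr p')"
      using C0 D by (simp only: ennreal_powr_ennreal mult_nonneg_nonneg powr_ge_zero powr_mult powr_powr)
        (simp add: p'_def)
    finally show "?S * ennreal_powr ?W (p' - 1) \<le> ennreal (C powr (1 / (p - 1)) * ?D powr p')" .
  qed simp
  then show ?thesis by (simp add: p'_def)
qed

text \<open>One implication applied twice: the second application takes the dual weight at p' back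
  to \<omega> at p.\<close>

lemma (in radius_function) A_class_dual:
  assumes p: "1 < p" "1 / p + 1 / p' = 1" and pos: "\<And>x. 0 < \<omega> x"
  shows "\<omega> \<in> A_class \<rho> p \<theta> \<longleftrightarrow> (\<lambda>x. \<omega> x powr (- 1 / (p - 1))) \<in> A_class \<rho> p' \<theta>"
proof -
  have "p' \<noteq> 0"
    using p by auto
  then have p'1: "p' = p / (p - 1)"
    using p by (simp add: field_simps)
  have p': "1 < p'" "- 1 / (p' - 1) = 1 - p" "p' / (p' - 1) = p"
    unfolding p'1 using p by (simp_all add: field_simps)
  have undual: "(\<lambda>x. (\<omega> x powr (- 1 / (p - 1))) powr (- 1 / (p' - 1))) = \<omega>"
    unfolding p'(2) using dual_powr[OF pos p(1)] by simp
  have dir: "(\<lambda>x. v x powr (- 1 / (q - 1))) \<in> A_class \<rho> (q / (q - 1)) \<theta>" if "1 < q" "v \<in> A_class \<rho> q \<theta>" for q v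
  proof -
    have v: "weight v" "Ap_condition \<rho> q \<theta> v"
      using that by (auto simp: A_class_def)
    have "1 < q / (q - 1)"
      using that by (simp add: field_simps)
    then show ?thesis
      using weight_dual[OF v(1) that(1) v(2)] Ap_condition_dual[OF v(1) that(1) v(2)] unfolding A_class_def by blast
  qed
  show ?thesis
    using dir[OF p(1), of \<omega>] dir[OF p'(1), of "\<lambda>x. \<omega> x powr (- 1 / (p - 1))"]
    unfolding undual p'(3) p'1[symmetric] by blast
qed

context radius_function
begin

section \<open>A_1 weights, products of their powers, and inclusions\<close>

lemma A1_conditionD:
  assumes "A1_condition \<rho> \<theta> (\<lambda>x. ennreal (\<omega> x))"
  obtains C where "1 \<le> C" "AE x in lebesgue. maximal \<rho> \<theta> (\<lambda>x. ennreal (\<omega> x)) x \<le> ennreal C * ennreal (\<omega> x)"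
proof -
  obtain C :: real where C: "AE x in lebesgue. maximal \<rho> \<theta> (\<lambda>x. ennreal (\<omega> x)) x \<le> ennreal C * ennreal (\<omega> x)"
    using assms by (auto simp: A1_condition_def)
  show ?thesis
  proof (rule that)
    show "AE x in lebesgue. maximal \<rho> \<theta> (\<lambda>x. ennreal (\<omega> x)) x \<le> ennreal (max 1 C) * ennreal (\<omega> x)"
      by (rule eventually_mono[OF C]) (rule order_trans, assumption, intro mult_right_mono ennreal_leI, auto)
  qed simp
qed

lemma Psi_average_less_topD:
  "0 < r \<Longrightarrow> Psi_average \<rho> \<theta> z r f < top \<Longrightarrow> ball_integral f z r < top"
  using denominator_pos[of r \<theta> z]
  by (cases "ball_integral f z r") (simp_all add: Psi_average_def ennreal_top_divide)

text \<open>Local integrability comes with the A_1 inequality: a single point where the maximal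
  function is finite makes the mass of every ball containing it finite.\<close>

lemma A1_classI:
  fixes \<omega> :: "'a \<Rightarrow> real"
  assumes [measurable]: "\<omega> \<in> borel_measurable lebesgue" and pos: "\<And>x. 0 < \<omega> x"
    and C: "AE x in lebesgue. maximal \<rho> \<theta> (\<lambda>x. ennreal (\<omega> x)) x \<le> ennreal C * ennreal (\<omega> x)"
  shows "\<omega> \<in> A_class \<rho> 1 \<theta>"
proof -
  have "locally_integrable \<omega>"
  proof (rule locally_integrableI)
    fix r :: real assume r: "0 < r"
    have "\<exists>x. maximal \<rho> \<theta> (\<lambda>x. ennreal (\<omega> x)) x \<le> ennreal C * ennreal (\<omega> x)"
    proof (rule ccontr)
      assume "\<not> ?thesis"
      with C have "AE x in (lebesgue :: 'a measure). False"
        by (auto elim: eventually_mono)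
      then have "emeasure lebesgue (UNIV :: 'a set) = 0"
        by (subst (asm) AE_iff_measurable[of UNIV]) auto
      then show False by simp
    qed
    then obtain x where x: "maximal \<rho> \<theta> (\<lambda>x. ennreal (\<omega> x)) x \<le> ennreal C * ennreal (\<omega> x)" ..
    \<comment> \<open>A ball about the origin that contains both \<open>ball 0 r\<close> and the
      point of finiteness.\<close>
    define R where "R = r + norm x + 1"
    have R: "0 < R" "x \<in> ball 0 R" "ball 0 r \<subseteq> ball (0::'a) R"
      using r norm_ge_zero[of x] by (auto simp: R_def simp del: norm_ge_zero)
    have "Psi_average \<rho> \<theta> 0 R (\<lambda>x. ennreal (\<omega> x)) \<le> ennreal C * ennreal (\<omega> x)"
      using maximal_ge[OF R(1,2)] x by (rule order_trans)
    also have "\<dots> < top"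
      by (simp add: ennreal_mult_less_top)
    finally have "mass \<omega> 0 R < top"
      by (rule Psi_average_less_topD[OF R(1)])
    moreover have "mass \<omega> 0 r \<le> mass \<omega> 0 R"
      using R(3) by (intro nn_integral_mono) (auto simp: indicator_def)
    ultimately show "mass \<omega> 0 r < \<infinity>"
      by (simp add: order_le_less_trans)
  qed (auto simp: less_imp_le pos)
  then show ?thesis
    using assms by (auto simp: A_class_def weight_def A1_condition_def)
qed

lemma A_class_1_mono:
  assumes "\<omega> \<in> A_class \<rho> 1 \<theta>" "\<theta> \<le> \<theta>'"
  shows "\<omega> \<in> A_class \<rho> 1 \<theta>'"
proof -
  have \<omega>: "weight \<omega>" "A1_condition \<rho> \<theta> (\<lambda>x. ennreal (\<omega> x))"
    using assms by (auto simp: A_class_def)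
  obtain C where "AE x in lebesgue. maximal \<rho> \<theta> (\<lambda>x. ennreal (\<omega> x)) x \<le> ennreal C * ennreal (\<omega> x)"
    using A1_conditionD[OF \<omega>(2)] by blast
  then have "AE x in lebesgue. maximal \<rho> \<theta>' (\<lambda>x. ennreal (\<omega> x)) x \<le> ennreal C * ennreal (\<omega> x)"
    by (rule eventually_mono) (rule order_trans[OF maximal_mono_theta[OF assms(2)]])
  then show ?thesis
    using weightD(1,2)[OF \<omega>(1)] by (intro A1_classI)
qed

lemma one_in_A_class_1:
  assumes "0 \<le> \<theta>"
  shows "(\<lambda>_. 1) \<in> A_class \<rho> 1 \<theta>"
proof (rule A1_classI)
  have "maximal \<rho> \<theta> (\<lambda>x. ennreal 1) x \<le> ennreal 1 * ennreal 1" for x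
  proof (rule maximal_le)
    fix z r assume r: "0 < (r::real)"
    have "Psi_average \<rho> \<theta> z r (\<lambda>x. ennreal 1) = ennreal (vol z r) / ennreal (Psi \<rho> \<theta> z r * vol z r)"
      unfolding Psi_average_def by (simp add: emeasure_lebesgue_ball del: emeasure_completion)
    also have "\<dots> = ennreal (1 / Psi \<rho> \<theta> z r)"
      using denominator_pos[OF r, of \<theta> z] measure_lebesgue_ball_pos[OF r, of z] Psi_pos[of r \<theta> z] r
      by (subst divide_ennreal) (auto simp: field_simps)
    also have "\<dots> \<le> ennreal 1"
      using Psi_ge_1[OF assms, of r z] r by (intro ennreal_leI) (simp add: divide_le_eq_1)
    finally show "Psi_average \<rho> \<theta> z r (\<lambda>x. ennreal 1) \<le> ennreal 1 * ennreal 1" by simp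
  qed
  then show "AE x in lebesgue. maximal \<rho> \<theta> (\<lambda>x. ennreal 1) x \<le> ennreal 1 * ennreal 1"
    by simp
qed auto

lemma weight_Psi_average_real:
  assumes "weight \<omega>" "0 < r"
  obtains a where "0 < a" "Psi_average \<rho> \<theta> z r (\<lambda>x. ennreal (\<omega> x)) = ennreal a"
proof -
  obtain b where b: "0 < b" "mass \<omega> z r = ennreal b"
    using weight_integral_real[OF assms] by blast
  then show ?thesis
    using denominator_pos[OF assms(2), of \<theta> z]
    by (intro that[of "b / (Psi \<rho> \<theta> z r * vol z r)"]) (auto simp: Psi_average_def divide_ennreal)
qed

text \<open>On a ball an A_1 weight is almost everywhere at least its average divided by its
  constant, so a factor with negative exponent is at most a power of an average. One such factor is
  pulled out of each of the two averages in the A_p product, and then all averages cancel.\<close>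

lemma A1_mult_A1_powr:
  assumes \<omega>1: "\<omega>1 \<in> A_class \<rho> 1 \<theta>" and \<omega>2: "\<omega>2 \<in> A_class \<rho> 1 \<theta>" and p: "1 < p"
  shows "(\<lambda>x. \<omega>1 x * \<omega>2 x powr (1 - p)) \<in> A_class \<rho> p \<theta>"
proof -
  let ?\<omega> = "\<lambda>x. \<omega>1 x * \<omega>2 x powr (1 - p)"
  have w1: "weight \<omega>1" "A1_condition \<rho> \<theta> (\<lambda>x. ennreal (\<omega>1 x))"
    and w2: "weight \<omega>2" "A1_condition \<rho> \<theta> (\<lambda>x. ennreal (\<omega>2 x))"
    using \<omega>1 \<omega>2 by (auto simp: A_class_def)
  note [measurable] = weightD(1)[OF w1(1)] weightD(1)[OF w2(1)]
  have pos1: "0 < \<omega>1 x" and pos2: "0 < \<omega>2 x" for x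
    using weightD(2)[OF w1(1)] weightD(2)[OF w2(1)] by auto
  obtain C1 where C1: "1 \<le> C1" "AE x in lebesgue. maximal \<rho> \<theta> (\<lambda>x. ennreal (\<omega>1 x)) x \<le> ennreal C1 * ennreal (\<omega>1 x)"
    using A1_conditionD[OF w1(2)] by blast
  obtain C2 where C2: "1 \<le> C2" "AE x in lebesgue. maximal \<rho> \<theta> (\<lambda>x. ennreal (\<omega>2 x)) x \<le> ennreal C2 * ennreal (\<omega>2 x)"
    using A1_conditionD[OF w2(2)] by blast
  \<comment> \<open>Finiteness of the first average is carried along because local integrability of
    the product follows from it.\<close>
  have main: "Psi_average \<rho> \<theta> z r (\<lambda>x. ennreal (?\<omega> x)) < top \<and>
      Psi_average \<rho> \<theta> z r (\<lambda>y. ennreal (?\<omega> y))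
       * ennreal_powr (Psi_average \<rho> \<theta> z r (\<lambda>y. ennreal (?\<omega> y powr (- 1 / (p - 1))))) (p - 1)
      \<le> ennreal (C2 powr (p - 1) * C1)" if r: "0 < r" for z r
  proof -
    obtain a1 where a1: "0 < a1" "Psi_average \<rho> \<theta> z r (\<lambda>x. ennreal (\<omega>1 x)) = ennreal a1"
      using weight_Psi_average_real[OF w1(1) r] by blast
    obtain a2 where a2: "0 < a2" "Psi_average \<rho> \<theta> z r (\<lambda>x. ennreal (\<omega>2 x)) = ennreal a2"
      using weight_Psi_average_real[OF w2(1) r] by blast
    have low: "AE x in lebesgue. x \<in> ball z r \<longrightarrow> a / C \<le> v x"
      if C: "1 \<le> C" "AE x in lebesgue. maximal \<rho> \<theta> (\<lambda>x. ennreal (v x)) x \<le> ennreal C * ennreal (v x)"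
        and a: "Psi_average \<rho> \<theta> z r (\<lambda>x. ennreal (v x)) = ennreal a" and v: "\<And>x. 0 < v x" for v a C
    proof (rule eventually_mono[OF C(2)], rule impI)
      fix x assume "maximal \<rho> \<theta> (\<lambda>x. ennreal (v x)) x \<le> ennreal C * ennreal (v x)" "x \<in> ball z r"
      then have "ennreal a \<le> ennreal C * ennreal (v x)"
        using maximal_ge[OF r, of x z \<theta> "\<lambda>x. ennreal (v x)"] a by (simp add: order_trans)
      then show "a / C \<le> v x"
        using C v[of x] by (simp add: field_simps flip: ennreal_mult)
    qed
    note low1 = low[OF C1 a1(2) pos1] and low2 = low[OF C2 a2(2) pos2]
    have "Psi_average \<rho> \<theta> z r (\<lambda>x. ennreal (?\<omega> x)) \<le> Psi_average \<rho> \<theta> z r (\<lambda>x. ennreal ((a2 / C2) powr (1 - p)) * ennreal (\<omega>1 x))"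
    proof (rule Psi_average_mono_AE, rule eventually_mono[OF low2], rule impI)
      fix x assume "x \<in> ball z r \<longrightarrow> a2 / C2 \<le> \<omega>2 x" "x \<in> ball z r"
      then have "\<omega>2 x powr (1 - p) \<le> (a2 / C2) powr (1 - p)"
        using p a2 C2 by (intro powr_mono2') auto
      then show "ennreal (?\<omega> x) \<le> ennreal ((a2 / C2) powr (1 - p)) * ennreal (\<omega>1 x)"
        using pos1[of x] by (simp add: mult.commute mult_left_mono flip: ennreal_mult)
    qed
    also have "\<dots> = ennreal ((a2 / C2) powr (1 - p) * a1)"
      using a1 by (subst Psi_average_cmult) (auto simp: ennreal_mult)
    finally have avg1: "Psi_average \<rho> \<theta> z r (\<lambda>x. ennreal (?\<omega> x)) \<le> ennreal ((a2 / C2) powr (1 - p) * a1)" .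
    have "Psi_average \<rho> \<theta> z r (\<lambda>x. ennreal (?\<omega> x powr (- 1 / (p - 1)))) \<le> Psi_average \<rho> \<theta> z r (\<lambda>x. ennreal ((a1 / C1) powr (- 1 / (p - 1))) * ennreal (\<omega>2 x))"
    proof (rule Psi_average_mono_AE, rule eventually_mono[OF low1], rule impI)
      fix x assume "x \<in> ball z r \<longrightarrow> a1 / C1 \<le> \<omega>1 x" "x \<in> ball z r"
      then have "\<omega>1 x powr (- 1 / (p - 1)) \<le> (a1 / C1) powr (- 1 / (p - 1))"
        using p a1 C1 by (intro powr_mono2') auto
      moreover have "?\<omega> x powr (- 1 / (p - 1)) = \<omega>1 x powr (- 1 / (p - 1)) * \<omega>2 x"
      proof -
        have "(1 - p) * (- 1 / (p - 1)) = 1" using p by (simp add: field_simps)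
        then show ?thesis using pos1[of x] pos2[of x] by (simp only: powr_mult powr_powr powr_one less_imp_le)
      qed
      ultimately show "ennreal (?\<omega> x powr (- 1 / (p - 1))) \<le> ennreal ((a1 / C1) powr (- 1 / (p - 1))) * ennreal (\<omega>2 x)"
        using pos2[of x] by (simp add: mult_right_mono flip: ennreal_mult)
    qed
    also have "\<dots> = ennreal ((a1 / C1) powr (- 1 / (p - 1)) * a2)"
      using a2 by (subst Psi_average_cmult) (auto simp: ennreal_mult)
    finally have "ennreal_powr (Psi_average \<rho> \<theta> z r (\<lambda>x. ennreal (?\<omega> x powr (- 1 / (p - 1))))) (p - 1)
        \<le> ennreal_powr (ennreal ((a1 / C1) powr (- 1 / (p - 1)) * a2)) (p - 1)"
      using p by (intro ennreal_powr_mono) auto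
    also have "\<dots> = ennreal ((a1 / C1) powr (- 1) * a2 powr (p - 1))"
    proof -
      have "- 1 / (p - 1) * (p - 1) = - 1" using p by simp
      then show ?thesis
        using a1 a2 C1 by (simp only: ennreal_powr_ennreal mult_nonneg_nonneg powr_ge_zero less_imp_le powr_mult powr_powr)
    qed
    finally have avg2: "ennreal_powr (Psi_average \<rho> \<theta> z r (\<lambda>x. ennreal (?\<omega> x powr (- 1 / (p - 1))))) (p - 1)
        \<le> ennreal ((a1 / C1) powr (- 1) * a2 powr (p - 1))" .
    have "ennreal ((a2 / C2) powr (1 - p) * a1) * ennreal ((a1 / C1) powr (- 1) * a2 powr (p - 1))
        = ennreal ((a2 / C2) powr (1 - p) * a1 * ((a1 / C1) powr (- 1) * a2 powr (p - 1)))"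
      using a1 by (intro ennreal_mult[symmetric]) auto
    also have "(a2 / C2) powr (1 - p) * a1 * ((a1 / C1) powr (- 1) * a2 powr (p - 1)) = C2 powr (p - 1) * C1"
      using a1 a2 C1 C2 by (simp add: powr_divide powr_diff powr_minus field_simps)
    finally show ?thesis
      using mult_mono[OF avg1 avg2] avg1 by (auto simp: le_less_trans)
  qed
  have pos: "0 < ?\<omega> x" for x
    using pos1[of x] pos2[of x] by simp
  have "locally_integrable ?\<omega>"
  proof (rule locally_integrableI)
    fix r :: real assume r: "0 < r"
    show "mass ?\<omega> 0 r < \<infinity>"
      using main[OF r, of 0] Psi_average_less_topD[OF r] by auto
  qed (auto simp: less_imp_le pos)
  moreover have "Ap_condition \<rho> p \<theta> ?\<omega>"
    unfolding Ap_condition_def using main by blast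
  ultimately show ?thesis
    using p pos unfolding A_class_def weight_def by blast
qed

text \<open>For p1 = 1 take the constant 1 as second factor in \<open>A1_mult_A1_powr\<close>. For
  p1 > 1 Jensen's inequality for the dual factor, with exponent (p2 - 1) / (p1 - 1), leaves a
  surplus |B|^(p2-p1); the higher power of the denominator absorbs it, since \<open>Psi\<close> is
  at least 1.\<close>

lemma A_class_mono:
  assumes p: "1 \<le> p1" "p1 < p2" and \<theta>: "0 \<le> \<theta>" and \<omega>: "\<omega> \<in> A_class \<rho> p1 \<theta>"
  shows "\<omega> \<in> A_class \<rho> p2 \<theta>"
proof (cases "p1 = 1")
  case True
  then show ?thesis
    using A1_mult_A1_powr[OF _ one_in_A_class_1[OF \<theta>], of \<omega> p2] p \<omega> by simp
next
  case False
  with p have p1: "1 < p1" by simp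
  with p have p2: "1 < p2" by simp
  have w: "weight \<omega>" "Ap_condition \<rho> p1 \<theta> \<omega>"
    using \<omega> p1 by (auto simp: A_class_def)
  note [measurable] = weightD(1)[OF w(1)]
  obtain C where C0: "0 \<le> C" and C: "\<And>z r. 0 < r \<Longrightarrow> mass \<omega> z r
       * ennreal_powr (mass (\<lambda>y. \<omega> y powr (- 1 / (p1 - 1))) z r) (p1 - 1)
     \<le> ennreal (C * (Psi \<rho> \<theta> z r * vol z r) powr p1)"
    using w unfolding Ap_condition_iff[OF p1] by blast
  define q where "q = (p2 - 1) / (p1 - 1)"
  have q: "1 \<le> q" "q * (p1 - 1) = p2 - 1" "- 1 / (p2 - 1) * q = - 1 / (p1 - 1)"
    using p p1 by (simp_all add: q_def field_simps)
  have "Ap_condition \<rho> p2 \<theta> \<omega>"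
    unfolding Ap_condition_iff[OF p2]
  proof (intro exI[of _ C] conjI allI impI C0)
    fix z r assume r: "0 < (r::real)"
    let ?W = "mass \<omega> z r"
    let ?S = "\<lambda>p. mass (\<lambda>y. \<omega> y powr (- 1 / (p - 1))) z r"
    define m where "m = vol z r"
    define D where "D = Psi \<rho> \<theta> z r * m"
    have m: "0 < m" unfolding m_def by (rule measure_lebesgue_ball_pos[OF r])
    have mD: "m \<le> D"
      unfolding D_def using m Psi_ge_1[OF \<theta>, of r z] r by simp
    have "ennreal_powr (?S p2) q \<le> ennreal (m powr (q - 1)) *
        ball_integral (\<lambda>y. ennreal_powr (ennreal (\<omega> y powr (- 1 / (p2 - 1)))) q) z r"
      using m q by (intro nn_integral_power_mean) (auto simp: emeasure_lebesgue_ball m_def simp del: emeasure_completion)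
    also have "ball_integral (\<lambda>y. ennreal_powr (ennreal (\<omega> y powr (- 1 / (p2 - 1)))) q) z r = ?S p1"
      by (simp only: ennreal_powr_ennreal powr_ge_zero powr_powr q(3))
    finally have S: "ennreal_powr (?S p2) q \<le> ennreal (m powr (q - 1)) * ?S p1" .
    have "ennreal_powr (?S p2) (p2 - 1) = ennreal_powr (ennreal_powr (?S p2) q) (p1 - 1)"
      by (simp only: ennreal_powr_powr q(2))
    also have "\<dots> \<le> ennreal_powr (ennreal (m powr (q - 1)) * ?S p1) (p1 - 1)"
      using p1 by (intro ennreal_powr_mono S) auto
    also have "\<dots> = ennreal (m powr (p2 - p1)) * ennreal_powr (?S p1) (p1 - 1)"
    proof -
      have "(q - 1) * (p1 - 1) = p2 - p1"
        using q(2) by (simp add: algebra_simps)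
      then show ?thesis
        using p1 by (simp only: ennreal_powr_mult ennreal_powr_ennreal powr_ge_zero powr_powr diff_gt_0_iff_gt)
    qed
    also have "\<dots> \<le> ennreal (D powr (p2 - p1)) * ennreal_powr (?S p1) (p1 - 1)"
      using m mD p by (intro mult_right_mono ennreal_leI powr_mono2) auto
    finally have "?W * ennreal_powr (?S p2) (p2 - 1) \<le> ?W * (ennreal (D powr (p2 - p1)) * ennreal_powr (?S p1) (p1 - 1))"
      by (rule mult_left_mono) simp
    also have "\<dots> = ennreal (D powr (p2 - p1)) * (?W * ennreal_powr (?S p1) (p1 - 1))"
      by (simp only: mult_ac)
    also have "\<dots> \<le> ennreal (D powr (p2 - p1)) * ennreal (C * D powr p1)"
      unfolding D_def m_def by (intro mult_left_mono C r) auto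
    also have "\<dots> = ennreal (C * D powr p2)"
      using C0 m mD by (simp add: powr_diff flip: ennreal_mult)
    finally show "?W * ennreal_powr (?S p2) (p2 - 1) \<le> ennreal (C * (Psi \<rho> \<theta> z r * vol z r) powr p2)"
      unfolding D_def m_def .
  qed
  then show ?thesis
    using w p2 by (auto simp: A_class_def)
qed

end

section \<open>Factorization\<close>

lemma ennreal_powr_weight_cancel:
  fixes a :: real
  assumes "0 < a" "0 < p"
  shows "ennreal (a powr (- (b * p))) * ennreal_powr (ennreal_powr x (1 / p) * ennreal (a powr b)) p = x"
proof -
  have "ennreal_powr (ennreal_powr x (1 / p) * ennreal (a powr b)) p = x * ennreal (a powr (b * p))"
    using assms by (simp add: ennreal_powr_mult ennreal_powr_powr ennreal_powr_ennreal powr_powr)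
  moreover have "ennreal (a powr (- (b * p))) * ennreal (a powr (b * p)) = 1"
    using assms by (simp add: powr_minus flip: ennreal_mult)
  ultimately show ?thesis
    by (metis mult.left_commute mult.right_neutral)
qed

context radius_function
begin

text \<open>The summand of the factorization operator: it is bounded on \<open>L\<^sup>1\<close> as soon as the
  maximal operator is bounded on \<open>L\<^sup>p\<close> with weight \<open>a\<^sup>-\<^sup>b\<^sup>p\<close>.\<close>

definition maximal_powr :: "real \<Rightarrow> real \<Rightarrow> real \<Rightarrow> ('a \<Rightarrow> real) \<Rightarrow> ('a \<Rightarrow> ennreal) \<Rightarrow> 'a \<Rightarrow> ennreal" where
  "maximal_powr \<theta> p b a u x =
     ennreal (a x powr (- (b * p))) * ennreal_powr (maximal \<rho> \<theta> (\<lambda>y. ennreal_powr (u y) (1 / p) * ennreal (a y powr b)) x) p"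

lemma borel_measurable_maximal_powr [measurable]:
  "a \<in> borel_measurable lebesgue \<Longrightarrow> maximal_powr \<theta> p b a u \<in> borel_measurable lebesgue"
  unfolding maximal_powr_def[abs_def]
  by (intro borel_measurable_times_ennreal borel_measurable_ennreal_powr borel_measurable_maximal
      measurable_compose[OF _ measurable_ennreal] powr_real_measurable borel_measurable_const) auto

lemma maximal_powr_mono:
  assumes "\<And>x. u x \<le> v x" "0 < p"
  shows "maximal_powr \<theta> p b a u x \<le> maximal_powr \<theta> p b a v x"
  unfolding maximal_powr_def using assms
  by (intro mult_left_mono ennreal_powr_mono maximal_mono_AE AE_I2 mult_right_mono) auto

lemma maximal_powr_SUP:
  fixes u :: "nat \<Rightarrow> 'a \<Rightarrow> ennreal"
  assumes [measurable]: "\<And>k. u k \<in> borel_measurable lebesgue" "a \<in> borel_measurable lebesgue"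
    and inc: "incseq u" and p: "0 < p"
  shows "maximal_powr \<theta> p b a (\<lambda>x. SUP k. u k x) x \<le> (SUP k. maximal_powr \<theta> p b a (u k) x)"
proof -
  let ?f = "\<lambda>k y. ennreal_powr (u k y) (1 / p) * ennreal (a y powr b)"
  have "maximal \<rho> \<theta> (\<lambda>y. ennreal_powr (SUP k. u k y) (1 / p) * ennreal (a y powr b)) x
      = maximal \<rho> \<theta> (\<lambda>y. SUP k. ?f k y) x"
    using p by (simp add: ennreal_powr_SUP SUP_mult_right_ennreal)
  also have "\<dots> \<le> (SUP k. maximal \<rho> \<theta> (?f k) x)"
  proof (rule maximal_SUP)
    show "incseq ?f"
      using inc p by (auto simp: incseq_def le_fun_def intro!: mult_right_mono ennreal_powr_mono)
  qed measurable
  finally have "maximal_powr \<theta> p b a (\<lambda>x. SUP k. u k x) x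
      \<le> ennreal (a x powr (- (b * p))) * ennreal_powr (SUP k. maximal \<rho> \<theta> (?f k) x) p"
    unfolding maximal_powr_def using p by (intro mult_left_mono ennreal_powr_mono) auto
  then show ?thesis
    using p by (simp add: ennreal_powr_SUP SUP_mult_left_ennreal maximal_powr_def)
qed

text \<open>The weighted L^p bound is applied to u^(1/p) a^b, whose weighted p-th power is
  \<open>u\<close> itself. Passing from \<theta>' to a larger \<theta> lets two such operators share
  one parameter.\<close>

lemma maximal_powr_bounded:
  assumes C: "\<forall>f\<in>borel_measurable lebesgue.
      (\<integral>\<^sup>+x. ennreal (a x powr (- (b * p))) * ennreal_powr (maximal \<rho> \<theta>' f x) p \<partial>lebesgue)
      \<le> ennreal C * (\<integral>\<^sup>+x. ennreal (a x powr (- (b * p))) * ennreal_powr (f x) p \<partial>lebesgue)"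
    and \<theta>: "\<theta>' \<le> \<theta>" and p: "0 < p" and pos: "\<And>x. 0 < a x"
    and [measurable]: "u \<in> borel_measurable lebesgue" "a \<in> borel_measurable lebesgue"
  shows "(\<integral>\<^sup>+x. maximal_powr \<theta> p b a u x \<partial>lebesgue) \<le> ennreal C * (\<integral>\<^sup>+x. u x \<partial>lebesgue)"
proof -
  let ?f = "\<lambda>y. ennreal_powr (u y) (1 / p) * ennreal (a y powr b)"
  have "(\<integral>\<^sup>+x. maximal_powr \<theta> p b a u x \<partial>lebesgue)
      \<le> (\<integral>\<^sup>+x. ennreal (a x powr (- (b * p))) * ennreal_powr (maximal \<rho> \<theta>' ?f x) p \<partial>lebesgue)"
    unfolding maximal_powr_def using p
    by (intro nn_integral_mono mult_left_mono ennreal_powr_mono maximal_mono_theta \<theta>) auto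
  also have "\<dots> \<le> ennreal C * (\<integral>\<^sup>+x. ennreal (a x powr (- (b * p))) * ennreal_powr (?f x) p \<partial>lebesgue)"
    using C by (rule bspec) measurable
  also have "(\<integral>\<^sup>+x. ennreal (a x powr (- (b * p))) * ennreal_powr (?f x) p \<partial>lebesgue) = (\<integral>\<^sup>+x. u x \<partial>lebesgue)"
    using pos p by (intro nn_integral_cong ennreal_powr_weight_cancel)
  finally show ?thesis .
qed

text \<open>A positive integrable fixed point of \<open>u \<mapsto> g + c (T\<^sub>1 u + T\<^sub>2 u)\<close>. Monotone iteration
  only needs monotonicity and continuity along increasing sequences, not sublinearity.\<close>

lemma exists_dominating_function:
  fixes T1 T2 :: "('a \<Rightarrow> ennreal) \<Rightarrow> 'a \<Rightarrow> ennreal"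
  assumes meas1: "\<And>u. T1 u \<in> borel_measurable lebesgue" and meas2: "\<And>u. T2 u \<in> borel_measurable lebesgue"
    and mono1: "\<And>u v x. (\<And>x. u x \<le> v x) \<Longrightarrow> T1 u x \<le> T1 v x"
    and mono2: "\<And>u v x. (\<And>x. u x \<le> v x) \<Longrightarrow> T2 u x \<le> T2 v x"
    and SUP1: "\<And>u x. (\<And>k. u k \<in> borel_measurable lebesgue) \<Longrightarrow> incseq u \<Longrightarrow> T1 (\<lambda>x. SUP k::nat. u k x) x \<le> (SUP k. T1 (u k) x)"
    and SUP2: "\<And>u x. (\<And>k. u k \<in> borel_measurable lebesgue) \<Longrightarrow> incseq u \<Longrightarrow> T2 (\<lambda>x. SUP k::nat. u k x) x \<le> (SUP k. T2 (u k) x)"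
    and bound1: "\<And>u. u \<in> borel_measurable lebesgue \<Longrightarrow> (\<integral>\<^sup>+x. T1 u x \<partial>lebesgue) \<le> ennreal A1 * (\<integral>\<^sup>+x. u x \<partial>lebesgue)"
    and bound2: "\<And>u. u \<in> borel_measurable lebesgue \<Longrightarrow> (\<integral>\<^sup>+x. T2 u x \<partial>lebesgue) \<le> ennreal A2 * (\<integral>\<^sup>+x. u x \<partial>lebesgue)"
    and A: "0 \<le> A1" "0 \<le> A2"
  shows "\<exists>u\<in>borel_measurable lebesgue. \<exists>c>0. (\<forall>x. 0 < u x) \<and> (AE x in lebesgue. u x < top) \<and>
    (\<forall>x. ennreal c * T1 u x \<le> u x \<and> ennreal c * T2 u x \<le> u x)"
proof -
  interpret sigma_finite_measure "lebesgue :: 'a measure" by (rule sigma_finite_lebesgue)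
  \<comment> \<open>A strictly positive start makes the limit positive everywhere; its integrability
    makes the limit finite almost everywhere.\<close>
  obtain g :: "'a \<Rightarrow> ennreal" where [measurable]: "g \<in> borel_measurable lebesgue"
    and g: "(\<integral>\<^sup>+x. g x \<partial>lebesgue) \<noteq> \<infinity>" "\<And>x. 0 < g x"
    using Ex_finite_integrable_function by auto
  \<comment> \<open>Small enough for 2 c (A1 + A2) \<le> 1, so that the bound by twice the integral
    of \<open>g\<close> reproduces itself in each step.\<close>
  define c where "c = 1 / (2 * (A1 + A2 + 1))"
  have c: "0 < c" using A by (simp add: c_def)
  define u where "u = rec_nat (\<lambda>_. 0) (\<lambda>_ v x. g x + ennreal c * (T1 v x + T2 v x))"
  have u_0: "u 0 = (\<lambda>_. 0)" and u_Suc: "u (Suc k) = (\<lambda>x. g x + ennreal c * (T1 (u k) x + T2 (u k) x))" for k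
    by (simp_all add: u_def)
  have meas [measurable]: "u k \<in> borel_measurable lebesgue" for k
  proof (cases k)
    case (Suc j)
    note [measurable] = meas1[of "u j"] meas2[of "u j"]
    show ?thesis unfolding Suc u_Suc by measurable
  qed (simp add: u_0)
  have step: "u k x \<le> u (Suc k) x" for k x
  proof (induction k arbitrary: x)
    case (Suc k)
    have "u (Suc k) x = g x + ennreal c * (T1 (u k) x + T2 (u k) x)"
      by (rule fun_cong[OF u_Suc])
    also have "\<dots> \<le> g x + ennreal c * (T1 (u (Suc k)) x + T2 (u (Suc k)) x)"
      by (intro add_left_mono mult_left_mono add_mono mono1[OF Suc.IH] mono2[OF Suc.IH]) auto
    also have "\<dots> = u (Suc (Suc k)) x"
      by (rule fun_cong[OF u_Suc, symmetric])
    finally show ?case .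
  qed (simp add: u_0)
  have inc: "incseq u"
    by (rule incseq_SucI) (simp add: le_fun_def step)
  have int: "(\<integral>\<^sup>+x. u k x \<partial>lebesgue) \<le> 2 * (\<integral>\<^sup>+x. g x \<partial>lebesgue)" for k
  proof (induction k)
    case (Suc k)
    note [measurable] = meas1[of "u k"] meas2[of "u k"]
    let ?I = "\<integral>\<^sup>+x. g x \<partial>lebesgue"
    have "(\<integral>\<^sup>+x. u (Suc k) x \<partial>lebesgue) = ?I + ennreal c * ((\<integral>\<^sup>+x. T1 (u k) x \<partial>lebesgue) + (\<integral>\<^sup>+x. T2 (u k) x \<partial>lebesgue))"
      by (simp add: u_Suc nn_integral_add nn_integral_cmult)
    also have "\<dots> \<le> ?I + ennreal c * (ennreal A1 * (2 * ?I) + ennreal A2 * (2 * ?I))"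
      by (intro add_left_mono mult_left_mono add_mono order_trans[OF bound1] order_trans[OF bound2] Suc.IH) auto
    also have "ennreal c * (ennreal A1 * (2 * ?I) + ennreal A2 * (2 * ?I)) = (ennreal c * ((ennreal A1 + ennreal A2) * ennreal 2)) * ?I"
      by (simp add: algebra_simps)
    also have "ennreal c * ((ennreal A1 + ennreal A2) * ennreal 2) = ennreal (c * ((A1 + A2) * 2))"
      using A c by (simp add: ennreal_mult ennreal_plus distrib_right del: ennreal_numeral)
    also have "?I + ennreal (c * ((A1 + A2) * 2)) * ?I \<le> ?I + ennreal 1 * ?I"
      using A by (intro add_left_mono mult_right_mono ennreal_leI) (auto simp: c_def field_simps)
    also have "\<dots> = 2 * ?I"
      by (simp add: mult_2)
    finally show ?case .
  qed (simp add: u_0)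
  define v where "v = (\<lambda>x. SUP k. u k x)"
  have [measurable]: "v \<in> borel_measurable lebesgue"
    unfolding v_def by measurable
  have u_v: "u k x \<le> v x" for k x
    unfolding v_def by (rule SUP_upper) simp
  have "(\<integral>\<^sup>+x. v x \<partial>lebesgue) = (SUP k. \<integral>\<^sup>+x. u k x \<partial>lebesgue)"
    unfolding v_def by (rule nn_integral_monotone_convergence_SUP[OF inc meas])
  also have "\<dots> \<le> 2 * (\<integral>\<^sup>+x. g x \<partial>lebesgue)"
    by (intro SUP_least int)
  also have "\<dots> < \<infinity>"
    using g(1) by (simp add: ennreal_mult_less_top less_top)
  finally have "AE x in lebesgue. v x \<noteq> \<infinity>"
    by (intro nn_integral_PInf_AE) auto
  then have "AE x in lebesgue. v x < top"
    by (rule eventually_mono) (simp add: less_top)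
  moreover have "0 < v x" for x
  proof -
    have "0 < g x" by (rule g(2))
    also have "\<dots> \<le> u (Suc 0) x" by (simp add: u_Suc)
    also have "\<dots> \<le> v x" by (rule u_v)
    finally show ?thesis .
  qed
  \<comment> \<open>One limit argument for \<open>T1\<close> and \<open>T2\<close>, each being at
    most their sum.\<close>
  moreover have "ennreal c * T v x \<le> v x"
    if SUP: "T v x \<le> (SUP k. T (u k) x)" and le: "\<And>k. T (u k) x \<le> T1 (u k) x + T2 (u k) x" for T x
  proof -
    have "ennreal c * T v x \<le> ennreal c * (SUP k. T (u k) x)"
      by (intro mult_left_mono SUP) auto
    also have "\<dots> = (SUP k. ennreal c * T (u k) x)"
      by (rule SUP_mult_left_ennreal)
    also have "\<dots> \<le> v x"
    proof (rule SUP_least)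
      fix k
      have "ennreal c * T (u k) x \<le> u (Suc k) x"
        unfolding u_Suc by (rule order_trans[OF _ add_increasing[OF zero_le order_refl]]) (intro mult_left_mono le, auto)
      then show "ennreal c * T (u k) x \<le> v x"
        using u_v by (rule order_trans)
    qed
    finally show ?thesis .
  qed
  then have "ennreal c * T1 v x \<le> v x \<and> ennreal c * T2 v x \<le> v x" for x
    using SUP1[OF meas inc, of x] SUP2[OF meas inc, of x] unfolding v_def[symmetric] by simp
  ultimately show ?thesis
    using c \<open>v \<in> borel_measurable lebesgue\<close> by blast
qed

text \<open>Taking the p-th root in the domination of \<open>u\<close> gives the A_1 inequality for
  u^(1/p) a^b. Identifying \<open>v\<close> with this function almost everywhere suffices, because
  averages ignore null sets; \<open>u\<close> itself may be infinite on a null set.\<close>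

lemma A1_from_maximal_powr:
  fixes v :: "'a \<Rightarrow> real"
  assumes [measurable]: "v \<in> borel_measurable lebesgue" and v: "\<And>x. 0 < v x"
    and ae: "AE x in lebesgue. ennreal (v x) = ennreal_powr (u x) (1 / p) * ennreal (a x powr b)"
    and c: "0 < c" and dom: "\<And>x. ennreal c * maximal_powr \<theta> p b a u x \<le> u x"
    and p: "0 < p" and pos: "\<And>x. 0 < a x"
  shows "v \<in> A_class \<rho> 1 \<theta>"
proof (rule A1_classI[OF assms(1) v])
  let ?f = "\<lambda>y. ennreal_powr (u y) (1 / p) * ennreal (a y powr b)"
  show "AE x in lebesgue. maximal \<rho> \<theta> (\<lambda>x. ennreal (v x)) x \<le> ennreal ((1 / c) powr (1 / p)) * ennreal (v x)"
  proof (rule eventually_mono[OF ae])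
    fix x assume x: "ennreal (v x) = ?f x"
    have "maximal \<rho> \<theta> (\<lambda>x. ennreal (v x)) x \<le> maximal \<rho> \<theta> ?f x"
      by (rule maximal_mono_AE) (use ae in \<open>auto elim: eventually_mono\<close>)
    also have "\<dots> \<le> ennreal_powr (ennreal (1 / c) * (ennreal (a x powr (b * p)) * u x)) (1 / p)"
    proof (subst ennreal_powr_le_iff[OF p, symmetric])
      let ?M = "ennreal_powr (maximal \<rho> \<theta> ?f x) p"
      have one: "ennreal (1 / c) * (ennreal (a x powr (b * p)) * (ennreal c * ennreal (a x powr (- (b * p))))) = 1"
        using c pos[of x] by (simp add: powr_minus flip: ennreal_mult)
      have "?M = ennreal (1 / c) * (ennreal (a x powr (b * p)) * (ennreal c * ennreal (a x powr (- (b * p))))) * ?M"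
        unfolding one by simp
      also have "\<dots> = ennreal (1 / c) * (ennreal (a x powr (b * p)) * (ennreal c * maximal_powr \<theta> p b a u x))"
        by (simp only: maximal_powr_def mult.assoc)
      also have "\<dots> \<le> ennreal (1 / c) * (ennreal (a x powr (b * p)) * u x)"
        by (intro mult_left_mono dom) auto
      finally show "?M \<le> ennreal (1 / c) * (ennreal (a x powr (b * p)) * u x)" .
    qed
    also have "\<dots> = ennreal ((1 / c) powr (1 / p)) * ennreal (v x)"
      using c p by (simp add: x ennreal_powr_mult ennreal_powr_ennreal powr_powr mult_ac)
    finally show "maximal \<rho> \<theta> (\<lambda>x. ennreal (v x)) x \<le> ennreal ((1 / c) powr (1 / p)) * ennreal (v x)" .
  qed
qed

lemma Ap_factorization:
  assumes \<omega>: "\<omega> \<in> A_class \<rho> p \<theta>" and p: "1 < p" and \<theta>: "0 \<le> \<theta>"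
  shows "\<exists>\<theta>'\<ge>0. \<exists>\<omega>1\<in>A_class \<rho> 1 \<theta>'. \<exists>\<omega>2\<in>A_class \<rho> 1 \<theta>'. \<omega> = (\<lambda>x. \<omega>1 x * \<omega>2 x powr (1 - p))"
proof -
  define \<sigma> where "\<sigma> = (\<lambda>x. \<omega> x powr (- 1 / (p - 1)))"
  define p' where "p' = p / (p - 1)"
  have p': "1 < p'" "- (1 / p * p') = - 1 / (p - 1)" "- (- 1 / p * p) = 1" "1 / p' = (p - 1) / p"
    using p by (simp_all add: p'_def field_simps)
  have w: "weight \<omega>" "Ap_condition \<rho> p \<theta> \<omega>"
    using \<omega> p by (auto simp: A_class_def)
  have w\<sigma>: "weight \<sigma>" "Ap_condition \<rho> p' \<theta> \<sigma>"
    unfolding \<sigma>_def p'_def using weight_dual[OF w(1) p w(2)] Ap_condition_dual[OF w(1) p w(2)] by auto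
  note [measurable] = weightD(1)[OF w(1)]
  have pos: "0 < \<omega> x" for x by (rule weightD(2)[OF w(1)])
  obtain C1 where C1: "0 \<le> C1" "\<forall>f\<in>borel_measurable lebesgue.
    (\<integral>\<^sup>+x. ennreal (\<omega> x) * ennreal_powr (maximal \<rho> (\<theta> * p / (p - 1)) f x) p \<partial>lebesgue)
      \<le> ennreal C1 * (\<integral>\<^sup>+x. ennreal (\<omega> x) * ennreal_powr (f x) p \<partial>lebesgue)"
    using maximal_strong_type[OF w(1) p \<theta> w(2)] by blast
  obtain C2 where C2: "0 \<le> C2" "\<forall>f\<in>borel_measurable lebesgue.
    (\<integral>\<^sup>+x. ennreal (\<sigma> x) * ennreal_powr (maximal \<rho> (\<theta> * p' / (p' - 1)) f x) p' \<partial>lebesgue)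
      \<le> ennreal C2 * (\<integral>\<^sup>+x. ennreal (\<sigma> x) * ennreal_powr (f x) p' \<partial>lebesgue)"
    using maximal_strong_type[OF w\<sigma>(1) p'(1) \<theta> w\<sigma>(2)] by blast
  \<comment> \<open>The bounds for \<omega> and for the dual weight come with different parameters.
    The maximal operator decreases in \<theta>, so the larger parameter serves both.\<close>
  define \<theta>' where "\<theta>' = max (\<theta> * p / (p - 1)) (\<theta> * p' / (p' - 1))"
  have \<theta>': "0 \<le> \<theta>'" "\<theta> * p / (p - 1) \<le> \<theta>'" "\<theta> * p' / (p' - 1) \<le> \<theta>'"
    using \<theta> p by (simp_all add: \<theta>'_def le_max_iff_disj)
  \<comment> \<open>\<open>?T1\<close> rests on the bound in L^p' of \<sigma> = \<omega>^(-p'/p),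
    \<open>?T2\<close> on the bound in L^p of \<omega>.\<close>
  let ?T1 = "maximal_powr \<theta>' p' (1 / p) \<omega>" and ?T2 = "maximal_powr \<theta>' p (- 1 / p) \<omega>"
  have weights: "\<omega> x powr (- (1 / p * p')) = \<sigma> x" "\<omega> x powr (- (- 1 / p * p)) = \<omega> x" for x
    unfolding p' \<sigma>_def using pos[of x] by simp_all
  have "\<exists>u\<in>borel_measurable lebesgue. \<exists>c>0. (\<forall>x. 0 < u x) \<and> (AE x in lebesgue. u x < top) \<and>
    (\<forall>x. ennreal c * ?T1 u x \<le> u x \<and> ennreal c * ?T2 u x \<le> u x)"
  proof (rule exists_dominating_function)
    fix u :: "'a \<Rightarrow> ennreal" assume [measurable]: "u \<in> borel_measurable lebesgue"
    show "(\<integral>\<^sup>+x. ?T1 u x \<partial>lebesgue) \<le> ennreal C2 * (\<integral>\<^sup>+x. u x \<partial>lebesgue)"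
      by (rule maximal_powr_bounded[OF _ \<theta>'(3)]) (use C2(2) p' pos weights in auto)
    show "(\<integral>\<^sup>+x. ?T2 u x \<partial>lebesgue) \<le> ennreal C1 * (\<integral>\<^sup>+x. u x \<partial>lebesgue)"
      by (rule maximal_powr_bounded[OF _ \<theta>'(2)]) (use C1(2) p pos weights in auto)
  qed (use p p' C1 C2 in \<open>auto intro: maximal_powr_mono maximal_powr_SUP\<close>)
  then obtain u c where [measurable]: "u \<in> borel_measurable lebesgue" and c: "0 < c"
    and u: "\<And>x. 0 < u x" "AE x in lebesgue. u x < top"
    and dom: "\<And>x. ennreal c * ?T1 u x \<le> u x" "\<And>x. ennreal c * ?T2 u x \<le> u x"
    by blast
  \<comment> \<open>On the null set where \<open>u\<close> is infinite, the values \<omega> and 1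
    keep both factors positive and the product identity true everywhere.\<close>
  define \<omega>1 where "\<omega>1 = (\<lambda>x. if u x < top then \<omega> x powr (1 / p) * enn2real (u x) powr (1 / p') else \<omega> x)"
  define \<omega>2 where "\<omega>2 = (\<lambda>x. if u x < top then \<omega> x powr (- 1 / p) * enn2real (u x) powr (1 / p) else 1)"
  have u_real: "0 < enn2real (u x)" "ennreal (enn2real (u x)) = u x" if "u x < top" for x
    using u(1)[of x] that by (auto simp: enn2real_positive_iff)
  have "\<omega>1 \<in> A_class \<rho> 1 \<theta>'"
  proof (rule A1_from_maximal_powr[OF _ _ _ c dom(1)])
    show "AE x in lebesgue. ennreal (\<omega>1 x) = ennreal_powr (u x) (1 / p') * ennreal (\<omega> x powr (1 / p))"
    proof (rule eventually_mono[OF u(2)])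
      fix x assume x: "u x < top"
      have "ennreal_powr (u x) (1 / p') = ennreal (enn2real (u x) powr (1 / p'))"
        by (subst u_real(2)[OF x, symmetric], rule ennreal_powr_ennreal) simp
      then show "ennreal (\<omega>1 x) = ennreal_powr (u x) (1 / p') * ennreal (\<omega> x powr (1 / p))"
        using x by (simp add: \<omega>1_def ennreal_mult mult.commute)
    qed
    show "\<omega>1 \<in> borel_measurable lebesgue" unfolding \<omega>1_def by measurable
    show "0 < \<omega>1 x" for x using pos[of x] u_real[of x] by (auto simp: \<omega>1_def)
  qed (use p' pos in auto)
  moreover have "\<omega>2 \<in> A_class \<rho> 1 \<theta>'"
  proof (rule A1_from_maximal_powr[OF _ _ _ c dom(2)])
    show "AE x in lebesgue. ennreal (\<omega>2 x) = ennreal_powr (u x) (1 / p) * ennreal (\<omega> x powr (- 1 / p))"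
    proof (rule eventually_mono[OF u(2)])
      fix x assume x: "u x < top"
      have "ennreal_powr (u x) (1 / p) = ennreal (enn2real (u x) powr (1 / p))"
        by (subst u_real(2)[OF x, symmetric], rule ennreal_powr_ennreal) simp
      then show "ennreal (\<omega>2 x) = ennreal_powr (u x) (1 / p) * ennreal (\<omega> x powr (- 1 / p))"
        using x by (simp add: \<omega>2_def ennreal_mult mult.commute)
    qed
    show "\<omega>2 \<in> borel_measurable lebesgue" unfolding \<omega>2_def by measurable
    show "0 < \<omega>2 x" for x using pos[of x] u_real[of x] by (auto simp: \<omega>2_def)
  qed (use p pos in auto)
  moreover have "\<omega> = (\<lambda>x. \<omega>1 x * \<omega>2 x powr (1 - p))"
  proof
    fix x
    show "\<omega> x = \<omega>1 x * \<omega>2 x powr (1 - p)"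
    proof (cases "u x < top")
      case True
      have e1: "- 1 / p * (1 - p) = 1 / p'" and e2: "1 / p * (1 - p) = - (1 / p')"
        and e3: "1 / p + 1 / p' = 1"
        using p by (simp_all add: p'(4) field_simps)
      have "\<omega>2 x powr (1 - p) = \<omega> x powr (1 / p') * enn2real (u x) powr (- (1 / p'))"
        using True pos[of x] u_real[OF True] by (simp add: \<omega>2_def powr_mult powr_powr e1 e2 del: times_divide_eq_left)
      then have "\<omega>1 x * \<omega>2 x powr (1 - p) =
          (\<omega> x powr (1 / p) * \<omega> x powr (1 / p')) * (enn2real (u x) powr (1 / p') * enn2real (u x) powr (- (1 / p')))"
        using True by (simp add: \<omega>1_def)
      also have "\<dots> = \<omega> x"
        using pos[of x] u_real(1)[OF True] e3 by (simp flip: powr_add)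
      finally show ?thesis ..
    qed (simp add: \<omega>1_def \<omega>2_def)
  qed
  ultimately show ?thesis
    using \<theta>'(1) by blast
qed

end

section \<open>Powers of maximal functions\<close>

text \<open>Kolmogorov's inequality. Inside \<open>B\<close> the level set at height l has measure
  at most m, and at most A / l by the weak type. The layer cake integral is split where the bounds
  cross, at t = A / m; the upper piece converges because \<delta> < 1. For A = 0 the crossing point
  degenerates, hence the separate case.\<close>

lemma vitali_maximal_Kolmogorov:
  fixes f :: "'a::euclidean_space \<Rightarrow> ennreal"
  assumes [measurable]: "f \<in> borel_measurable lebesgue" "B \<in> sets lebesgue"
    and A: "(\<integral>\<^sup>+x. f x \<partial>lebesgue) = ennreal A" "0 \<le> A"
    and m: "emeasure lebesgue B = ennreal m" "0 < m" and \<delta>: "0 < \<delta>" "\<delta> < 1"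
  shows "(\<integral>\<^sup>+x\<in>B. ennreal_powr (vitali_maximal (\<lambda>_. 1) f x) \<delta> \<partial>lebesgue)
     \<le> ennreal (1 / (1 - \<delta>) * (A powr \<delta> * m powr (1 - \<delta>)))"
proof (cases "A = 0")
  case True
  have "(\<integral>\<^sup>+x\<in>S. f x \<partial>lebesgue) = 0" for S
  proof -
    have "(\<integral>\<^sup>+x\<in>S. f x \<partial>lebesgue) \<le> (\<integral>\<^sup>+x. f x \<partial>lebesgue)"
      by (intro nn_integral_mono) (simp add: indicator_def)
    then show ?thesis using A True by simp
  qed
  then have "vitali_maximal (\<lambda>_. 1) f x \<le> 0" for x
    unfolding vitali_maximal_def by (intro SUP_least) auto
  then have "vitali_maximal (\<lambda>_. 1) f x = 0" for x by simp
  then show ?thesis by simp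
next
  case False
  with A have A0: "0 < A" by simp
  define t where "t = A / m"
  have t: "0 < t" using A0 m by (simp add: t_def)
  let ?N = "vitali_maximal (\<lambda>_. 1) f"
  let ?S = "\<lambda>l. \<integral>\<^sup>+x. indicator B x * indicator {x. ennreal l < ?N x} x \<partial>lebesgue"
  have S1: "?S l \<le> ennreal m" for l
  proof -
    have "?S l \<le> (\<integral>\<^sup>+x. indicator B x \<partial>lebesgue)"
      by (intro nn_integral_mono) (auto simp: indicator_def)
    then show ?thesis using m by simp
  qed
  have S2: "?S l \<le> ennreal (A / l)" if l: "0 < l" for l
  proof -
    have "?S l \<le> (\<integral>\<^sup>+x. 1 * indicator {x. ennreal l < ?N x} x \<partial>lebesgue)"
      by (intro nn_integral_mono) (auto simp: indicator_def)
    also have "\<dots> = ennreal (1 / l) * (ennreal l * (\<integral>\<^sup>+x. 1 * indicator {x. ennreal l < ?N x} x \<partial>lebesgue))"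
      using l by (simp add: mult.assoc[symmetric] flip: ennreal_mult)
    also have "\<dots> \<le> ennreal (1 / l) * (\<integral>\<^sup>+x. f x \<partial>lebesgue)"
      by (intro mult_left_mono vitali_maximal_weak_type) auto
    also have "\<dots> = ennreal (A / l)"
      using A l by (simp flip: ennreal_mult)
    finally show ?thesis .
  qed
  have "(\<integral>\<^sup>+x\<in>B. ennreal_powr (?N x) \<delta> \<partial>lebesgue) = (\<integral>\<^sup>+x. indicator B x * ennreal_powr (?N x) \<delta> \<partial>lebesgue)"
    by (simp only: mult.commute)
  also have "\<dots> = (\<integral>\<^sup>+l. ennreal (\<delta> * l powr (\<delta> - 1)) * indicator {0<..} l * ?S l \<partial>lborel)"
    using \<delta> by (intro nn_integral_layer_cake) auto
  also have "\<dots> \<le> (\<integral>\<^sup>+l. ennreal m * (ennreal (\<delta> * l powr (\<delta> - 1)) * indicator {l. 0 < l \<and> ennreal l < ennreal t} l)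
      + ennreal (A * \<delta>) * (indicator {t..} l * ennreal (l powr (\<delta> - 2))) \<partial>lborel)"
  proof (intro nn_integral_mono)
    fix l :: real
    consider "l \<le> 0" | "0 < l" "l < t" | "t \<le> l" by linarith
    then show "ennreal (\<delta> * l powr (\<delta> - 1)) * indicator {0<..} l * ?S l \<le>
       ennreal m * (ennreal (\<delta> * l powr (\<delta> - 1)) * indicator {l. 0 < l \<and> ennreal l < ennreal t} l)
      + ennreal (A * \<delta>) * (indicator {t..} l * ennreal (l powr (\<delta> - 2)))"
    proof cases
      case 2
      then have "ennreal (\<delta> * l powr (\<delta> - 1)) * ?S l \<le> ennreal (\<delta> * l powr (\<delta> - 1)) * ennreal m"
        by (intro mult_left_mono S1) auto
      with 2 show ?thesis by (simp add: ennreal_less_iff mult.commute)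
    next
      case 3
      then have l: "0 < l" using t by simp
      then have "ennreal (\<delta> * l powr (\<delta> - 1)) * ?S l \<le> ennreal (\<delta> * l powr (\<delta> - 1)) * ennreal (A / l)"
        by (intro mult_left_mono S2) auto
      also have "\<dots> = ennreal (\<delta> * l powr (\<delta> - 1) * (A / l))"
        using \<delta> A0 l by (intro ennreal_mult[symmetric]) auto
      also have "\<delta> * l powr (\<delta> - 1) * (A / l) = A * \<delta> * l powr (\<delta> - 2)"
        using l powr_diff[of l "\<delta> - 1" 1] by simp
      also have "ennreal \<dots> = ennreal (A * \<delta>) * ennreal (l powr (\<delta> - 2))"
        using A0 \<delta> by (intro ennreal_mult) auto
      finally show ?thesis
        using 3 l by (simp add: ennreal_less_iff)
    qed auto
  qed
  also have "\<dots> = ennreal m * (\<integral>\<^sup>+l. ennreal (\<delta> * l powr (\<delta> - 1)) * indicator {l. 0 < l \<and> ennreal l < ennreal t} l \<partial>lborel)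
      + ennreal (A * \<delta>) * (\<integral>\<^sup>+l. indicator {t..} l * ennreal (l powr (\<delta> - 2)) \<partial>lborel)"
    by (subst nn_integral_add) (auto simp: nn_integral_cmult)
  also have "(\<integral>\<^sup>+l. ennreal (\<delta> * l powr (\<delta> - 1)) * indicator {l. 0 < l \<and> ennreal l < ennreal t} l \<partial>lborel) = ennreal (t powr \<delta>)"
    using ennreal_powr_layer[OF \<delta>(1), of "ennreal t"] t by (simp add: ennreal_powr_ennreal)
  also have "(\<integral>\<^sup>+l. indicator {t..} l * ennreal (l powr (\<delta> - 2)) \<partial>lborel) = ennreal (t powr (\<delta> - 1) / (1 - \<delta>))"
  proof -
    have "((\<lambda>l. l powr (\<delta> - 2)) has_integral - (t powr (\<delta> - 2 + 1)) / (\<delta> - 2 + 1)) {t..}"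
      using \<delta> t by (intro has_integral_powr_to_inf) auto
    moreover have "- (t powr (\<delta> - 2 + 1)) / (\<delta> - 2 + 1) = t powr (\<delta> - 1) / (1 - \<delta>)"
      using \<delta> by (simp add: field_simps)
    ultimately show ?thesis
      using nn_integral_has_integral_lebesgue[where \<Omega> = "{t..}" and f = "\<lambda>l. l powr (\<delta> - 2)"]
      by (simp add: ennreal_mult' ennreal_indicator)
  qed
  also have "ennreal m * ennreal (t powr \<delta>) + ennreal (A * \<delta>) * ennreal (t powr (\<delta> - 1) / (1 - \<delta>)) =
      ennreal (m * t powr \<delta> + A * \<delta> * (t powr (\<delta> - 1) / (1 - \<delta>)))"
  proof -
    have "ennreal (A * \<delta>) * ennreal (t powr (\<delta> - 1) / (1 - \<delta>)) = ennreal (A * \<delta> * (t powr (\<delta> - 1) / (1 - \<delta>)))"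
      using A0 \<delta> by (intro ennreal_mult[symmetric]) auto
    moreover have "ennreal m * ennreal (t powr \<delta>) = ennreal (m * t powr \<delta>)"
      using m by (intro ennreal_mult[symmetric]) auto
    ultimately show ?thesis
      using m A0 \<delta> by (simp only:) (intro ennreal_plus[symmetric], auto)
  qed
  also have "m * t powr \<delta> + A * \<delta> * (t powr (\<delta> - 1) / (1 - \<delta>)) = 1 / (1 - \<delta>) * (A powr \<delta> * m powr (1 - \<delta>))"
  proof -
    have "A * t powr (\<delta> - 1) = m * t powr \<delta>"
      using A0 m by (simp add: t_def powr_diff)
    then have "A * \<delta> * (t powr (\<delta> - 1) / (1 - \<delta>)) = \<delta> / (1 - \<delta>) * (m * t powr \<delta>)"
      by (metis (no_types, lifting) mult.assoc mult.commute times_divide_eq_left times_divide_eq_right)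
    moreover have "m * t powr \<delta> = A powr \<delta> * m powr (1 - \<delta>)"
      using A0 m by (simp add: t_def powr_divide powr_diff)
    moreover have "1 + \<delta> / (1 - \<delta>) = 1 / (1 - \<delta>)"
      using \<delta> by (simp add: field_simps)
    ultimately show ?thesis
      by (metis distrib_right mult_1)
  qed
  finally show ?thesis .
qed

context radius_function
begin

lemma denominator_scale:
  assumes "1 \<le> k" "0 \<le> \<theta>" "0 < r"
  shows "Psi \<rho> \<theta> z (k * r) * vol z (k * r) \<le>
    (k powr \<theta> * k ^ DIM('a)) * (Psi \<rho> \<theta> z r * vol z r)"
proof -
  have "Psi \<rho> \<theta> z (k * r) * vol z (k * r) \<le>
     (k powr \<theta> * Psi \<rho> \<theta> z r) * (k ^ DIM('a) * vol z r)"
  proof (rule mult_mono)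
    show "Psi \<rho> \<theta> z (k * r) \<le> k powr \<theta> * Psi \<rho> \<theta> z r"
      using assms by (intro Psi_scale) auto
    show "vol z (k * r) \<le> k ^ DIM('a) * vol z r"
      using assms by (subst measure_lebesgue_ball_scale[where x = z]) auto
  qed (use assms in \<open>auto simp: less_imp_le Psi_pos\<close>)
  then show ?thesis by (simp only: mult_ac)
qed

lemma Psi_average_enlarge:
  assumes "1 \<le> k" "0 \<le> \<theta>" "0 < r"
  shows "Psi_average \<rho> \<theta> z r f \<le> ennreal (k powr \<theta> * k ^ DIM('a)) * Psi_average \<rho> \<theta> z (k * r) f"
proof -
  define D where "D = Psi \<rho> \<theta> z r * vol z r"
  define D' where "D' = Psi \<rho> \<theta> z (k * r) * vol z (k * r)"
  define \<kappa> where "\<kappa> = k powr \<theta> * k ^ DIM('a)"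
  have D: "0 < D" "0 < D'"
    unfolding D_def D'_def using assms by (intro denominator_pos; simp)+
  have \<kappa>: "0 \<le> \<kappa>" using assms by (simp add: \<kappa>_def)
  have "D' \<le> \<kappa> * D"
    unfolding D_def D'_def \<kappa>_def by (rule denominator_scale[OF assms])
  then have "1 / D \<le> \<kappa> * (1 / D')"
    using D by (simp add: field_simps)
  have "Psi_average \<rho> \<theta> z r f = ball_integral f z r * ennreal (1 / D)"
    unfolding Psi_average_def D_def[symmetric] divide_ennreal_def using D by (simp add: inverse_ennreal inverse_eq_divide)
  also have "\<dots> \<le> ball_integral f z (k * r) * ennreal (\<kappa> * (1 / D'))"
  proof (rule mult_mono)
    have "r \<le> k * r" using assms by simp
    then have "ball z r \<subseteq> ball z (k * r)" by (rule subset_ball)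
    then show "ball_integral f z r \<le> ball_integral f z (k * r)"
      by (intro nn_integral_mono) (auto simp: indicator_def)
    show "ennreal (1 / D) \<le> ennreal (\<kappa> * (1 / D'))"
      by (rule ennreal_leI) fact
  qed auto
  also have "\<dots> = ennreal \<kappa> * Psi_average \<rho> \<theta> z (k * r) f"
  proof -
    have "ennreal (\<kappa> * (1 / D')) = ennreal \<kappa> * inverse (ennreal D')"
      using D \<kappa> by (subst ennreal_mult) (auto simp: inverse_ennreal inverse_eq_divide)
    then show ?thesis
      by (simp only: Psi_average_def D'_def[symmetric] divide_ennreal_def mult_ac)
  qed
  finally show ?thesis unfolding \<kappa>_def .
qed

text \<open>A ball around y of radius below r stays inside B(z, 3 r) and sees only the cut-off of
  \<open>f\<close>; the factor 5^n undoes the enlarged denominator. A ball of radius at least r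
  contains x after tripling, which costs the second constant.\<close>

lemma maximal_local_bound:
  fixes f :: "'a \<Rightarrow> ennreal"
  assumes \<theta>: "0 \<le> \<theta>" and r: "0 < r" and x: "x \<in> ball z r" and y: "y \<in> ball z r"
  shows "maximal \<rho> \<theta> f y \<le> max (ennreal (5 ^ DIM('a)) * vitali_maximal (\<lambda>_. 1) (\<lambda>y. f y * indicator (ball z (3 * r)) y) y)
     (ennreal (3 powr \<theta> * 3 ^ DIM('a)) * maximal \<rho> \<theta> f x)"
proof (rule maximal_le)
  fix z' t assume t: "0 < t" and yB: "y \<in> ball z' t"
  let ?n = "DIM('a)"
  let ?f = "\<lambda>y. f y * indicator (ball z (3 * r)) y"
  have yz: "dist z y < r" "dist z x < r" "dist z' y < t"
    using x y yB by auto
  show "Psi_average \<rho> \<theta> z' t f \<le> max (ennreal (5 ^ ?n) * vitali_maximal (\<lambda>_. 1) ?f y) (ennreal (3 powr \<theta> * 3 ^ ?n) * maximal \<rho> \<theta> f x)"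
  proof (cases "t < r")
    case True
    define m where "m = vol z' t"
    have m: "0 < m" unfolding m_def by (rule measure_lebesgue_ball_pos[OF t])
    have sub: "w \<in> ball z (3 * r)" if "w \<in> ball z' t" for w
    proof -
      have "dist z w \<le> dist z y + dist z' y + dist z' w"
        using dist_triangle[of z w y] dist_triangle[of y w z'] by (simp add: dist_commute)
      then show ?thesis using that yz True by simp
    qed
    have "Psi_average \<rho> \<theta> z' t f \<le> ball_integral ?f z' t / ennreal (Psi \<rho> 0 z' t * m)"
    proof -
      have "Psi_average \<rho> \<theta> z' t f \<le> Psi_average \<rho> 0 z' t f"
        by (rule Psi_average_mono_theta[OF \<theta> t])
      also have "\<dots> = Psi_average \<rho> 0 z' t ?f"
        using sub by (intro Psi_average_cong_AE) auto
      finally show ?thesis by (simp add: Psi_average_def m_def)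
    qed
    also have "\<dots> = ball_integral ?f z' t / ennreal m"
    proof -
      have "1 + t / \<rho> z' \<noteq> 0" using t rho_pos[of z'] divide_pos_pos[of t "\<rho> z'"] by linarith
      then show ?thesis by (simp add: Psi_def)
    qed
    also have "\<dots> = ennreal (5 ^ ?n) * (ball_integral ?f z' t / ennreal (5 ^ ?n * m))"
    proof -
      have "inverse (ennreal m) = ennreal (5 ^ ?n) * inverse (ennreal (5 ^ ?n * m))"
        using m by (simp add: inverse_ennreal flip: ennreal_mult)
      then show ?thesis by (simp only: divide_ennreal_def mult_ac)
    qed
    also have "ennreal (5 ^ ?n * m) = ball_integral (\<lambda>w. 1) z' (5 * t)"
      using t measure_lebesgue_ball_scale[of t 5 z' z']
      by (simp add: emeasure_lebesgue_ball m_def del: emeasure_completion)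
    also have "ennreal (5 ^ ?n) * (ball_integral ?f z' t / ball_integral (\<lambda>w. 1) z' (5 * t))
        \<le> ennreal (5 ^ ?n) * vitali_maximal (\<lambda>_. 1) ?f y"
      by (intro mult_left_mono vitali_maximal_ge t yB) auto
    finally show ?thesis by (simp add: le_max_iff_disj)
  next
    case False
    have "dist z' x \<le> dist z' y + dist z y + dist z x"
      using dist_triangle[of z' x y] dist_triangle[of y x z] by (simp add: dist_commute)
    then have "x \<in> ball z' (3 * t)"
      using yz False by simp
    then have "Psi_average \<rho> \<theta> z' (3 * t) f \<le> maximal \<rho> \<theta> f x"
      using t by (intro maximal_ge) auto
    then have "ennreal (3 powr \<theta> * 3 ^ ?n) * Psi_average \<rho> \<theta> z' (3 * t) f \<le> ennreal (3 powr \<theta> * 3 ^ ?n) * maximal \<rho> \<theta> f x"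
      by (rule mult_left_mono) simp
    moreover have "Psi_average \<rho> \<theta> z' t f \<le> ennreal (3 powr \<theta> * 3 ^ ?n) * Psi_average \<rho> \<theta> z' (3 * t) f"
      using \<theta> t by (intro Psi_average_enlarge) auto
    ultimately have "Psi_average \<rho> \<theta> z' t f \<le> ennreal (3 powr \<theta> * 3 ^ ?n) * maximal \<rho> \<theta> f x"
      by (rule order_trans[rotated])
    then show ?thesis by (simp add: le_max_iff_disj)
  qed
qed

text \<open>By \<open>maximal_local_bound\<close> the large balls contribute a multiple of the value
  at x, which is constant over the ball, and the small ones a local maximal function, to whose power
  \<delta> Kolmogorov's inequality applies.\<close>

lemma maximal_powr_A1:
  fixes f :: "'a \<Rightarrow> real"
  assumes f: "locally_integrable f" and \<delta>: "0 < \<delta>" "\<delta> < 1" and \<theta>: "0 \<le> \<theta>"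
  shows "A1_condition \<rho> \<theta> (\<lambda>x. ennreal_powr (maximal \<rho> \<theta> (\<lambda>y. ennreal \<bar>f y\<bar>) x) \<delta>)"
proof -
  note [measurable] = locally_integrable_measurable[OF f]
  let ?n = "DIM('a)"
  let ?M = "maximal \<rho> \<theta> (\<lambda>y. ennreal \<bar>f y\<bar>)"
  define \<kappa> where "\<kappa> = (3::real) powr \<theta> * 3 ^ ?n"
  define C where "C = \<kappa> powr \<delta> * ((5 ^ ?n) powr \<delta> / (1 - \<delta>) + 1)"
  have \<kappa>: "0 < \<kappa>" by (simp add: \<kappa>_def)
  have bound: "Psi_average \<rho> \<theta> z r (\<lambda>y. ennreal_powr (?M y) \<delta>) \<le> ennreal C * ennreal_powr (?M x) \<delta>"
    if r: "0 < r" and xB: "x \<in> ball z r" for x z r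
  proof -
    define m where "m = vol z r"
    define D where "D = Psi \<rho> \<theta> z r * m"
    define X where "X = ennreal_powr (?M x) \<delta>"
    let ?f = "\<lambda>y. ennreal \<bar>f y\<bar> * indicator (ball z (3 * r)) y"
    let ?N = "vitali_maximal (\<lambda>_. 1) ?f"
    have m: "0 < m" unfolding m_def by (rule measure_lebesgue_ball_pos[OF r])
    have D: "0 < D" unfolding D_def m_def by (rule denominator_pos[OF r])
    have mD: "m \<le> D"
      unfolding D_def using m Psi_ge_1[OF \<theta>, of r z] r by simp
    obtain A where A: "0 \<le> A" "(\<integral>\<^sup>+y. ?f y \<partial>lebesgue) = ennreal A"
      using locally_integrable_ball[OF f, of z "3 * r"] by (cases "\<integral>\<^sup>+y. ?f y \<partial>lebesgue") auto
    \<comment> \<open>\<open>A\<close> is the integral over the tripled ball, which contains x, so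
      it is at most \<kappa> D times the maximal function at x.\<close>
    have "ennreal (A powr \<delta>) \<le> X * ennreal (\<kappa> powr \<delta> * D powr \<delta>)"
    proof -
      define D3 where "D3 = Psi \<rho> \<theta> z (3 * r) * vol z (3 * r)"
      have D3: "0 < D3" unfolding D3_def using r by (intro denominator_pos) simp
      have D3D: "D3 \<le> \<kappa> * D"
        unfolding D3_def \<kappa>_def D_def m_def using \<theta> r by (intro denominator_scale) auto
      have "ennreal A / ennreal D3 \<le> ?M x"
        using maximal_ge[of "3 * r" x z \<theta> "\<lambda>y. ennreal \<bar>f y\<bar>"] r xB
        unfolding Psi_average_def D3_def[symmetric] A(2) by simp
      then have "ennreal D3 * (ennreal A / ennreal D3) \<le> ennreal (\<kappa> * D) * ?M x"
        using D3D by (intro mult_mono ennreal_leI) auto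
      moreover have "ennreal D3 * (ennreal A / ennreal D3) = ennreal A"
        using D3 A by (simp add: divide_ennreal flip: ennreal_mult)
      ultimately have "ennreal_powr (ennreal A) \<delta> \<le> ennreal_powr (ennreal (\<kappa> * D) * ?M x) \<delta>"
        using \<delta> by (intro ennreal_powr_mono) auto
      then show ?thesis
        using \<delta> A \<kappa> D by (simp add: ennreal_powr_mult ennreal_powr_ennreal X_def powr_mult mult.commute)
    qed
    \<comment> \<open>Using m \<le> D, the product A^\<delta> m^(1-\<delta>) yields exactly one
      power of \<open>D\<close>, which the denominator of the average cancels.\<close>
    then have AX: "ennreal (1 / (1 - \<delta>) * (A powr \<delta> * m powr (1 - \<delta>))) \<le> ennreal (\<kappa> powr \<delta> / (1 - \<delta>)) * X * ennreal D"
    proof -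
      assume *: "ennreal (A powr \<delta>) \<le> X * ennreal (\<kappa> powr \<delta> * D powr \<delta>)"
      have "ennreal (1 / (1 - \<delta>) * (A powr \<delta> * m powr (1 - \<delta>))) = ennreal (1 / (1 - \<delta>) * m powr (1 - \<delta>)) * ennreal (A powr \<delta>)"
        using \<delta> by (simp add: mult_ac flip: ennreal_mult)
      also have "\<dots> \<le> ennreal (1 / (1 - \<delta>) * D powr (1 - \<delta>)) * (X * ennreal (\<kappa> powr \<delta> * D powr \<delta>))"
        using \<delta> m mD * by (intro mult_mono ennreal_leI powr_mono2) auto
      also have "\<dots> = ennreal (1 / (1 - \<delta>) * D powr (1 - \<delta>) * (\<kappa> powr \<delta> * D powr \<delta>)) * X"
        using \<delta> by (subst ennreal_mult) (auto simp: mult_ac)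
      also have "1 / (1 - \<delta>) * D powr (1 - \<delta>) * (\<kappa> powr \<delta> * D powr \<delta>) = \<kappa> powr \<delta> / (1 - \<delta>) * D"
        using D by (simp add: powr_diff)
      also have "ennreal (\<kappa> powr \<delta> / (1 - \<delta>) * D) = ennreal (\<kappa> powr \<delta> / (1 - \<delta>)) * ennreal D"
        using D \<delta> by (intro ennreal_mult) auto
      finally show ?thesis by (simp only: mult_ac)
    qed
    have "ball_integral (\<lambda>y. ennreal_powr (?M y) \<delta>) z r
       \<le> (\<integral>\<^sup>+y. ennreal ((5 ^ ?n) powr \<delta>) * (ennreal_powr (?N y) \<delta> * indicator (ball z r) y)
           + ennreal (\<kappa> powr \<delta>) * X * indicator (ball z r) y \<partial>lebesgue)"
    proof (intro nn_integral_mono)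
      fix y
      show "ennreal_powr (?M y) \<delta> * indicator (ball z r) y \<le>
          ennreal ((5 ^ ?n) powr \<delta>) * (ennreal_powr (?N y) \<delta> * indicator (ball z r) y)
           + ennreal (\<kappa> powr \<delta>) * X * indicator (ball z r) y"
      proof (cases "y \<in> ball z r")
        case True
        have "ennreal_powr (?M y) \<delta> \<le> ennreal_powr (max (ennreal (5 ^ ?n) * ?N y) (ennreal \<kappa> * ?M x)) \<delta>"
          using maximal_local_bound[OF \<theta> r xB True] \<delta> unfolding \<kappa>_def by (intro ennreal_powr_mono) auto
        also have "\<dots> = max (ennreal_powr (ennreal (5 ^ ?n) * ?N y) \<delta>) (ennreal_powr (ennreal \<kappa> * ?M x) \<delta>)"
          using \<delta> by (intro ennreal_powr_max) auto
        also have "\<dots> \<le> ennreal_powr (ennreal (5 ^ ?n) * ?N y) \<delta> + ennreal_powr (ennreal \<kappa> * ?M x) \<delta>"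
          by simp
        also have "\<dots> = ennreal ((5 ^ ?n) powr \<delta>) * ennreal_powr (?N y) \<delta> + ennreal (\<kappa> powr \<delta>) * X"
          using \<delta> \<kappa> by (simp add: ennreal_powr_mult ennreal_powr_ennreal X_def)
        finally show ?thesis using True by simp
      qed simp
    qed
    also have "\<dots> = ennreal ((5 ^ ?n) powr \<delta>) * ball_integral (\<lambda>y. ennreal_powr (?N y) \<delta>) z r + ennreal (\<kappa> powr \<delta>) * X * ennreal m"
      by (simp add: nn_integral_add nn_integral_cmult emeasure_lebesgue_ball m_def del: emeasure_completion)
    also have "\<dots> \<le> ennreal ((5 ^ ?n) powr \<delta>) * (ennreal (\<kappa> powr \<delta> / (1 - \<delta>)) * X * ennreal D) + ennreal (\<kappa> powr \<delta>) * X * ennreal D"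
    proof (intro add_mono mult_left_mono ennreal_leI mD order_trans[OF _ AX])
      show "ball_integral (\<lambda>y. ennreal_powr (?N y) \<delta>) z r \<le> ennreal (1 / (1 - \<delta>) * (A powr \<delta> * m powr (1 - \<delta>)))"
        using A m \<delta> by (intro vitali_maximal_Kolmogorov) (auto simp: emeasure_lebesgue_ball m_def simp del: emeasure_completion)
    qed auto
    also have "\<dots> = (ennreal ((5 ^ ?n) powr \<delta>) * ennreal (\<kappa> powr \<delta> / (1 - \<delta>)) + ennreal (\<kappa> powr \<delta>)) * X * ennreal D"
      by (simp only: distrib_right mult.assoc)
    also have "ennreal ((5 ^ ?n) powr \<delta>) * ennreal (\<kappa> powr \<delta> / (1 - \<delta>)) + ennreal (\<kappa> powr \<delta>) = ennreal C"
      using \<delta> by (simp add: C_def algebra_simps flip: ennreal_mult ennreal_plus)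
    finally have "ball_integral (\<lambda>y. ennreal_powr (?M y) \<delta>) z r \<le> ennreal D * (ennreal C * X)"
      by (simp only: mult_ac)
    then show ?thesis
      unfolding Psi_average_def m_def[symmetric] D_def[symmetric] X_def
      using D by (intro divide_le_posI_ennreal) auto
  qed
  have "maximal \<rho> \<theta> (\<lambda>x. ennreal_powr (?M x) \<delta>) x \<le> ennreal C * ennreal_powr (?M x) \<delta>" for x
    by (intro maximal_le bound)
  then show ?thesis
    unfolding A1_condition_def by (intro conjI exI[of _ C] AE_I2 borel_measurable_ennreal_powr borel_measurable_maximal)
qed

end

section \<open>The critical radius of a reverse Hoelder potential\<close>

text \<open>Rounding the number log_a (R / r) of steps up costs the leading factor \<open>K\<close>;
  the rest is the identity K^(log_a s) = s^(log_a K).\<close>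

lemma log_iteration_upper:
  fixes g :: "real \<Rightarrow> real"
  assumes mono: "\<And>r R. 0 < r \<Longrightarrow> r \<le> R \<Longrightarrow> g r \<le> g R" and nonneg: "\<And>r. 0 \<le> g r"
    and step: "\<And>r. 0 < r \<Longrightarrow> g (a * r) \<le> K * g r" and a: "1 < a" and K: "1 \<le> K"
    and r: "0 < r" "r \<le> R"
  shows "g R \<le> K * (R / r) powr (log a K) * g r"
proof -
  define m where "m = nat \<lceil>log a (R / r)\<rceil>"
  have log0: "0 \<le> log a (R / r)"
    using a r by simp
  have m: "log a (R / r) \<le> real m" "real m \<le> log a (R / r) + 1"
    using log0 by (simp_all add: m_def of_nat_nat)
  have iter: "g (a ^ j * r) \<le> K ^ j * g r" for j
  proof (induction j)
    case (Suc j)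
    have "g (a ^ Suc j * r) = g (a * (a ^ j * r))" by (simp add: mult.assoc)
    also have "\<dots> \<le> K * g (a ^ j * r)" using a r by (intro step) simp
    also have "\<dots> \<le> K * (K ^ j * g r)" using Suc K by (intro mult_left_mono) auto
    finally show ?case by (simp add: mult.assoc)
  qed simp
  have Rr: "R / r = a powr (log a (R / r))"
    using a r by simp
  also have "\<dots> \<le> a powr (real m)"
    using a m by (intro powr_mono) auto
  finally have "R \<le> a ^ m * r"
    using a r by (simp add: powr_realpow divide_le_eq)
  then have "g R \<le> g (a ^ m * r)"
    using r by (intro mono) auto
  also have "\<dots> \<le> K ^ m * g r" by (rule iter)
  also have "\<dots> \<le> (K * (R / r) powr (log a K)) * g r"
  proof (rule mult_right_mono[OF _ nonneg])
    have "K ^ m = K powr (real m)" using K by (simp add: powr_realpow)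
    also have "\<dots> \<le> K powr (log a (R / r) + 1)" using K m by (intro powr_mono) auto
    also have "\<dots> = K * K powr (log a (R / r))" using K by (simp add: powr_add)
    also have "K powr (log a (R / r)) = (R / r) powr (log a K)"
      using K a r by (simp add: powr_def log_def mult.commute)
    finally show "K ^ m \<le> K * (R / r) powr (log a K)" .
  qed
  finally show ?thesis .
qed

text \<open>The number of steps is rounded down here, since the dilated radius must not exceed
  \<open>R\<close>; this costs the factor 1 / \<gamma>.\<close>

lemma log_iteration_lower:
  fixes g :: "real \<Rightarrow> real"
  assumes mono: "\<And>r R. 0 < r \<Longrightarrow> r \<le> R \<Longrightarrow> g r \<le> g R" and nonneg: "\<And>r. 0 \<le> g r"
    and step: "\<And>r. 0 < r \<Longrightarrow> g r \<le> \<gamma> * g (b * r)" and b: "1 < b" and \<gamma>: "0 < \<gamma>" "\<gamma> < 1"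
    and r: "0 < r" "r \<le> R"
  shows "g r \<le> (1 / \<gamma>) * (r / R) powr (log b (1 / \<gamma>)) * g R"
proof -
  define m where "m = nat \<lfloor>log b (R / r)\<rfloor>"
  have log0: "0 \<le> log b (R / r)"
    using b r by simp
  have m: "real m \<le> log b (R / r)" "log b (R / r) - 1 \<le> real m"
    using log0 by (simp_all add: m_def of_nat_nat)
  have iter: "g r \<le> \<gamma> ^ j * g (b ^ j * r)" for j
  proof (induction j)
    case (Suc j)
    have "g (b ^ j * r) \<le> \<gamma> * g (b * (b ^ j * r))"
      using b r by (intro step) simp
    then have "\<gamma> ^ j * g (b ^ j * r) \<le> \<gamma> ^ j * (\<gamma> * g (b * (b ^ j * r)))"
      using \<gamma> by (intro mult_left_mono) auto
    with Suc show ?case by (simp add: mult_ac)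
  qed simp
  have "b ^ m = b powr (real m)" using b by (simp add: powr_realpow)
  also have "\<dots> \<le> b powr (log b (R / r))" using b m by (intro powr_mono) auto
  also have "\<dots> = R / r" using b r by simp
  finally have "b ^ m * r \<le> R" using r by (simp add: le_divide_eq)
  then have "g (b ^ m * r) \<le> g R" using b r by (intro mono) auto
  then have "\<gamma> ^ m * g (b ^ m * r) \<le> \<gamma> ^ m * g R" using \<gamma> by (intro mult_left_mono) auto
  also have "\<dots> \<le> ((1 / \<gamma>) * (r / R) powr (log b (1 / \<gamma>))) * g R"
  proof (rule mult_right_mono[OF _ nonneg])
    have "\<gamma> ^ m = \<gamma> powr (real m)" using \<gamma> by (simp add: powr_realpow)
    also have "\<dots> \<le> \<gamma> powr (log b (R / r) - 1)" using \<gamma> m by (intro powr_mono') auto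
    also have "\<dots> = (1 / \<gamma>) * \<gamma> powr (log b (R / r))" using \<gamma> by (simp add: powr_diff)
    also have "\<gamma> powr (log b (R / r)) = (r / R) powr (log b (1 / \<gamma>))"
      using \<gamma> b r by (simp add: powr_def log_def ln_div algebra_simps diff_divide_distrib)
    finally show "\<gamma> ^ m \<le> (1 / \<gamma>) * (r / R) powr (log b (1 / \<gamma>))" .
  qed
  finally show ?thesis using iter[of m] by linarith
qed

lemma set_nn_integral_eq_set_lebesgue_integral:
  assumes "set_integrable M E f" "\<And>x. 0 \<le> f x"
  shows "(\<integral>\<^sup>+x\<in>E. ennreal (f x) \<partial>M) = ennreal (LINT x:E|M. f x)"
proof -
  have "(\<integral>\<^sup>+x\<in>E. ennreal (f x) \<partial>M) = (\<integral>\<^sup>+x. ennreal (indicator E x *\<^sub>R f x) \<partial>M)"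
    by (intro nn_integral_cong) (simp add: indicator_def)
  also have "\<dots> = ennreal (LINT x:E|M. f x)"
    unfolding set_lebesgue_integral_def using assms
    by (intro nn_integral_eq_integral) (auto simp: set_integrable_def)
  finally show ?thesis .
qed

section \<open>Mass of a potential in the reverse Hoelder class\<close>

locale schroedinger_potential =
  fixes V :: "'a::euclidean_space \<Rightarrow> real"
  assumes dim: "3 \<le> DIM('a)"
    and V: "V \<in> reverse_holder_class (real DIM('a) / 2)"
    and V_nonzero: "\<not> (AE x in lebesgue. V x = 0)"
begin

definition "q = real DIM('a) / 2"
definition "U E = (LINT y:E|lebesgue. V y)"
definition "W E = (LINT y:E|lebesgue. V y powr q)"

lemma q_gt_1: "1 < q"
  using dim by (simp add: q_def)

lemma V_nonneg: "0 \<le> V x"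
  using V by (auto simp: reverse_holder_class_def)

lemma V_measurable [measurable]: "V \<in> borel_measurable lebesgue"
  using V by (auto simp: reverse_holder_class_def)

lemma integrable_W: "E \<in> sets lebesgue \<Longrightarrow> E \<subseteq> ball x r \<Longrightarrow> set_integrable lebesgue E (\<lambda>y. V y powr q)"
proof -
  assume E: "E \<in> sets lebesgue" "E \<subseteq> ball x r"
  have "set_integrable lebesgue (cball x r) (\<lambda>y. V y powr q)"
    using V by (simp add: reverse_holder_class_def locally_integrable_def q_def)
  then show ?thesis
    by (rule set_integrable_subset) (use E in auto)
qed

lemma integrable_U:
  assumes E: "E \<in> sets lebesgue" "E \<subseteq> ball x r"
  shows "set_integrable lebesgue E V"
proof -
  have "set_integrable lebesgue (ball x r) (\<lambda>y. 1 + V y powr q)"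
    using integrable_W[of "ball x r" x r]
    by (intro set_integral_add) (auto simp: set_integrable_def emeasure_lebesgue_ball less_top[symmetric] simp del: emeasure_completion)
  then have "set_integrable lebesgue (ball x r) V"
  proof (rule set_integrable_bound)
    show "set_borel_measurable lebesgue (ball x r) V"
      unfolding set_borel_measurable_def by measurable
    \<comment> \<open>Only V^q is known to be locally integrable; it dominates \<open>V\<close> up
      to the constant 1.\<close>
    have "V y \<le> 1 + V y powr q" for y
    proof (cases "V y \<le> 1")
      case False
      then have "V y powr 1 \<le> V y powr q" using q_gt_1 by (intro powr_mono) auto
      then show ?thesis using False by simp
    qed (simp add: add_increasing2)
    then show "AE y in lebesgue. y \<in> ball x r \<longrightarrow> norm (V y) \<le> norm (1 + V y powr q)"
      using V_nonneg by simp
  qed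
  then show ?thesis
    by (rule set_integrable_subset) (use E in auto)
qed

lemma U_nonneg: "0 \<le> U E" and W_nonneg: "0 \<le> W E"
  unfolding U_def W_def set_lebesgue_integral_def using V_nonneg by (auto intro!: integral_nonneg_AE)

lemma U_Diff:
  assumes "E \<in> sets lebesgue" "F \<in> sets lebesgue" "E \<subseteq> F" "F \<subseteq> ball x r"
  shows "U F = U E + U (F - E)"
proof -
  have "U (E \<union> (F - E)) = U E + U (F - E)"
    unfolding U_def using assms by (intro set_integral_Un integrable_U[of _ x r]) auto
  moreover have "E \<union> (F - E) = F" using assms by auto
  ultimately show ?thesis by simp
qed

lemma W_Diff:
  assumes "E \<in> sets lebesgue" "F \<in> sets lebesgue" "E \<subseteq> F" "F \<subseteq> ball x r"
  shows "W F = W E + W (F - E)"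
proof -
  have "W (E \<union> (F - E)) = W E + W (F - E)"
    unfolding W_def using assms by (intro set_integral_Un integrable_W[of _ x r]) auto
  moreover have "E \<union> (F - E) = F" using assms by auto
  ultimately show ?thesis by simp
qed

lemma U_mono:
  "E \<in> sets lebesgue \<Longrightarrow> F \<in> sets lebesgue \<Longrightarrow> E \<subseteq> F \<Longrightarrow> F \<subseteq> ball x r \<Longrightarrow> U E \<le> U F"
  using U_Diff[of E F x r] U_nonneg[of "F - E"] by simp

lemma W_mono:
  "E \<in> sets lebesgue \<Longrightarrow> F \<in> sets lebesgue \<Longrightarrow> E \<subseteq> F \<Longrightarrow> F \<subseteq> ball x r \<Longrightarrow> W E \<le> W F"
  using W_Diff[of E F x r] W_nonneg[of "F - E"] by simp

lemma Hoelder: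
  assumes E: "E \<in> sets lebesgue" "E \<subseteq> ball x r" and m: "emeasure lebesgue E = ennreal m" "0 < m"
  shows "U E powr q \<le> m powr (q - 1) * W E"
proof -
  have "(\<integral>\<^sup>+y\<in>E. ennreal (V y) \<partial>lebesgue) = ennreal (U E)"
    unfolding U_def using integrable_U[OF E] V_nonneg by (rule set_nn_integral_eq_set_lebesgue_integral)
  moreover have "(\<integral>\<^sup>+y\<in>E. ennreal_powr (ennreal (V y)) q \<partial>lebesgue) = ennreal (W E)"
    unfolding W_def using integrable_W[OF E] V_nonneg
    by (subst set_nn_integral_eq_set_lebesgue_integral[symmetric]) (auto simp: ennreal_powr_ennreal)
  moreover have "ennreal_powr (\<integral>\<^sup>+y\<in>E. ennreal (V y) \<partial>lebesgue) q
      \<le> ennreal (m powr (q - 1)) * (\<integral>\<^sup>+y\<in>E. ennreal_powr (ennreal (V y)) q \<partial>lebesgue)"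
    using E m q_gt_1 by (intro nn_integral_power_mean) auto
  ultimately have "ennreal (U E powr q) \<le> ennreal (m powr (q - 1) * W E)"
    using U_nonneg[of E] W_nonneg[of E] by (simp add: ennreal_powr_ennreal ennreal_mult)
  then show ?thesis
    using W_nonneg[of E] by (subst (asm) ennreal_le_iff) auto
qed

text \<open>The constant of the reverse Hoelder inequality after raising it to the power q and
  clearing the averages. It is fixed once, and taken at least 1, because the next constants depend
  on it.\<close>

definition "B_const = (SOME C. 1 \<le> C \<and> (\<forall>x r. 0 < r \<longrightarrow>
  W (ball x r) \<le> C powr q * U (ball x r) powr q * vol x r powr (1 - q)))"

lemma B_const: "1 \<le> B_const" "0 < r \<Longrightarrow>
  W (ball x r) \<le> B_const powr q * U (ball x r) powr q * vol x r powr (1 - q)"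
proof -
  obtain C0 where C0: "\<And>x r. 0 < r \<Longrightarrow> (W (ball x r) / vol x r) powr (1 / q)
      \<le> C0 * (U (ball x r) / vol x r)"
    using V unfolding reverse_holder_class_def U_def W_def q_def by blast
  define C where "C = max 1 C0"
  have "W (ball x r) \<le> C powr q * U (ball x r) powr q * vol x r powr (1 - q)"
    if r: "0 < r" for x r
  proof -
    define m where "m = vol x r"
    have m: "0 < m" unfolding m_def by (rule measure_lebesgue_ball_pos[OF r])
    have "(W (ball x r) / m) powr (1 / q) \<le> C0 * (U (ball x r) / m)"
      unfolding m_def by (rule C0[OF r])
    also have "\<dots> \<le> C * (U (ball x r) / m)"
      using m U_nonneg[of "ball x r"] by (intro mult_right_mono) (auto simp: C_def)
    finally have "((W (ball x r) / m) powr (1 / q)) powr q \<le> (C * (U (ball x r) / m)) powr q"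
      using q_gt_1 by (intro powr_mono2) auto
    then have "W (ball x r) / m \<le> C powr q * (U (ball x r) powr q / m powr q)"
      using q_gt_1 m U_nonneg[of "ball x r"] W_nonneg[of "ball x r"]
      by (simp add: powr_powr powr_mult powr_divide C_def)
    then have "W (ball x r) \<le> C powr q * (U (ball x r) powr q / m powr q) * m"
      using m by (simp only: pos_divide_le_eq)
    then show ?thesis
      using m unfolding m_def[symmetric] by (simp add: powr_diff)
  qed
  then have "1 \<le> C \<and> (\<forall>x r. 0 < r \<longrightarrow>
     W (ball x r) \<le> C powr q * U (ball x r) powr q * vol x r powr (1 - q))"
    by (simp add: C_def)
  then have *: "1 \<le> B_const \<and> (\<forall>x r. 0 < r \<longrightarrow>
     W (ball x r) \<le> B_const powr q * U (ball x r) powr q * vol x r powr (1 - q))"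
    unfolding B_const_def by (rule someI)
  show "1 \<le> B_const" "0 < r \<Longrightarrow>
    W (ball x r) \<le> B_const powr q * U (ball x r) powr q * vol x r powr (1 - q)"
    using * by blast+
qed

text \<open>Solves small^(q-1) B_const^q = 2^(-q), which is what \<open>U_half\<close>
  needs.\<close>

definition "small = (2 * B_const) powr (- (q / (q - 1)))"

lemma small: "0 < small" "small < 1" "small powr (q - 1) = (2 * B_const) powr (- q)"
proof -
  have "small < (2 * B_const) powr 0"
    unfolding small_def using B_const(1) q_gt_1 by (intro powr_less_mono) auto
  then show "small < 1" using B_const(1) by simp
  show "0 < small" using B_const(1) by (simp add: small_def)
  show "small powr (q - 1) = (2 * B_const) powr (- q)"
    using q_gt_1 by (simp add: small_def powr_powr)
qed

text \<open>Hoelder's inequality on \<open>E\<close> followed by the reverse inequality on the ball: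
  a set of small relative measure carries a small share of the mass of \<open>V\<close>.\<close>

lemma U_half:
  assumes r: "0 < r" and E: "E \<in> sets lebesgue" "E \<subseteq> ball x r"
    and m: "emeasure lebesgue E = ennreal m" "0 < m" and le: "m \<le> small * vol x r"
  shows "U E \<le> U (ball x r) / 2"
proof (rule ccontr)
  assume neg: "\<not> ?thesis"
  define b where "b = vol x r"
  have b: "0 < b" unfolding b_def by (rule measure_lebesgue_ball_pos[OF r])
  have "(U (ball x r) / 2) powr q < U E powr q"
    using neg q_gt_1 U_nonneg[of "ball x r"] by (intro powr_less_mono2) auto
  also have "\<dots> \<le> m powr (q - 1) * W E"
    by (rule Hoelder[OF E m])
  also have "\<dots> \<le> (small * b) powr (q - 1) * (B_const powr q * U (ball x r) powr q * b powr (1 - q))"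
  proof (intro mult_mono powr_mono2)
    show "W E \<le> B_const powr q * U (ball x r) powr q * b powr (1 - q)"
      unfolding b_def using W_mono[OF E(1) _ E(2), of x r] B_const(2)[OF r, of x] by simp
  qed (use q_gt_1 m le W_nonneg in \<open>auto simp: b_def\<close>)
  also have "\<dots> = (2 * B_const) powr (- q) * B_const powr q * U (ball x r) powr q * (b powr (q - 1) * b powr (1 - q))"
    using b small by (simp add: powr_mult)
  also have "b powr (q - 1) * b powr (1 - q) = 1"
    using b by (simp flip: powr_add)
  also have "(2 * B_const) powr (- q) * B_const powr q * U (ball x r) powr q * 1 = (U (ball x r) / 2) powr q"
    using B_const(1) U_nonneg[of "ball x r"] by (simp add: powr_minus powr_mult powr_divide field_simps)
  finally show False by simp
qed

lemma annulus:
  fixes x :: 'a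
  assumes "0 < r" "1 < a"
  shows "emeasure lebesgue (ball x (a * r) - ball x r) = ennreal ((a ^ DIM('a) - 1) * vol x r)"
    "0 < (a ^ DIM('a) - 1) * vol x r" "ball x r \<subseteq> ball x (a * r)"
proof -
  have "r \<le> a * r" using assms by simp
  then show sub: "ball x r \<subseteq> ball x (a * r)" by (rule subset_ball)
  have "emeasure lebesgue (ball x (a * r) - ball x r) = emeasure lebesgue (ball x (a * r)) - emeasure lebesgue (ball x r)"
    by (rule emeasure_Diff) (use sub in \<open>auto simp: emeasure_lebesgue_ball simp del: emeasure_completion\<close>)
  also have "\<dots> = ennreal (vol x (a * r) - vol x r)"
    unfolding emeasure_lebesgue_ball by (intro ennreal_minus) simp
  also have "vol x (a * r) - vol x r = (a ^ DIM('a) - 1) * vol x r"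
    using assms measure_lebesgue_ball_scale[of r a x x] by (simp add: algebra_simps)
  finally show "emeasure lebesgue (ball x (a * r) - ball x r) = ennreal ((a ^ DIM('a) - 1) * vol x r)" .
  have "1 < a ^ DIM('a)" using assms dim by (intro one_less_power) auto
  then show "0 < (a ^ DIM('a) - 1) * vol x r"
    using measure_lebesgue_ball_pos[OF assms(1), of x] by simp
qed

lemma doubling: "\<exists>d\<ge>0. \<forall>x r R. 0 < r \<longrightarrow> r \<le> R \<longrightarrow> U (ball x R) \<le> 2 * (R / r) powr d * U (ball x r)"
proof -
  let ?n = "DIM('a)"
  \<comment> \<open>With a^n = 1 / (1 - small) the annulus between radii r and a r is exactly the
    fraction \<open>small\<close> of the larger ball, so dilation by \<open>a\<close> at most
    doubles the mass.\<close>
  define a where "a = (1 - small) powr (- 1 / real ?n)"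
  have n: "0 < real ?n" using dim by simp
  have "(1 - small) powr 0 < a"
    unfolding a_def using small n by (intro powr_less_mono') auto
  then have a: "1 < a" using small by simp
  have "a ^ ?n = a powr (real ?n)" using a by (simp add: powr_realpow)
  also have "\<dots> = 1 / (1 - small)" 
  proof -
    have "- 1 / real ?n * real ?n = - 1" using n by simp
    then have "a powr (real ?n) = (1 - small) powr (- 1)" by (simp only: a_def powr_powr)
    then show ?thesis using small by (simp add: powr_minus inverse_eq_divide)
  qed
  finally have an: "(a ^ ?n - 1) = small * a ^ ?n" using small by (simp add: field_simps)
  have step: "U (ball x (a * r)) \<le> 2 * U (ball x r)" if r: "0 < r" for x r
  proof -
    have "U (ball x (a * r) - ball x r) \<le> U (ball x (a * r)) / 2"
      using annulus[OF r a, of x] r a an measure_lebesgue_ball_scale[of r a x x] by (intro U_half) auto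
    moreover have "U (ball x (a * r)) = U (ball x r) + U (ball x (a * r) - ball x r)"
      using annulus(3)[OF r a, of x] by (intro U_Diff[of _ _ x "a * r"]) auto
    ultimately show ?thesis by simp
  qed
  show ?thesis
  proof (intro exI[of _ "log a 2"] conjI allI impI)
    show "0 \<le> log a 2" using a by simp
    fix x r R assume "0 < r" "r \<le> (R::real)"
    then show "U (ball x R) \<le> 2 * (R / r) powr (log a 2) * U (ball x r)"
      using a step by (intro log_iteration_upper[where g = "\<lambda>r. U (ball x r)"])
        (auto intro: U_nonneg U_mono[of _ _ x] subset_ball)
  qed
qed

text \<open>The gain \<open>\<beta>\<close> over the exponent given by Hoelder's inequality replaces the
  self-improvement of the reverse Hoelder class: a small concentric ball carries at most half of
  the mass of \<open>V\<close>, so the annulus carries a fixed portion of the mass of \<open>V\<^sup>q\<close>.\<close>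

lemma growth: "\<exists>K\<ge>1. \<exists>\<beta>>0. \<forall>x r R. 0 < r \<longrightarrow> r \<le> R \<longrightarrow>
  U (ball x r) \<le> K * (r / R) powr (real DIM('a) - 2 + \<beta>) * U (ball x R)"
proof -
  let ?n = "DIM('a)"
  \<comment> \<open>Here b^n = 1 / small, so the inner ball is the fraction \<open>small\<close> of
    the larger one and the annulus keeps at least half of the mass.\<close>
  define b where "b = small powr (- 1 / real ?n)"
  have n: "0 < real ?n" using dim by simp
  have "small powr 0 < b"
    unfolding b_def using small n by (intro powr_less_mono') auto
  then have b: "1 < b" using small by simp
  have "b ^ ?n = b powr (real ?n)" using b by (simp add: powr_realpow)
  also have "\<dots> = 1 / small" 
  proof -
    have "- 1 / real ?n * real ?n = - 1" using n by simp
    then have "b powr (real ?n) = small powr (- 1)" by (simp only: b_def powr_powr)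
    then show ?thesis using small(1) by (simp add: powr_minus inverse_eq_divide)
  qed
  finally have bn: "small * b ^ ?n = 1" using small by simp
  \<comment> \<open>The annulus holds at least the fraction (2 B_const)^(-q) of the integral of V^q;
    \<gamma> is what remains for the inner ball.\<close>
  define \<gamma> where "\<gamma> = 1 - (2 * B_const) powr (- q)"
  have "(2 * B_const) powr (- q) < (2 * B_const) powr 0"
    using B_const(1) q_gt_1 by (intro powr_less_mono) auto
  then have \<gamma>: "0 < \<gamma>" "\<gamma> < 1"
    using B_const(1) by (simp_all add: \<gamma>_def)
  have step: "W (ball x r) \<le> \<gamma> * W (ball x (b * r))" if r: "0 < r" for x r
  proof -
    let ?A = "ball x (b * r) - ball x r"
    define m where "m = (b ^ ?n - 1) * vol x r"
    define M where "M = vol x (b * r)"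
    note A = annulus[OF r b, of x, folded m_def]
    have br: "0 < b * r" using r b by simp
    have M: "0 < M" unfolding M_def by (rule measure_lebesgue_ball_pos[OF br])
    have Mr: "M = b ^ ?n * vol x r"
      unfolding M_def using r b by (intro measure_lebesgue_ball_scale) auto
    have mM: "m \<le> M"
      unfolding m_def Mr by (intro mult_right_mono) auto
    have "U (ball x r) \<le> U (ball x (b * r)) / 2"
    proof (rule U_half[OF br])
      have "small * (b ^ ?n * vol x r) = vol x r"
        by (simp only: mult.assoc[symmetric] bn mult_1)
      then show "vol x r \<le> small * vol x (b * r)"
        unfolding M_def[symmetric] Mr by (simp only: order_refl)
    qed (use A(3) measure_lebesgue_ball_pos[OF r, of x] in \<open>auto simp: emeasure_lebesgue_ball simp del: emeasure_completion\<close>)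
    moreover have "U (ball x (b * r)) = U (ball x r) + U ?A"
      using A(3) by (intro U_Diff[of _ _ x "b * r"]) auto
    ultimately have UA: "U (ball x (b * r)) / 2 \<le> U ?A" by simp
    have "(2 * B_const) powr (- q) * W (ball x (b * r))
        \<le> (2 * B_const) powr (- q) * (B_const powr q * U (ball x (b * r)) powr q * M powr (1 - q))"
      unfolding M_def by (intro mult_left_mono B_const(2) br) auto
    also have "\<dots> = (U (ball x (b * r)) / 2) powr q * M powr (1 - q)"
      using B_const(1) U_nonneg[of "ball x (b * r)"] by (simp add: powr_minus powr_mult powr_divide field_simps)
    also have "\<dots> \<le> U ?A powr q * m powr (1 - q)"
      using UA U_nonneg[of "ball x (b * r)"] A(2) mM q_gt_1
      by (intro mult_mono powr_mono2 powr_mono2') auto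
    also have "\<dots> \<le> (m powr (q - 1) * W ?A) * m powr (1 - q)"
      using A by (intro mult_right_mono Hoelder[of _ x "b * r"]) auto
    also have "\<dots> = (m powr (q - 1) * m powr (1 - q)) * W ?A" by simp
    also have "\<dots> = W ?A"
      using A(2) by (simp flip: powr_add)
    finally have "(2 * B_const) powr (- q) * W (ball x (b * r)) \<le> W ?A" .
    moreover have "W (ball x (b * r)) = W (ball x r) + W ?A"
      using A(3) by (intro W_Diff[of _ _ x "b * r"]) auto
    ultimately show ?thesis
      by (simp add: \<gamma>_def algebra_simps)
  qed
  define \<alpha> where "\<alpha> = log b (1 / \<gamma>)"
  have \<alpha>: "0 < \<alpha>" unfolding \<alpha>_def using b \<gamma> by simp
  \<comment> \<open>As q = n / 2, the volume factor in Hoelder's inequality becomes exactly the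
    critical power n - 2 after a q-th root; the decay \<alpha> of the integral of V^q adds \<alpha>
    / q.\<close>
  have q: "0 < q" "real ?n * (q - 1) = (real ?n - 2) * q"
    using q_gt_1 by (simp_all add: q_def algebra_simps)
  have "(1::real) * 1 \<le> (1 / \<gamma>) powr (1 / q) * B_const"
    using \<gamma> q B_const(1) by (intro mult_mono ge_one_powr_ge_zero) auto
  then have K: "1 \<le> (1 / \<gamma>) powr (1 / q) * B_const" by simp
  have \<beta>: "0 < \<alpha> / q" using \<alpha> q by simp
  show ?thesis
  proof (rule exI[of _ "(1 / \<gamma>) powr (1 / q) * B_const"], rule conjI[OF K], rule exI[of _ "\<alpha> / q"],
      rule conjI[OF \<beta>], intro allI impI)
    fix x :: 'a and r R assume r: "0 < r" "r \<le> (R::real)"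
    then have R: "0 < R" by simp
    let ?m = "vol x r" and ?M = "vol x R"
    have m: "0 < ?m" "0 < ?M" using r R by (auto intro!: measure_lebesgue_ball_pos simp del: measure_completion)
    have mM: "?m powr (q - 1) * ?M powr (1 - q) = (r / R) powr ((real ?n - 2) * q)"
    proof -
      have "?m powr (q - 1) * ?M powr (1 - q) = (?m / ?M) powr (q - 1)"
        using m by (simp add: powr_divide powr_diff)
      also have "?m / ?M = (r / R) ^ ?n"
        using r R unit_ball_vol_pos[of "real ?n"]
        by (simp add: measure_lebesgue_ball power_divide less_imp_neq[symmetric] del: measure_completion unit_ball_vol_pos)
      also have "((r / R) ^ ?n) powr (q - 1) = (r / R) powr (real ?n * (q - 1))"
        using r R by (simp add: powr_powr flip: powr_realpow)
      finally show ?thesis by (simp only: q(2))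
    qed
    have "U (ball x r) powr q \<le> ?m powr (q - 1) * W (ball x r)"
      using m by (intro Hoelder[of _ x r]) (auto simp: emeasure_lebesgue_ball simp del: emeasure_completion)
    also have "\<dots> \<le> ?m powr (q - 1) * ((1 / \<gamma>) * (r / R) powr \<alpha> * W (ball x R))"
      unfolding \<alpha>_def using r b \<gamma> step
      by (intro mult_left_mono log_iteration_lower[where g = "\<lambda>r. W (ball x r)"])
        (auto intro: W_nonneg W_mono[of _ _ x] subset_ball)
    also have "\<dots> \<le> ?m powr (q - 1) * ((1 / \<gamma>) * (r / R) powr \<alpha> * (B_const powr q * U (ball x R) powr q * ?M powr (1 - q)))"
      using \<gamma> R by (intro mult_left_mono B_const(2)) auto
    also have "\<dots> = (?m powr (q - 1) * ?M powr (1 - q)) * (r / R) powr \<alpha> * (1 / \<gamma>) * B_const powr q * U (ball x R) powr q"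
      by (simp only: mult_ac)
    also have "\<dots> = ((1 / \<gamma>) powr (1 / q) * B_const * (r / R) powr (real ?n - 2 + \<alpha> / q) * U (ball x R)) powr q"
    proof -
      have "(real ?n - 2 + \<alpha> / q) * q = (real ?n - 2) * q + \<alpha>"
        using q by (simp add: algebra_simps)
      then show ?thesis
        unfolding mM using B_const(1) \<gamma> q U_nonneg[of "ball x R"]
        by (simp add: powr_mult powr_powr powr_add)
    qed
    finally have le: "U (ball x r) powr q \<le> ((1 / \<gamma>) powr (1 / q) * B_const * (r / R) powr (real ?n - 2 + \<alpha> / q) * U (ball x R)) powr q" .
    show "U (ball x r) \<le> (1 / \<gamma>) powr (1 / q) * B_const * (r / R) powr (real ?n - 2 + \<alpha> / q) * U (ball x R)"
    proof (rule ccontr)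
      assume "\<not> ?thesis"
      then have "((1 / \<gamma>) powr (1 / q) * B_const * (r / R) powr (real ?n - 2 + \<alpha> / q) * U (ball x R)) powr q < U (ball x r) powr q"
        using q B_const(1) U_nonneg[of "ball x R"] by (intro powr_less_mono2) auto
      with le show False by simp
    qed
  qed
qed

section \<open>Finiteness, positivity and slow variation of the critical radius\<close>

lemma U_pos: "\<exists>R\<ge>1. 0 < U (ball x R)"
proof (rule ccontr)
  assume neg: "\<not> ?thesis"
  have "AE y in lebesgue. y \<in> ball x (real (Suc N)) \<longrightarrow> V y = 0" for N
  proof -
    have "\<not> 0 < U (ball x (real (Suc N)))"
      using neg by (auto simp del: of_nat_Suc)
    then have "U (ball x (real (Suc N))) = 0"
      using U_nonneg[of "ball x (real (Suc N))"] by linarith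
    then have "(LINT y|lebesgue. indicator (ball x (real (Suc N))) y *\<^sub>R V y) = 0"
      unfolding U_def set_lebesgue_integral_def .
    then have "AE y in lebesgue. indicator (ball x (real (Suc N))) y *\<^sub>R V y = 0"
      using integrable_U[of "ball x (real (Suc N))" x "real (Suc N)"] V_nonneg
      unfolding set_integrable_def
      by (subst (asm) integral_nonneg_eq_0_iff_AE) auto
    then show ?thesis
      by (rule eventually_mono) (auto simp: indicator_def split: if_splits)
  qed
  then have "AE y in lebesgue. \<forall>N. y \<in> ball x (real (Suc N)) \<longrightarrow> V y = 0"
    by (simp only: AE_all_countable) blast
  then have "AE y in lebesgue. V y = 0"
  proof (rule eventually_mono)
    fix y assume *: "\<forall>N. y \<in> ball x (real (Suc N)) \<longrightarrow> V y = 0"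
    obtain N where "dist x y < real N" using reals_Archimedean2 by blast
    then have "y \<in> ball x (real (Suc N))" by simp
    with * show "V y = 0" by blast
  qed
  with V_nonzero show False by simp
qed

definition "S x = {r. 0 < r \<and> r powr (2 - real DIM('a)) * U (ball x r) \<le> 1}"

lemma critical_radius_eq: "critical_radius V x = Sup (S x)"
  by (simp add: critical_radius_def S_def U_def)

lemma S_iff: "r \<in> S x \<longleftrightarrow> 0 < r \<and> U (ball x r) \<le> r powr (real DIM('a) - 2)"
proof -
  have "r powr (2 - real DIM('a)) * u \<le> 1 \<longleftrightarrow> u \<le> r powr (real DIM('a) - 2)" if "0 < r" for u
  proof -
    have "r powr (2 - real DIM('a)) = 1 / r powr (real DIM('a) - 2)"
      using powr_minus_divide[of r "real DIM('a) - 2"] by simp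
    then show ?thesis using that by (simp only:) (simp add: divide_le_eq)
  qed
  then show ?thesis by (auto simp: S_def)
qed

text \<open>The surplus \<beta> in \<open>growth\<close> makes r^(2-n) times the mass of B(x, r)
  tend to 0 with r; the witness has r^\<beta> T = 1.\<close>

lemma S_nonempty: "S x \<noteq> {}"
proof -
  obtain K \<beta> where K: "1 \<le> K" "0 < \<beta>" and g: "\<And>x r R. 0 < r \<Longrightarrow> r \<le> R \<Longrightarrow>
      U (ball x r) \<le> K * (r / R) powr (real DIM('a) - 2 + \<beta>) * U (ball x R)"
    using growth by blast
  define T where "T = K * (U (ball x 1) + 1)"
  have T: "1 \<le> T" unfolding T_def using K U_nonneg[of "ball x 1"] mult_mono[of 1 K 1 "U (ball x 1) + 1"] by simp
  define r where "r = T powr (- 1 / \<beta>)"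
  have r: "0 < r" using T by (simp add: r_def)
  have "r \<le> T powr 0" unfolding r_def using T K by (intro powr_mono) auto
  then have r1: "r \<le> 1" using T by simp
  have "U (ball x r) \<le> K * (r / 1) powr (real DIM('a) - 2 + \<beta>) * U (ball x 1)"
    by (rule g[OF r r1])
  also have "\<dots> \<le> r powr (real DIM('a) - 2) * (r powr \<beta> * T)"
  proof -
    have "K * U (ball x 1) \<le> T" using K by (simp add: T_def distrib_left)
    then have "r powr (real DIM('a) - 2 + \<beta>) * (K * U (ball x 1)) \<le> r powr (real DIM('a) - 2 + \<beta>) * T"
      by (intro mult_left_mono) auto
    then show ?thesis
      unfolding powr_add by (simp add: mult_ac)
  qed
  also have "r powr \<beta> * T = 1"
  proof -
    have "- 1 / \<beta> * \<beta> = - 1" using K by simp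
    then have "r powr \<beta> = T powr (- 1)" by (simp only: r_def powr_powr)
    then show ?thesis using T by (simp add: powr_minus)
  qed
  finally show ?thesis using r by (auto simp: S_iff)
qed

text \<open>Read outwards from a ball of positive mass, the same surplus makes R^(2-n) times the
  mass of B(x, R) tend to infinity.\<close>

lemma S_bdd: "bdd_above (S x)"
proof -
  obtain K \<beta> where K: "1 \<le> K" "0 < \<beta>" and g: "\<And>x r R. 0 < r \<Longrightarrow> r \<le> R \<Longrightarrow>
      U (ball x r) \<le> K * (r / R) powr (real DIM('a) - 2 + \<beta>) * U (ball x R)"
    using growth by blast
  obtain R1 where R1: "1 \<le> R1" "0 < U (ball x R1)"
    using U_pos by blast
  let ?e = "real DIM('a) - 2"
  define T where "T = K * R1 powr (?e + \<beta>) / U (ball x R1)"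
  have T: "0 < T" using K R1 by (simp add: T_def)
  have "R \<le> max R1 (T powr (1 / \<beta>))" if R: "R \<in> S x" for R
  proof (cases "R \<le> R1")
    case False
    then have R': "R1 \<le> R" "0 < R" using R1 by auto
    have UR: "U (ball x R) \<le> R powr ?e" using R by (simp add: S_iff)
    have "U (ball x R1) \<le> K * (R1 / R) powr (?e + \<beta>) * U (ball x R)"
      using R1 R' by (intro g) auto
    also have "\<dots> \<le> K * (R1 / R) powr (?e + \<beta>) * R powr ?e"
      using K by (intro mult_left_mono UR) auto
    also have "\<dots> = K * R1 powr (?e + \<beta>) / R powr \<beta>"
      using R' R1 by (simp add: powr_divide powr_add)
    finally have "R powr \<beta> \<le> T"
      using R' R1 by (simp add: T_def field_simps)
    then have "(R powr \<beta>) powr (1 / \<beta>) \<le> T powr (1 / \<beta>)"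
      using K by (intro powr_mono2) auto
    then show ?thesis using R' K by (simp add: powr_powr)
  qed simp
  then show ?thesis by (rule bdd_aboveI)
qed

lemma critical_radius_pos: "0 < critical_radius V x"
proof -
  obtain r where r: "r \<in> S x" using S_nonempty by blast
  then have "r \<le> critical_radius V x"
    unfolding critical_radius_eq by (rule cSup_upper[OF _ S_bdd])
  with r show ?thesis by (simp add: S_iff)
qed

text \<open>The ball about y of radius R = |x - y| + \<rho>(x) lies in B(x, 2 R), whose mass is
  bounded by doubling from the scale \<rho>(x), with a loss (R / \<rho>)^d. Shrinking the ball about
  y gains the power \<beta>, which compensates the loss and makes the radius admissible at y; hence
  k = d / \<beta>.\<close>

lemma critical_radius_slowly_varying:
  "\<exists>c>0. \<exists>k\<ge>0. \<forall>x y. c * critical_radius V x * (1 + dist x y / critical_radius V x) powr (- k) \<le> critical_radius V y"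
proof -
  let ?e = "real DIM('a) - 2"
  obtain K \<beta> where K: "1 \<le> K" "0 < \<beta>" and g: "\<And>x r R. 0 < r \<Longrightarrow> r \<le> R \<Longrightarrow>
      U (ball x r) \<le> K * (r / R) powr (?e + \<beta>) * U (ball x R)"
    using growth by blast
  obtain d where d: "0 \<le> d" and D: "\<And>x r R. 0 < r \<Longrightarrow> r \<le> R \<Longrightarrow> U (ball x R) \<le> 2 * (R / r) powr d * U (ball x r)"
    using doubling by blast
  define T where "T = 2 * K * 4 powr d"
  have "1 * 1 \<le> T"
    unfolding T_def using K d by (intro mult_mono ge_one_powr_ge_zero) auto
  then have T: "1 \<le> T" by simp
  have c: "0 < T powr (- 1 / \<beta>)" using T by simp
  have k: "0 \<le> d / \<beta>" using d K by simp
  show ?thesis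
  proof (rule exI[of _ "T powr (- 1 / \<beta>)"], rule conjI[OF c], rule exI[of _ "d / \<beta>"], rule conjI[OF k], intro allI)
    fix x y :: 'a
    define \<rho> where "\<rho> = critical_radius V x"
    have \<rho>: "0 < \<rho>" unfolding \<rho>_def by (rule critical_radius_pos)
    \<comment> \<open>An admissible radius above \<rho> / 2 stands in for the supremum. This gives
      one factor 2 in \<open>4 powr d\<close>; the radius 2 R gives the other.\<close>
    have "\<exists>r1\<in>S x. \<rho> / 2 < r1"
      using less_cSup_iff[OF S_nonempty S_bdd, of "\<rho> / 2" x] \<rho> by (simp add: \<rho>_def critical_radius_eq)
    then obtain r1 where r1: "r1 \<in> S x" "\<rho> / 2 < r1" by blast
    have r1\<rho>: "r1 \<le> \<rho>"
      unfolding \<rho>_def critical_radius_eq by (rule cSup_upper[OF r1(1) S_bdd])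
    have r1_pos: "0 < r1" using r1 by (simp add: S_iff)
    define R where "R = dist x y + \<rho>"
    have R: "\<rho> \<le> R" "0 < R" using \<rho> by (simp_all add: R_def add_nonneg_pos)
    have "U (ball y R) \<le> U (ball x (2 * R))"
    proof (rule U_mono[of _ _ x "2 * R"])
      show "ball y R \<subseteq> ball x (2 * R)"
      proof
        fix w assume "w \<in> ball y R"
        then show "w \<in> ball x (2 * R)"
          using dist_triangle[of x w y] \<rho> by (simp add: R_def)
      qed
    qed auto
    also have "\<dots> \<le> 2 * (2 * R / r1) powr d * U (ball x r1)"
      using r1_pos r1\<rho> R by (intro D) auto
    also have "\<dots> \<le> 2 * (4 * (R / \<rho>)) powr d * \<rho> powr ?e"
    proof (intro mult_mono powr_mono2)
      show "2 * R / r1 \<le> 4 * (R / \<rho>)"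
        using r1 r1_pos \<rho> R by (simp add: field_simps)
      have "U (ball x r1) \<le> r1 powr ?e" using r1(1) by (simp add: S_iff)
      also have "\<dots> \<le> \<rho> powr ?e" using r1_pos r1\<rho> dim by (intro powr_mono2) auto
      finally show "U (ball x r1) \<le> \<rho> powr ?e" .
    qed (use d r1_pos R U_nonneg in auto)
    finally have UR: "U (ball y R) \<le> 2 * (4 * (R / \<rho>)) powr d * \<rho> powr ?e" .
    \<comment> \<open>The solution of (r / R)^\<beta> T (R / \<rho>)^d = 1.\<close>
    define r where "r = R * (T powr (- 1 / \<beta>) * (R / \<rho>) powr (- (d / \<beta>)))"
    have r: "0 < r" using R T \<rho> by (simp add: r_def)
    have "T powr (- 1 / \<beta>) \<le> T powr 0" using T K by (intro powr_mono) auto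
    then have "T powr (- 1 / \<beta>) \<le> 1" using T by simp
    moreover have "(R / \<rho>) powr (- (d / \<beta>)) \<le> (R / \<rho>) powr 0" using R \<rho> K d by (intro powr_mono) auto
    then have "(R / \<rho>) powr (- (d / \<beta>)) \<le> 1" using R \<rho> by simp
    ultimately have "T powr (- 1 / \<beta>) * (R / \<rho>) powr (- (d / \<beta>)) \<le> 1" by (simp add: mult_le_one)
    then have rR: "r \<le> R" unfolding r_def using R by (simp add: mult_left_le)
    have "U (ball y r) \<le> K * (r / R) powr (?e + \<beta>) * U (ball y R)"
      by (rule g[OF r rR])
    also have "\<dots> \<le> K * (r / R) powr (?e + \<beta>) * (2 * (4 * (R / \<rho>)) powr d * \<rho> powr ?e)"
      using K by (intro mult_left_mono UR) auto
    also have "\<dots> = ((r / R) powr \<beta> * T * (R / \<rho>) powr d) * ((r / R) powr ?e * \<rho> powr ?e)"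
    proof -
      have "(4 * (R / \<rho>)) powr d = 4 powr d * (R / \<rho>) powr d"
        by (rule powr_mult)
      then show ?thesis
        by (simp only: T_def powr_add mult_ac)
    qed
    also have "(r / R) powr \<beta> * T * (R / \<rho>) powr d = 1"
    proof -
      have "r / R = T powr (- 1 / \<beta>) * (R / \<rho>) powr (- (d / \<beta>))" using R by (simp add: r_def)
      then have "(r / R) powr \<beta> = T powr (- 1) * (R / \<rho>) powr (- d)"
        using K by (simp add: powr_mult powr_powr)
      moreover have "(R / \<rho>) powr (- d) * (R / \<rho>) powr d = 1" "T powr (- 1) * T = 1"
        using T R \<rho> by (simp_all add: powr_minus)
      ultimately show ?thesis
        by (simp only: mult_ac)
    qed
    also have "1 * ((r / R) powr ?e * \<rho> powr ?e) \<le> (r / R) powr ?e * R powr ?e"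
      using R \<rho> dim by (simp add: mult_left_mono powr_mono2)
    also have "\<dots> = r powr ?e"
      using r R by (simp add: powr_divide)
    finally have "r \<in> S y" using r by (simp add: S_iff)
    then have "r \<le> critical_radius V y"
      unfolding critical_radius_eq by (rule cSup_upper[OF _ S_bdd])
    moreover have "T powr (- 1 / \<beta>) * \<rho> * (1 + dist x y / \<rho>) powr (- (d / \<beta>)) \<le> r"
    proof -
      have "1 + dist x y / \<rho> = R / \<rho>" using \<rho> by (simp add: R_def field_simps)
      then show ?thesis
        unfolding r_def using R by (simp add: mult_ac mult_right_mono mult_left_mono)
    qed
    ultimately show "T powr (- 1 / \<beta>) * critical_radius V x * (1 + dist x y / critical_radius V x) powr (- (d / \<beta>)) \<le> critical_radius V y"
      unfolding \<rho>_def by linarith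
  qed
qed

end

section \<open>Reverse Hoelder inequality for local A1 weights\<close>

text \<open>Subadditivity on the dilated balls and additivity on the disjoint ones. The value k = 5
  goes with Vitali's covering lemma, k = 1 with his covering theorem.\<close>

lemma disjoint_balls_integral_le:
  fixes f :: "'a::euclidean_space \<Rightarrow> ennreal" and C :: "('a \<times> real) set"
  assumes [measurable]: "f \<in> borel_measurable lebesgue" and C: "countable C"
    and disj: "pairwise (\<lambda>i j. disjnt (ball (fst i) (snd i)) (ball (fst j) (snd j))) C"
    and le: "\<And>x r. (x, r) \<in> C \<Longrightarrow> ball_integral f x (k * r) \<le> c * emeasure lebesgue (ball x r)"
  shows "(\<integral>\<^sup>+y\<in>(\<Union>i\<in>C. ball (fst i) (k * snd i)). f y \<partial>lebesgue) \<le> c * emeasure lebesgue (\<Union>i\<in>C. ball (fst i) (snd i))"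
proof -
  let ?F = "density lebesgue f"
  have "(\<integral>\<^sup>+y\<in>(\<Union>i\<in>C. ball (fst i) (k * snd i)). f y \<partial>lebesgue) = emeasure ?F (\<Union>i\<in>C. ball (fst i) (k * snd i))"
    using C by (intro emeasure_density[symmetric]) auto
  also have "\<dots> \<le> (\<integral>\<^sup>+i. emeasure ?F (ball (fst i) (k * snd i)) \<partial>count_space C)"
    using C by (intro emeasure_UN_countable_le) auto
  also have "\<dots> \<le> (\<integral>\<^sup>+i. c * emeasure lebesgue (ball (fst i) (snd i)) \<partial>count_space C)"
    using le by (intro nn_integral_mono) (auto simp: emeasure_density simp del: emeasure_completion)
  also have "\<dots> = c * (\<integral>\<^sup>+i. emeasure lebesgue (ball (fst i) (snd i)) \<partial>count_space C)"
    by (intro nn_integral_cmult) simp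
  also have "(\<integral>\<^sup>+i. emeasure lebesgue (ball (fst i) (snd i)) \<partial>count_space C) = emeasure lebesgue (\<Union>i\<in>C. ball (fst i) (snd i))"
    using C disj by (intro emeasure_UN_countable[symmetric])
      (auto simp: disjoint_family_on_def pairwise_def disjnt_def)
  finally show ?thesis .
qed

text \<open>The part of the Lebesgue differentiation theorem that the stopping time argument needs.
  The exceptional set need not be measurable a priori; Vitali's theorem covers it by balls inside
  a slightly larger open set, on which the averages are still at most \<open>l\<close>.\<close>

lemma negligible_small_averages:
  fixes f :: "'a::euclidean_space \<Rightarrow> real" and z :: 'a and R :: real
  assumes [measurable]: "f \<in> borel_measurable lebesgue" and f: "\<And>x. 0 \<le> f x" and l: "0 \<le> l" and d: "0 < d"
  defines "F \<equiv> {x \<in> ball z R. l < f x \<and>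
     (\<forall>r. 0 < r \<and> r < d \<longrightarrow> mass f x r \<le> ennreal l * emeasure lebesgue (ball x r))}"
  shows "negligible F"
proof -
  define E where "E = {x \<in> ball z R. l < f x}"
  have E_eq: "E = ball z R \<inter> {x \<in> space lebesgue. l < f x}" by (auto simp: E_def)
  have E [measurable]: "E \<in> sets lebesgue"
    unfolding E_eq by measurable
  \<comment> \<open>The excess of \<open>f\<close> over \<open>l\<close>, positive exactly on
    \<open>E\<close>: a set on which it integrates to 0 meets \<open>E\<close> in a null
    set.\<close>
  define h where "h x = ennreal (f x - l) * indicator E x" for x
  have [measurable]: "h \<in> borel_measurable lebesgue"
    unfolding h_def by measurable
  \<comment> \<open>\<open>G\<close> is a union of disjoint balls inside \<open>T\<close>, so it
    exceeds \<open>E\<close> by measure at most e. As \<open>f\<close> integrates over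
    \<open>G\<close> to at most l |G| and f = h + l on the part in \<open>E\<close>, only l e is
    left for the excess.\<close>
  have ex: "\<exists>G. G \<in> sets lebesgue \<and> negligible (F - G) \<and> (\<integral>\<^sup>+x\<in>G. h x \<partial>lebesgue) \<le> ennreal (l * e)" if e: "0 < e" for e
  proof -
    obtain T where T: "open T" "E \<subseteq> T" "emeasure lebesgue (T - E) < ennreal e"
      using sets_lebesgue_outer_open[OF E e] by metis
    define K where "K = {(x, r). x \<in> F \<and> 0 < r \<and> r < d \<and> ball x r \<subseteq> T}"
    have cover: "\<exists>i. i \<in> K \<and> x \<in> ball (fst i) (snd i) \<and> snd i < d'" if x: "x \<in> F" and d': "0 < d'" for x d'
    proof -
      have "x \<in> T" using x T by (auto simp: F_def E_def)
      then obtain r where r: "0 < r" "ball x r \<subseteq> T"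
        using T(1) openE by blast
      let ?r = "min (min r (d / 2)) (d' / 2)"
      have "ball x ?r \<subseteq> ball x r" by (intro subset_ball) simp
      then have "(x, ?r) \<in> K \<and> x \<in> ball (fst (x, ?r)) (snd (x, ?r)) \<and> snd (x, ?r) < d'"
        using x r d d' by (auto simp: K_def min_def)
      then show ?thesis by blast
    qed
    obtain C where C: "countable C" "C \<subseteq> K"
      "pairwise (\<lambda>i j. disjnt (ball (fst i) (snd i)) (ball (fst j) (snd j))) C"
      "negligible (F - (\<Union>i\<in>C. ball (fst i) (snd i)))"
      by (rule Vitali_covering_theorem_balls[of F K fst snd, OF cover]) (assumption | rule that)+
    define G where "G = (\<Union>i\<in>C. ball (fst i) (snd i))"
    have [measurable]: "G \<in> sets lebesgue" unfolding G_def using C(1) by auto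
    have GT: "G \<subseteq> T" unfolding G_def using C(2) by (fastforce simp: K_def)
    have "(\<integral>\<^sup>+y\<in>(\<Union>i\<in>C. ball (fst i) (1 * snd i)). ennreal (f y) \<partial>lebesgue) \<le> ennreal l * emeasure lebesgue G"
      unfolding G_def by (rule disjoint_balls_integral_le[OF _ C(1,3)])
        (use C(2) in \<open>auto simp: K_def F_def simp del: emeasure_completion\<close>)
    then have fG: "(\<integral>\<^sup>+y\<in>G. ennreal (f y) \<partial>lebesgue) \<le> ennreal l * emeasure lebesgue G"
      by (simp add: G_def del: emeasure_completion)
    have fin: "emeasure lebesgue (G \<inter> E) < top"
    proof -
      have "emeasure lebesgue (G \<inter> E) \<le> emeasure lebesgue (ball z R)"
        by (intro emeasure_mono) (auto simp: E_def)
      then show ?thesis by (simp add: emeasure_lebesgue_ball le_less_trans del: emeasure_completion)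
    qed
    have "(\<integral>\<^sup>+x\<in>G. h x \<partial>lebesgue) + ennreal l * emeasure lebesgue (G \<inter> E) =
        (\<integral>\<^sup>+x. h x * indicator G x + ennreal l * indicator (G \<inter> E) x \<partial>lebesgue)"
      by (subst nn_integral_add) (auto simp: nn_integral_cmult_indicator simp del: emeasure_completion)
    also have "\<dots> \<le> (\<integral>\<^sup>+y\<in>G. ennreal (f y) \<partial>lebesgue)"
      using l by (intro nn_integral_mono) (auto simp: h_def indicator_def E_def simp flip: ennreal_plus)
    also have "\<dots> \<le> ennreal l * emeasure lebesgue G" by (rule fG)
    also have "emeasure lebesgue G = emeasure lebesgue (G \<inter> E) + emeasure lebesgue (G - E)"
      by (subst plus_emeasure) (auto simp: Int_Diff_Un simp del: emeasure_completion)
    also have "emeasure lebesgue (G - E) \<le> ennreal e"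
    proof -
      have "emeasure lebesgue (G - E) \<le> emeasure lebesgue (T - E)"
        using GT T(1) by (intro emeasure_mono) auto
      then show ?thesis using T(3) by simp
    qed
    finally have *: "(\<integral>\<^sup>+x\<in>G. h x \<partial>lebesgue) + ennreal l * emeasure lebesgue (G \<inter> E)
       \<le> ennreal (l * e) + ennreal l * emeasure lebesgue (G \<inter> E)"
      using l e by (simp add: distrib_left ennreal_mult add.commute mult_left_mono add_left_mono del: emeasure_completion)
    have hG: "(\<integral>\<^sup>+x\<in>G. h x \<partial>lebesgue) \<le> ennreal (l * e)"
    proof -
      have "ennreal l * emeasure lebesgue (G \<inter> E) \<noteq> top"
        using fin by (simp add: ennreal_mult_eq_top_iff less_top del: emeasure_completion)
      then show ?thesis
        using * by (simp add: add.commute[of _ "ennreal l * emeasure lebesgue (G \<inter> E)"] ennreal_add_left_cancel_le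
            del: emeasure_completion)
    qed
    show ?thesis
      by (rule exI[of _ G], intro conjI hG C(4)[folded G_def]) fact
  qed
  have "\<forall>n. \<exists>G. G \<in> sets lebesgue \<and> negligible (F - G) \<and> (\<integral>\<^sup>+x\<in>G. h x \<partial>lebesgue) \<le> ennreal (l * (1 / real (Suc n)))"
    by (intro allI ex) (simp del: of_nat_Suc)
  from choice[OF this] obtain G where G: "\<And>n. G n \<in> sets lebesgue" "\<And>n. negligible (F - G n)"
      "\<And>n. (\<integral>\<^sup>+x\<in>G n. h x \<partial>lebesgue) \<le> ennreal (l * (1 / real (Suc n)))"
    by blast
  note [measurable] = G(1)
  \<comment> \<open>Letting e tend to 0: \<open>h\<close> integrates to 0 over \<open>H\<close>, and
    all of \<open>F\<close> but a null set lies in \<open>H\<close>.\<close>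
  define H where "H = (\<Inter>n. G n)"
  have [measurable]: "H \<in> sets lebesgue" unfolding H_def by measurable
  have "(\<integral>\<^sup>+x\<in>H. h x \<partial>lebesgue) \<le> ennreal (l * (1 / real (Suc n)))" for n
  proof -
    have "(\<integral>\<^sup>+x\<in>H. h x \<partial>lebesgue) \<le> (\<integral>\<^sup>+x\<in>G n. h x \<partial>lebesgue)"
      by (intro nn_integral_mono) (auto simp: H_def indicator_def)
    then show ?thesis using G(3)[of n] by (rule order_trans)
  qed
  moreover have "(\<lambda>n. ennreal (l * (1 / real (Suc n)))) \<longlonglongrightarrow> ennreal (l * 0)"
    using LIMSEQ_inverse_real_of_nat by (intro tendsto_ennrealI tendsto_mult tendsto_const) (simp add: inverse_eq_divide)
  ultimately have "(\<integral>\<^sup>+x\<in>H. h x \<partial>lebesgue) \<le> ennreal (l * 0)"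
    by (intro LIMSEQ_le_const) auto
  then have "(\<integral>\<^sup>+x\<in>H. h x \<partial>lebesgue) = 0" by simp
  then have "AE x in lebesgue. h x * indicator H x = 0"
    by (subst (asm) nn_integral_0_iff_AE) auto
  then have "AE x in lebesgue. x \<notin> E \<inter> H"
    by (rule eventually_mono) (auto simp: h_def E_def indicator_def split: if_splits)
  then have "negligible (E \<inter> H)"
    by (subst (asm) AE_iff_measurable[of "E \<inter> H"]) (auto simp: negligible_iff_null_sets null_sets_def)
  moreover have "negligible (\<Union>n. F - G n)"
    using G(2) by (intro negligible_countable_Union) auto
  ultimately have "negligible ((E \<inter> H) \<union> (\<Union>n. F - G n))"
    by (rule negligible_Un)
  then show ?thesis
    by (rule negligible_subset) (auto simp: H_def F_def E_def)
qed

text \<open>Stopping along the radii 5^j r. Almost every point with w > l has a small ball whose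
  average exceeds l, while \<open>start\<close> forces the averages at radii from r1 to 5 r1 down to
  l. So some ball has average above l and its fivefold dilate does not. The dilate has mass at most
  5^n l |B|, and on B itself the A_1 bound gives l < C w.\<close>

lemma level_set_estimate:
  fixes w :: "'a::euclidean_space \<Rightarrow> real"
  assumes w: "weight w" and r1: "0 < r1" "5 * r1 \<le> t - s" and l: "0 < l"
    and A1: "\<And>x r. x \<in> ball z t \<Longrightarrow> 0 < r \<Longrightarrow> r \<le> r1 \<Longrightarrow>
      AE y in lebesgue. y \<in> ball x r \<longrightarrow> mass w x r \<le> ennreal (C * w y) * emeasure lebesgue (ball x r)"
    and start: "mass w z t \<le> ennreal l * emeasure lebesgue (ball z r1)"
  shows "(\<integral>\<^sup>+y\<in>{y \<in> ball z s. l < w y}. ennreal (w y) \<partial>lebesgue)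
     \<le> ennreal (5 ^ DIM('a) * l) * emeasure lebesgue {y \<in> ball z t. l < C * w y}"
proof -
  note [measurable] = weightD(1)[OF w]
  let ?n = "DIM('a)"
  define I where "I x r = mass w x r" for x r
  define v where "v x r = emeasure lebesgue (ball (x::'a) r)" for x r
  define K where "K = {(x, r). x \<in> ball z s \<and> 0 < r \<and> r < r1 \<and> ennreal l * v x r < I x r \<and> I x (5 * r) \<le> ennreal l * v x (5 * r)}"
  define F where "F = {x \<in> ball z s. l < w x \<and> (\<forall>r. 0 < r \<and> r < r1 \<longrightarrow> I x r \<le> ennreal l * v x r)}"
  have F: "negligible F"
    unfolding F_def I_def v_def
    using negligible_small_averages[of w l r1 z s] weightD(1,3)[OF w] l r1 by simp
  have v_mono: "v x r \<le> v y r'" if "r \<le> r'" "0 \<le> r" for x y r r'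
    unfolding v_def emeasure_lebesgue_ball using that
    by (intro ennreal_leI) (simp add: measure_lebesgue_ball power_mono mult_left_mono del: measure_completion)
  have stop: "\<exists>r. (x, r) \<in> K" if x: "x \<in> ball z s" "l < w x" "x \<notin> F" for x
  proof -
    obtain r where r: "0 < r" "r < r1" "ennreal l * v x r < I x r"
      using x by (auto simp: F_def not_le)
    define P where "P j = (I x (5 ^ j * r) \<le> ennreal l * v x (5 ^ j * r))" for j :: nat
    \<comment> \<open>The room 5 r1 \<le> t - s keeps these balls inside B(z, t), and their volume
      is at least that of the ball of radius r1 in \<open>start\<close>.\<close>
    have late: "P j" if "r1 \<le> 5 ^ j * r" "5 ^ j * r \<le> 5 * r1" for j
    proof -
      have "ball x (5 ^ j * r) \<subseteq> ball z t"
      proof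
        fix y assume "y \<in> ball x (5 ^ j * r)"
        then show "y \<in> ball z t"
          using that(2) x(1) r1(2) dist_triangle[of z y x] by simp
      qed
      then have "I x (5 ^ j * r) \<le> I z t"
        unfolding I_def by (intro nn_integral_mono) (auto simp: indicator_def)
      also have "\<dots> \<le> ennreal l * v z r1"
        using start by (simp add: I_def v_def)
      also have "\<dots> \<le> ennreal l * v x (5 ^ j * r)"
        using that r1 by (intro mult_left_mono v_mono) auto
      finally show ?thesis by (simp add: P_def)
    qed
    have step: "\<exists>j. r1 \<le> 5 ^ j * r \<and> 5 ^ j * r \<le> 5 * r1"
    proof -
      obtain j0 :: nat where "r1 / r < 5 ^ j0"
        using real_arch_pow[of 5 "r1 / r"] by auto
      then have "r1 \<le> 5 ^ j0 * r" using r by (simp add: field_simps)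
      define j where "j = (LEAST j. r1 \<le> 5 ^ j * r)"
      have j: "r1 \<le> 5 ^ j * r"
        unfolding j_def by (rule LeastI) fact
      then obtain i where i: "j = Suc i"
        using r by (cases j) auto
      then have "\<not> r1 \<le> 5 ^ i * r"
        using not_less_Least[of i "\<lambda>j. r1 \<le> 5 ^ j * r"] by (auto simp: j_def[symmetric])
      with j i show ?thesis by (intro exI[of _ j]) auto
    qed
    define k where "k = (LEAST j. P j)"
    have k: "P k" unfolding k_def using step late by (metis LeastI)
    have "\<not> P 0" using r by (simp add: P_def not_le)
    with k obtain i where i: "k = Suc i" by (cases k) auto
    have notP: "\<not> P j" if "j \<le> i" for j
      using not_less_Least[of j P] that i by (simp add: k_def)
    \<comment> \<open>Otherwise the first radius of the sequence to reach r1 would lie between r1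
      and 5 r1 and would already have stopped the search.\<close>
    have small: "5 ^ i * r < r1"
    proof (rule ccontr)
      assume "\<not> ?thesis"
      then have big: "r1 \<le> 5 ^ i * r" by simp
      define j where "j = (LEAST j. r1 \<le> 5 ^ j * r)"
      have j: "r1 \<le> 5 ^ j * r" "j \<le> i"
        unfolding j_def using big by (auto intro: LeastI Least_le)
      then obtain j' where j': "j = Suc j'"
        using r by (cases j) auto
      then have "\<not> r1 \<le> 5 ^ j' * r"
        using not_less_Least[of j' "\<lambda>j. r1 \<le> 5 ^ j * r"] by (auto simp: j_def[symmetric])
      then have "P j" using j j' by (intro late) auto
      then show False using notP j by blast
    qed
    have "(x, 5 ^ i * r) \<in> K"
      unfolding K_def using x(1) r small notP[of i] k
      by (auto simp: P_def i not_le mult.assoc)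
    then show ?thesis by blast
  qed
  have cov: "{y \<in> ball z s. l < w y} - F \<subseteq> (\<Union>i\<in>K. ball (fst i) (snd i))"
  proof
    fix x assume "x \<in> {y \<in> ball z s. l < w y} - F"
    then obtain r where "(x, r) \<in> K" using stop by blast
    moreover from this have "x \<in> ball (fst (x, r)) (snd (x, r))" by (simp add: K_def)
    ultimately show "x \<in> (\<Union>i\<in>K. ball (fst i) (snd i))" by blast
  qed
  have rad: "0 < snd i \<and> snd i \<le> r1" if "i \<in> K" for i
    using that by (auto simp: K_def)
  obtain D where D: "countable D" "D \<subseteq> K"
      "pairwise (\<lambda>i j. disjnt (ball (fst i) (snd i)) (ball (fst j) (snd j))) D"
      "{y \<in> ball z s. l < w y} - F \<subseteq> (\<Union>i\<in>D. ball (fst i) (5 * snd i))"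
    by (rule Vitali_covering_lemma_balls[OF cov rad]) (assumption, rule that)
  let ?G = "\<Union>i\<in>D. ball (fst i) (snd i)"
  have [measurable]: "(\<Union>i\<in>D. ball (fst i) (5 * snd i)) \<in> sets lebesgue" "?G \<in> sets lebesgue"
    using D(1) by auto
  have AE_F: "AE y in lebesgue. y \<notin> F"
    using F by (simp add: negligible_iff_null_sets AE_not_in)
  have "(\<integral>\<^sup>+y\<in>{y \<in> ball z s. l < w y}. ennreal (w y) \<partial>lebesgue)
      \<le> (\<integral>\<^sup>+y\<in>(\<Union>i\<in>D. ball (fst i) (5 * snd i)). ennreal (w y) \<partial>lebesgue)"
  proof (rule nn_integral_mono_AE, rule eventually_mono[OF AE_F])
    fix y assume "y \<notin> F"
    then show "ennreal (w y) * indicator {y \<in> ball z s. l < w y} y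
        \<le> ennreal (w y) * indicator (\<Union>i\<in>D. ball (fst i) (5 * snd i)) y"
      using D(4) by (intro mult_left_mono indicator_leI) (blast, simp)
  qed
  also have "\<dots> \<le> ennreal (5 ^ ?n * l) * emeasure lebesgue ?G"
  proof (rule disjoint_balls_integral_le[OF _ D(1,3)])
    fix x r assume "(x, r) \<in> D"
    then have xr: "0 < r" "I x (5 * r) \<le> ennreal l * v x (5 * r)"
      using D(2) by (auto simp: K_def)
    have "ennreal l * v x (5 * r) = ennreal (5 ^ ?n * l) * v x r"
      using xr(1) l measure_lebesgue_ball_scale[of r 5 x x]
      by (simp add: v_def emeasure_lebesgue_ball mult_ac del: emeasure_completion flip: ennreal_mult)
    with xr(2) show "mass w x (5 * r) \<le> ennreal (5 ^ ?n * l) * emeasure lebesgue (ball x r)"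
      by (simp add: I_def v_def del: emeasure_completion)
  qed measurable
  also have "\<dots> \<le> ennreal (5 ^ ?n * l) * emeasure lebesgue {y \<in> ball z t. l < C * w y}"
  proof (rule mult_left_mono)
    \<comment> \<open>The exceptional set of the A_1 bound depends on the ball; countability of
      \<open>D\<close> leaves one null set.\<close>
    have "AE y in lebesgue. \<forall>i\<in>D. y \<in> ball (fst i) (snd i) \<longrightarrow> l < C * w y"
    proof (subst AE_ball_countable[OF D(1)], rule ballI)
      fix i assume "i \<in> D"
      then obtain x r where i: "i = (x, r)" and xr: "x \<in> ball z s" "0 < r" "r < r1" "ennreal l * v x r < I x r"
        using D(2) by (cases i) (auto simp: K_def)
      have "x \<in> ball z t" using xr(1) r1 by simp
      then have "AE y in lebesgue. y \<in> ball x r \<longrightarrow> I x r \<le> ennreal (C * w y) * v x r"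
        unfolding I_def v_def using xr by (intro A1) auto
      then show "AE y in lebesgue. y \<in> ball (fst i) (snd i) \<longrightarrow> l < C * w y"
      proof (rule eventually_mono, intro impI)
        fix y assume "y \<in> ball x r \<longrightarrow> I x r \<le> ennreal (C * w y) * v x r" "y \<in> ball (fst i) (snd i)"
        then have "ennreal l * v x r < ennreal (C * w y) * v x r"
          using xr(4) i by (auto simp: less_le_trans)
        then have "ennreal l < ennreal (C * w y)"
          using mult_right_mono[of "ennreal (C * w y)" "ennreal l" "v x r"] by (meson not_le zero_le)
        then show "l < C * w y"
          using l by (simp add: ennreal_less_iff)
      qed
    qed
    then have "AE y in lebesgue. y \<in> ?G \<longrightarrow> y \<in> {y \<in> ball z t. l < C * w y}"
    proof (rule eventually_mono, intro impI)
      fix y assume y: "\<forall>i\<in>D. y \<in> ball (fst i) (snd i) \<longrightarrow> l < C * w y" "y \<in> ?G"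
      then obtain x r where xr: "(x, r) \<in> D" "y \<in> ball x r" by auto
      then have "x \<in> ball z s" "r < r1" using D(2) by (auto simp: K_def)
      then have "y \<in> ball z t"
        using xr(2) r1 dist_triangle[of z y x] by simp
      with y xr show "y \<in> {y \<in> ball z t. l < C * w y}" by fastforce
    qed
    then show "emeasure lebesgue ?G \<le> emeasure lebesgue {y \<in> ball z t. l < C * w y}"
    proof (rule emeasure_mono_AE)
      have "{y \<in> ball z t. l < C * w y} = ball z t \<inter> {y \<in> space lebesgue. l < C * w y}" by auto
      then show "{y \<in> ball z t. l < C * w y} \<in> sets lebesgue" by simp
    qed
  qed simp
  finally show ?thesis .
qed

text \<open>Levels below l0 contribute l0^\<epsilon> times the mass. Above l0 the level set estimate
  and a layer cake at exponent 1 + \<epsilon> return an integral of the original kind with the small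
  factor \<epsilon>. The truncation at \<open>N\<close> keeps that integral finite, so that it can
  be absorbed.\<close>

lemma truncated_absorption:
  fixes w :: "'a::euclidean_space \<Rightarrow> real"
  assumes w: "weight w" and \<epsilon>: "0 < \<epsilon>" "\<epsilon> \<le> 1" and C: "1 \<le> C" and N: "0 < N" and l0: "0 < l0"
    and level: "\<And>l. l0 \<le> l \<Longrightarrow> (\<integral>\<^sup>+y\<in>{y \<in> ball z s. l < w y}. ennreal (w y) \<partial>lebesgue)
     \<le> ennreal (c * l) * emeasure lebesgue {y \<in> ball z t. l < C * w y}" and c: "0 \<le> c"
  shows "mass (\<lambda>y. w y * min (w y) N powr \<epsilon>) z s
    \<le> ennreal (l0 powr \<epsilon>) * mass w z s
      + ennreal (\<epsilon> * c * C\<^sup>2) * mass (\<lambda>y. w y * min (w y) N powr \<epsilon>) z t"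
proof -
  note [measurable] = weightD(1)[OF w]
  have pos: "0 < w y" for y by (rule weightD(2)[OF w])
  let ?f = "\<lambda>y. ennreal (min (w y) N)"
  let ?h = "\<lambda>y. ennreal (C * min (w y) N)"
  let ?v = "\<lambda>y. ennreal (w y) * indicator (ball z s) y"
  let ?J = "\<lambda>l. \<integral>\<^sup>+y. ?v y * indicator {y. ennreal l < ?f y} y \<partial>lebesgue"
  let ?Q = "\<lambda>l. \<integral>\<^sup>+y. indicator (ball z t) y * indicator {y. ennreal l < ?h y} y \<partial>lebesgue"
  let ?W = "mass w z s"
  have J1: "?J l \<le> ?W" for l
    by (intro nn_integral_mono) (auto simp: indicator_def)
  have J2: "?J l \<le> ennreal (c * l) * ?Q l" if l: "l0 \<le> l" for l
  proof (cases "l < N")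
    case True
    have "?J l \<le> (\<integral>\<^sup>+y\<in>{y \<in> ball z s. l < w y}. ennreal (w y) \<partial>lebesgue)"
      using l l0 by (intro nn_integral_mono) (auto simp: indicator_def ennreal_less_iff)
    also have "\<dots> \<le> ennreal (c * l) * emeasure lebesgue {y \<in> ball z t. l < C * w y}"
      by (rule level[OF l])
    also have "emeasure lebesgue {y \<in> ball z t. l < C * w y} = (\<integral>\<^sup>+y. indicator {y \<in> ball z t. l < C * w y} y \<partial>lebesgue)"
    proof -
      have "{y \<in> ball z t. l < C * w y} = ball z t \<inter> {y \<in> space lebesgue. l < C * w y}" by auto
      then have "{y \<in> ball z t. l < C * w y} \<in> sets lebesgue" by simp
      then show ?thesis by simp
    qed
    also have "\<dots> \<le> ?Q l"
    proof (intro nn_integral_mono)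
      fix y
      \<comment> \<open>Below \<open>N\<close> the truncation does not affect the condition l < C w,
        as C is at least 1.\<close>
      have "l < C * N" using True C N by (metis less_le_trans less_imp_le mult_le_cancel_right1 not_less)
      then have "l < C * min (w y) N" if "l < C * w y"
        using that by (simp add: min_def)
      then show "indicator {y \<in> ball z t. l < C * w y} y \<le> (indicator (ball z t) y * indicator {y. ennreal l < ?h y} y :: ennreal)"
        using l l0 by (auto simp: indicator_def ennreal_less_iff)
    qed
    finally show ?thesis by (simp add: mult_left_mono)
  next
    case False
    then have "?J l = (\<integral>\<^sup>+y. 0 \<partial>(lebesgue :: 'a measure))"
      using l l0 by (intro nn_integral_cong) (auto simp: indicator_def ennreal_less_iff)
    then show ?thesis by simp
  qed
  have "mass (\<lambda>y. w y * min (w y) N powr \<epsilon>) z s = (\<integral>\<^sup>+y. ?v y * ennreal_powr (?f y) \<epsilon> \<partial>lebesgue)"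
    using pos N by (intro nn_integral_cong) (auto simp: ennreal_powr_ennreal ennreal_mult less_imp_le indicator_def)
  also have "\<dots> = (\<integral>\<^sup>+l. ennreal (\<epsilon> * l powr (\<epsilon> - 1)) * indicator {0<..} l * ?J l \<partial>lborel)"
    using \<epsilon> by (intro nn_integral_layer_cake) auto
  also have "\<dots> \<le> (\<integral>\<^sup>+l. ?W * (ennreal (\<epsilon> * l powr (\<epsilon> - 1)) * indicator {l. 0 < l \<and> ennreal l < ennreal l0} l)
      + ennreal (\<epsilon> * c) * (ennreal ((1 + \<epsilon>) * l powr (1 + \<epsilon> - 1)) * indicator {0<..} l * ?Q l) \<partial>lborel)"
  proof (intro nn_integral_mono)
    fix l :: real
    consider "l \<le> 0" | "0 < l" "l < l0" | "l0 \<le> l" by linarith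
    then show "ennreal (\<epsilon> * l powr (\<epsilon> - 1)) * indicator {0<..} l * ?J l \<le>
       ?W * (ennreal (\<epsilon> * l powr (\<epsilon> - 1)) * indicator {l. 0 < l \<and> ennreal l < ennreal l0} l)
      + ennreal (\<epsilon> * c) * (ennreal ((1 + \<epsilon>) * l powr (1 + \<epsilon> - 1)) * indicator {0<..} l * ?Q l)"
    proof cases
      case 2
      have "ennreal (\<epsilon> * l powr (\<epsilon> - 1)) * ?J l \<le> ?W * ennreal (\<epsilon> * l powr (\<epsilon> - 1))"
        by (subst mult.commute) (intro mult_right_mono J1, simp)
      also have "\<dots> \<le> ?W * ennreal (\<epsilon> * l powr (\<epsilon> - 1)) + ennreal (\<epsilon> * c) * (ennreal ((1 + \<epsilon>) * l powr (1 + \<epsilon> - 1)) * ?Q l)"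
        by simp
      finally show ?thesis using 2 by (simp add: ennreal_less_iff)
    next
      case 3
      then have l: "0 < l" using l0 by simp
      then have "ennreal (\<epsilon> * l powr (\<epsilon> - 1)) * ?J l \<le> ennreal (\<epsilon> * l powr (\<epsilon> - 1)) * (ennreal (c * l) * ?Q l)"
        using 3 by (intro mult_left_mono J2) auto
      also have "\<dots> = ennreal (\<epsilon> * c * l powr \<epsilon>) * ?Q l"
      proof -
        have "\<epsilon> * l powr (\<epsilon> - 1) * (c * l) = \<epsilon> * c * l powr \<epsilon>"
          using l by (simp add: powr_diff)
        moreover have "ennreal (\<epsilon> * l powr (\<epsilon> - 1)) * ennreal (c * l) = ennreal (\<epsilon> * l powr (\<epsilon> - 1) * (c * l))"
          using \<epsilon> c l by (intro ennreal_mult[symmetric]) auto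
        ultimately show ?thesis by (simp only: mult.assoc[symmetric])
      qed
      also have "\<dots> \<le> ennreal (\<epsilon> * c * ((1 + \<epsilon>) * l powr (1 + \<epsilon> - 1))) * ?Q l"
      proof (intro mult_right_mono ennreal_leI)
        \<comment> \<open>The factor 1 + \<epsilon> is inserted to match the layer cake density of
          the power 1 + \<epsilon>.\<close>
        have "l powr \<epsilon> \<le> (1 + \<epsilon>) * l powr (1 + \<epsilon> - 1)"
          using \<epsilon> by (simp add: algebra_simps)
        then show "\<epsilon> * c * l powr \<epsilon> \<le> \<epsilon> * c * ((1 + \<epsilon>) * l powr (1 + \<epsilon> - 1))"
          using \<epsilon> c by (intro mult_left_mono) auto
      qed simp
      also have "ennreal (\<epsilon> * c * ((1 + \<epsilon>) * l powr (1 + \<epsilon> - 1))) = ennreal (\<epsilon> * c) * ennreal ((1 + \<epsilon>) * l powr (1 + \<epsilon> - 1))"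
        using \<epsilon> c by (intro ennreal_mult) auto
      finally show ?thesis using 3 l by (simp add: ennreal_less_iff mult.assoc)
    qed auto
  qed
  also have "\<dots> = ?W * (\<integral>\<^sup>+l. ennreal (\<epsilon> * l powr (\<epsilon> - 1)) * indicator {l. 0 < l \<and> ennreal l < ennreal l0} l \<partial>lborel)
      + ennreal (\<epsilon> * c) * (\<integral>\<^sup>+l. ennreal ((1 + \<epsilon>) * l powr (1 + \<epsilon> - 1)) * indicator {0<..} l * ?Q l \<partial>lborel)"
  proof -
    have [measurable]: "?Q \<in> borel_measurable lborel"
      by (rule borel_measurable_level_integral) auto
    show ?thesis by (subst nn_integral_add) (auto simp: nn_integral_cmult)
  qed
  also have "(\<integral>\<^sup>+l. ennreal (\<epsilon> * l powr (\<epsilon> - 1)) * indicator {l. 0 < l \<and> ennreal l < ennreal l0} l \<partial>lborel) = ennreal (l0 powr \<epsilon>)"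
    using ennreal_powr_layer[OF \<epsilon>(1), of "ennreal l0"] l0 by (simp add: ennreal_powr_ennreal)
  also have "(\<integral>\<^sup>+l. ennreal ((1 + \<epsilon>) * l powr (1 + \<epsilon> - 1)) * indicator {0<..} l * ?Q l \<partial>lborel)
      = (\<integral>\<^sup>+y. indicator (ball z t) y * ennreal_powr (?h y) (1 + \<epsilon>) \<partial>lebesgue)"
    using \<epsilon> by (intro nn_integral_layer_cake[symmetric]) auto
  also have "\<dots> \<le> (\<integral>\<^sup>+y. ennreal (C\<^sup>2) * (ennreal (w y * min (w y) N powr \<epsilon>) * indicator (ball z t) y) \<partial>lebesgue)"
  proof (intro nn_integral_mono)
    fix y
    have m: "0 < min (w y) N" using pos N by simp
    have "(C * min (w y) N) powr (1 + \<epsilon>) = C powr (1 + \<epsilon>) * (min (w y) N * min (w y) N powr \<epsilon>)"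
      using C m by (simp add: powr_mult powr_add)
    also have "\<dots> \<le> C\<^sup>2 * (w y * min (w y) N powr \<epsilon>)"
    proof (intro mult_mono)
      have "C powr (1 + \<epsilon>) \<le> C powr 2" using C \<epsilon> by (intro powr_mono) auto
      then show "C powr (1 + \<epsilon>) \<le> C\<^sup>2" using C by simp
    qed (use m in auto)
    finally have "ennreal_powr (?h y) (1 + \<epsilon>) \<le> ennreal (C\<^sup>2) * ennreal (w y * min (w y) N powr \<epsilon>)"
      using C m pos[of y] by (simp add: ennreal_powr_ennreal less_imp_le flip: ennreal_mult)
    then show "indicator (ball z t) y * ennreal_powr (?h y) (1 + \<epsilon>) \<le> ennreal (C\<^sup>2) * (ennreal (w y * min (w y) N powr \<epsilon>) * indicator (ball z t) y)"
      by (simp add: indicator_def)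
  qed
  also have "\<dots> = ennreal (C\<^sup>2) * mass (\<lambda>y. w y * min (w y) N powr \<epsilon>) z t"
    by (rule nn_integral_cmult) measurable
  finally have "mass (\<lambda>y. w y * min (w y) N powr \<epsilon>) z s
    \<le> ?W * ennreal (l0 powr \<epsilon>) + ennreal (\<epsilon> * c) * (ennreal (C\<^sup>2) * mass (\<lambda>y. w y * min (w y) N powr \<epsilon>) z t)"
    by (simp add: mult_left_mono add_left_mono)
  moreover have "ennreal (\<epsilon> * c * C\<^sup>2) = ennreal (\<epsilon> * c) * ennreal (C\<^sup>2)"
    using \<epsilon> c by (intro ennreal_mult) auto
  ultimately show ?thesis
    by (simp only: mult.assoc mult.commute[of ?W])
qed

text \<open>The constant term doubles from step to step while the remainder carries a factor 1 / 4,
  so the costs sum to 4 M, and the uniform bound \<open>A\<close> sends (1 / 4)^k a k to 0.\<close>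

lemma geometric_absorption:
  fixes a :: "nat \<Rightarrow> real"
  assumes step: "\<And>k. a k \<le> M * 2 ^ Suc k + a (Suc k) / 4" and bound: "\<And>k. a k \<le> A" and M: "0 \<le> M"
  shows "a 0 \<le> 4 * M"
proof -
  have "a 0 \<le> 4 * M * (1 - (1 / 2) ^ k) + (1 / 4) ^ k * a k" for k
  proof (induction k)
    case (Suc k)
    have e: "(1 / 4) ^ k * (2::real) ^ Suc k = 2 * (1 / 2) ^ k"
      by (simp flip: power_mult_distrib)
    have "(1 / 4) ^ k * a k \<le> (1 / 4) ^ k * (M * 2 ^ Suc k + a (Suc k) / 4)"
      by (intro mult_left_mono step) auto
    also have "\<dots> = M * ((1 / 4) ^ k * 2 ^ Suc k) + (1 / 4) ^ Suc k * a (Suc k)"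
      by (simp add: algebra_simps)
    also have "\<dots> = M * (2 * (1 / 2) ^ k) + (1 / 4) ^ Suc k * a (Suc k)"
      by (simp only: e)
    finally show ?case
      using Suc by (simp add: algebra_simps)
  qed simp
  moreover have "4 * M * (1 - (1 / 2) ^ k) + (1 / 4) ^ k * a k \<le> 4 * M + (1 / 4) ^ k * A" for k
  proof (rule add_mono)
    show "4 * M * (1 - (1 / 2) ^ k) \<le> 4 * M" using M by (simp add: mult_left_le)
    show "(1 / 4) ^ k * a k \<le> (1 / 4) ^ k * A" by (intro mult_left_mono bound) auto
  qed
  ultimately have "a 0 \<le> 4 * M + (1 / 4) ^ k * A" for k
    by (rule order_trans)
  moreover have "(\<lambda>k. 4 * M + (1 / 4) ^ k * A) \<longlonglongrightarrow> 4 * M + 0 * A"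
    by (intro tendsto_intros LIMSEQ_power_zero) auto
  ultimately have "a 0 \<le> 4 * M + 0 * A"
    by (intro LIMSEQ_le_const) auto
  then show ?thesis by simp
qed

text \<open>The stopping balls of the level set estimate leave the ball one starts from, so the
  estimate on \<open>B(z, R)\<close> is obtained along the radii \<open>R (2 - 2\<^sup>-\<^sup>k)\<close> increasing to \<open>2 R\<close>.\<close>

lemma A1_reverse_Hoelder:
  fixes w :: "'a::euclidean_space \<Rightarrow> real"
  assumes w: "weight w" and R: "0 < r0" "r0 \<le> R" and C: "1 \<le> C"
    and \<epsilon>: "0 < \<epsilon>" "\<epsilon> \<le> 1" "\<epsilon> * real DIM('a) \<le> 1" "\<epsilon> * 5 ^ DIM('a) * C\<^sup>2 \<le> 1 / 4"
    and A1: "\<And>x r. x \<in> ball z (2 * R) \<Longrightarrow> 0 < r \<Longrightarrow> r \<le> r0 \<Longrightarrow>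
      AE y in lebesgue. y \<in> ball x r \<longrightarrow> mass w x r \<le> ennreal (C * w y) * emeasure lebesgue (ball x r)"
    and I: "mass w z (2 * R) = ennreal I" "0 < I"
  shows "mass (\<lambda>y. w y powr (1 + \<epsilon>)) z R
    \<le> ennreal (4 * I powr (1 + \<epsilon>) * vol z (r0 / 5) powr (- \<epsilon>))"
proof -
  note [measurable] = weightD(1)[OF w]
  have pos: "0 < w y" for y by (rule weightD(2)[OF w])
  let ?n = "DIM('a)"
  define v where "v = vol z (r0 / 5)"
  have v: "0 < v" unfolding v_def using R by (intro measure_lebesgue_ball_pos) simp
  define L where "L = I / v"
  have L: "0 < L" using I v by (simp add: L_def)
  define M where "M = L powr \<epsilon> * I"
  have M: "0 \<le> M" using I by (simp add: M_def)
  define g where "g N s = mass (\<lambda>y. w y * min (w y) N powr \<epsilon>) z s" for N s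
  define s where "s k = R * (2 - (1 / 2) ^ k)" for k :: nat
  have s: "s k \<le> 2 * R" "s k \<le> s (Suc k)" for k
  proof -
    have "(1 / 2 :: real) ^ Suc k \<le> (1 / 2) ^ k" by simp
    then show "s k \<le> s (Suc k)" using R unfolding s_def by (intro mult_left_mono) auto
    have "R * (2 - (1 / 2) ^ k) \<le> R * 2" using R by (intro mult_left_mono) auto
    then show "s k \<le> 2 * R" by (simp add: s_def)
  qed
  have sub: "ball z (s k) \<subseteq> ball z (2 * R)" for k
    by (rule subset_ball[OF s(1)])
  have trunc: "g N R \<le> ennreal (4 * M)" if N: "0 < N" for N
  proof -
    have g_fin: "g N (s k) \<le> ennreal (N powr \<epsilon> * I)" for k
    proof -
      have "g N (s k) \<le> (\<integral>\<^sup>+y. ennreal (N powr \<epsilon>) * (ennreal (w y) * indicator (ball z (2 * R)) y) \<partial>lebesgue)"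
        unfolding g_def
      proof (intro nn_integral_mono)
        fix y
        have "w y * min (w y) N powr \<epsilon> \<le> N powr \<epsilon> * w y"
          using pos[of y] N \<epsilon> by (subst mult.commute) (intro mult_right_mono powr_mono2, auto)
        then have "ennreal (w y * min (w y) N powr \<epsilon>) \<le> ennreal (N powr \<epsilon>) * ennreal (w y)"
          using pos[of y] by (simp add: ennreal_leI less_imp_le flip: ennreal_mult)
        then show "ennreal (w y * min (w y) N powr \<epsilon>) * indicator (ball z (s k)) y
            \<le> ennreal (N powr \<epsilon>) * (ennreal (w y) * indicator (ball z (2 * R)) y)"
          using sub[of k] by (auto simp: indicator_def)
      qed
      also have "\<dots> = ennreal (N powr \<epsilon> * I)"
        using I by (simp add: nn_integral_cmult ennreal_mult)
      finally show ?thesis .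
    qed
    define a where "a k = enn2real (g N (s k))" for k
    have a: "g N (s k) = ennreal (a k)" "0 \<le> a k" "a k \<le> N powr \<epsilon> * I" for k
    proof -
      have "g N (s k) < top" using g_fin[of k] by (simp add: le_less_trans)
      then show *: "g N (s k) = ennreal (a k)" "0 \<le> a k" by (simp_all add: a_def)
      then show "a k \<le> N powr \<epsilon> * I"
        using g_fin[of k] I by simp
    qed
    have step: "a k \<le> M * 2 ^ Suc k + a (Suc k) / 4" for k
    proof -
      \<comment> \<open>5 r1 = 2^(-k-1) r0 fits into the gap 2^(-k-1) R between consecutive radii.
        The height \<open>l0\<close> is the one with \<open>l0 * vol z r1 = I\<close>, as the start
        of the stopping argument requires.\<close>
      define r1 where "r1 = (1 / 2) ^ Suc k * (r0 / 5)"
      define l0 where "l0 = L * 2 ^ (?n * Suc k)"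
      have l0: "0 < l0" using L by (simp add: l0_def)
      have r1: "0 < r1" "r1 \<le> r0"
      proof -
        show "0 < r1" using R by (simp add: r1_def)
        have "r1 \<le> 1 * (r0 / 5)"
          unfolding r1_def using R by (intro mult_right_mono power_le_one) auto
        then show "r1 \<le> r0" using R by simp
      qed
      have r1s: "5 * r1 \<le> s (Suc k) - s k"
      proof -
        have "5 * r1 \<le> (1 / 2) ^ Suc k * R"
          unfolding r1_def using R by simp
        then show ?thesis by (simp add: s_def algebra_simps)
      qed
      have l0v: "l0 * vol z r1 = I"
      proof -
        have "vol z r1 = ((1 / 2) ^ Suc k) ^ ?n * v"
          unfolding r1_def v_def using R by (intro measure_lebesgue_ball_scale) auto
        also have "((1 / 2 :: real) ^ Suc k) ^ ?n = 1 / 2 ^ (?n * Suc k)"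
          by (simp only: power_mult[symmetric] mult.commute[of ?n] power_one_over)
        finally show ?thesis using v by (simp add: l0_def L_def)
      qed
      have "g N (s k) \<le> ennreal (l0 powr \<epsilon>) * mass w z (s k)
          + ennreal (\<epsilon> * 5 ^ ?n * C\<^sup>2) * g N (s (Suc k))"
        unfolding g_def
      proof (rule truncated_absorption[OF w \<epsilon>(1,2) C N l0])
        fix l assume l: "l0 \<le> l"
        show "(\<integral>\<^sup>+y\<in>{y \<in> ball z (s k). l < w y}. ennreal (w y) \<partial>lebesgue)
          \<le> ennreal (5 ^ ?n * l) * emeasure lebesgue {y \<in> ball z (s (Suc k)). l < C * w y}"
        proof (rule level_set_estimate[OF w r1(1) r1s])
          show "0 < l" using l l0 by simp
          show "AE y in lebesgue. y \<in> ball x r \<longrightarrow> mass w x r \<le> ennreal (C * w y) * emeasure lebesgue (ball x r)"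
            if "x \<in> ball z (s (Suc k))" "0 < r" "r \<le> r1" for x r
            using that sub[of "Suc k"] r1(2) by (intro A1) auto
          have "mass w z (s (Suc k)) \<le> mass w z (2 * R)"
            using sub[of "Suc k"] by (intro nn_integral_mono) (auto simp: indicator_def)
          also have "\<dots> = ennreal (l0 * vol z r1)"
            by (simp only: I(1) l0v)
          also have "\<dots> \<le> ennreal (l * vol z r1)"
            using l by (intro ennreal_leI mult_right_mono) auto
          also have "\<dots> = ennreal l * emeasure lebesgue (ball z r1)"
            using l l0 by (simp add: emeasure_lebesgue_ball ennreal_mult del: emeasure_completion)
          finally show "mass w z (s (Suc k)) \<le> ennreal l * emeasure lebesgue (ball z r1)" .
        qed
      qed simp
      also have "\<dots> \<le> ennreal (L powr \<epsilon> * 2 ^ Suc k) * ennreal I + ennreal (1 / 4) * ennreal (a (Suc k))"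
      proof (intro add_mono mult_mono ennreal_leI \<epsilon>(4))
        have "mass w z (s k) \<le> mass w z (2 * R)"
          using sub[of k] by (intro nn_integral_mono) (auto simp: indicator_def)
        then show "mass w z (s k) \<le> ennreal I"
          by (simp only: I(1))
        \<comment> \<open>Because \<epsilon> n \<le> 1, the power \<epsilon> of the starting height
          grows at most by a factor 2 per step, slowly enough for the absorption.\<close>
        have "(2 ^ (?n * Suc k)) powr \<epsilon> = 2 powr (\<epsilon> * real ?n * real (Suc k))"
          by (simp add: powr_powr algebra_simps flip: powr_realpow)
        also have "\<dots> \<le> 2 powr (1 * real (Suc k))"
          using \<epsilon>(3) by (intro powr_mono mult_right_mono) auto
        also have "\<dots> = 2 ^ Suc k" by (simp only: mult_1) (simp only: powr_realpow zero_less_numeral)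
        finally show "l0 powr \<epsilon> \<le> L powr \<epsilon> * 2 ^ Suc k"
          using L by (simp add: l0_def powr_mult mult_left_mono)
      qed (auto simp: a)
      also have "\<dots> = ennreal (M * 2 ^ Suc k + a (Suc k) / 4)"
        using I(2) a(2)[of "Suc k"] by (simp add: M_def mult_ac flip: ennreal_mult ennreal_plus)
      finally have "ennreal (a k) \<le> ennreal (M * 2 ^ Suc k + a (Suc k) / 4)"
        by (simp only: a(1))
      then show ?thesis
        using M a(2)[of "Suc k"] by (subst (asm) ennreal_le_iff) auto
    qed
    have "a 0 \<le> 4 * M"
      by (rule geometric_absorption[OF step a(3) M])
    then show ?thesis
      using a(1)[of 0] by (simp add: s_def ennreal_leI)
  qed
  let ?h = "\<lambda>i y. ennreal (w y * min (w y) (real (Suc i)) powr \<epsilon>) * indicator (ball z R) y"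
  have "mass (\<lambda>y. w y powr (1 + \<epsilon>)) z R \<le> (\<integral>\<^sup>+y. (SUP i. ?h i y) \<partial>lebesgue)"
  proof (intro nn_integral_mono)
    fix y
    obtain i where "w y \<le> real i" using real_arch_simple by blast
    then have "w y powr (1 + \<epsilon>) = w y * min (w y) (real (Suc i)) powr \<epsilon>"
      using pos[of y] by (simp add: powr_add min_def)
    then have "ennreal (w y powr (1 + \<epsilon>)) * indicator (ball z R) y = ?h i y" by simp
    also have "\<dots> \<le> (SUP i. ?h i y)" by (rule SUP_upper) simp
    finally show "ennreal (w y powr (1 + \<epsilon>)) * indicator (ball z R) y \<le> (SUP i. ?h i y)" .
  qed
  also have "\<dots> = (SUP i. \<integral>\<^sup>+y. ?h i y \<partial>lebesgue)"
  proof (rule nn_integral_monotone_convergence_SUP)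
    show "incseq ?h"
      using pos \<epsilon> by (auto simp: incseq_def le_fun_def less_imp_le intro!: mult_right_mono mult_left_mono ennreal_leI powr_mono2)
  qed measurable
  also have "\<dots> \<le> ennreal (4 * M)"
    using trunc by (intro SUP_least) (simp add: g_def)
  also have "4 * M = 4 * I powr (1 + \<epsilon>) * v powr (- \<epsilon>)"
    using I v by (simp add: M_def L_def powr_divide powr_add powr_minus field_simps)
  finally show ?thesis unfolding v_def .
qed

section \<open>Openness of the weight classes and the main result\<close>

locale slowly_varying_radius = radius_function +
  assumes slowly_varying: "\<exists>c>0. \<exists>k\<ge>0. \<forall>x y. c * \<rho> x * (1 + dist x y / \<rho> x) powr (- k) \<le> \<rho> y"
begin

text \<open>For radii up to r0 and centres in B(z, 2 R), \<open>Psi\<close> is at most 2^\<theta>.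
  There \<omega> satisfies the classical A_1 bound with a constant independent of the ball, so a
  single \<epsilon> serves all balls. The price is a power of R / r0, hence of 1 + R / \<rho>
  z.\<close>

lemma A1_powr_open:
  assumes \<omega>: "\<omega> \<in> A_class \<rho> 1 \<theta>" and \<theta>: "0 \<le> \<theta>"
  shows "\<exists>\<epsilon>>0. \<exists>\<theta>'\<ge>0. (\<lambda>x. \<omega> x powr (1 + \<epsilon>)) \<in> A_class \<rho> 1 \<theta>'"
proof -
  let ?n = "DIM('a)"
  have w: "weight \<omega>" "A1_condition \<rho> \<theta> (\<lambda>x. ennreal (\<omega> x))"
    using \<omega> by (auto simp: A_class_def)
  note [measurable] = weightD(1)[OF w(1)]
  have pos: "0 < \<omega> y" for y by (rule weightD(2)[OF w(1)])
  obtain CA where CA: "1 \<le> CA" and good: "AE x in lebesgue. maximal \<rho> \<theta> (\<lambda>x. ennreal (\<omega> x)) x \<le> ennreal CA * ennreal (\<omega> x)"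
    using A1_conditionD[OF w(2)] by blast
  obtain c k where c: "0 < c" and k: "0 \<le> k" and slow: "\<And>x y. c * \<rho> x * (1 + dist x y / \<rho> x) powr (- k) \<le> \<rho> y"
    using slowly_varying by blast
  define C where "C = 2 powr \<theta> * CA"
  have "1 * 1 \<le> C"
    unfolding C_def using CA \<theta> by (intro mult_mono ge_one_powr_ge_zero) auto
  then have C: "1 \<le> C" by simp
  define \<epsilon> where "\<epsilon> = min (1 / real ?n) (1 / (4 * 5 ^ ?n * C\<^sup>2))"
  have n: "1 \<le> real ?n" using DIM_positive[where 'a = 'a] by linarith
  have \<epsilon>: "0 < \<epsilon>" "\<epsilon> \<le> 1" "\<epsilon> * real ?n \<le> 1" "\<epsilon> * 5 ^ ?n * C\<^sup>2 \<le> 1 / 4"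
  proof -
    show "0 < \<epsilon>" using n C by (simp add: \<epsilon>_def)
    have e1: "\<epsilon> \<le> 1 / real ?n" and e2: "\<epsilon> \<le> 1 / (4 * 5 ^ ?n * C\<^sup>2)" by (simp_all add: \<epsilon>_def)
    show "\<epsilon> * real ?n \<le> 1" using e1 n by (simp add: le_divide_eq)
    have "1 / real ?n \<le> 1" using n by simp
    with e1 show "\<epsilon> \<le> 1" by linarith
    show "\<epsilon> * 5 ^ ?n * C\<^sup>2 \<le> 1 / 4" using e2 C by (simp add: le_divide_eq mult_ac)
  qed
  define \<Gamma> where "\<Gamma> = max 1 (2 powr k / c)"
  have \<Gamma>: "1 \<le> \<Gamma>" by (simp add: \<Gamma>_def)
  \<comment> \<open>The first term comes from the average over B(z, 2 R) raised to 1 + \<epsilon>,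
    the second from the volume ratio (R / r0)^(n \<epsilon>).\<close>
  define \<theta>' where "\<theta>' = \<theta> * (1 + \<epsilon>) + (k + 1) * (real ?n * \<epsilon>)"
  have \<theta>': "0 \<le> \<theta>'" using \<theta> k \<epsilon> by (simp add: \<theta>'_def)
  define K where "K = 4 * (CA * (2 powr \<theta> * 2 ^ ?n)) powr (1 + \<epsilon>) * (5 * \<Gamma>) powr (real ?n * \<epsilon>)"
  have K: "0 \<le> K" by (simp add: K_def)
  have main: "Psi_average \<rho> \<theta>' z R (\<lambda>y. ennreal (\<omega> y powr (1 + \<epsilon>))) \<le> ennreal K * ennreal (\<omega> x powr (1 + \<epsilon>))"
    if x: "maximal \<rho> \<theta> (\<lambda>x. ennreal (\<omega> x)) x \<le> ennreal CA * ennreal (\<omega> x)" and R: "0 < R" and xB: "x \<in> ball z R" for x z R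
  proof -
    define m where "m = vol z R"
    have m: "0 < m" unfolding m_def by (rule measure_lebesgue_ball_pos[OF R])
    define P where "P = 1 + R / \<rho> z"
    have P: "1 \<le> P" unfolding P_def using R rho_pos[of z] by simp
    \<comment> \<open>By slow variation this is a lower bound for \<rho> at all centres in B(z, 2
      R), cut at \<open>R\<close>.\<close>
    define r0 where "r0 = min R (c * \<rho> z * (1 + 2 * R / \<rho> z) powr (- k))"
    have Q: "0 < 1 + 2 * R / \<rho> z" using R rho_pos[of z] by (simp add: add_pos_pos)
    have r0: "0 < r0" "r0 \<le> R" using R c rho_pos[of z] Q by (simp_all add: r0_def)
    obtain I where I: "0 < I" "mass \<omega> z (2 * R) = ennreal I"
      using weight_integral_real[OF w(1), of "2 * R" z] R by auto
    have "mass (\<lambda>y. \<omega> y powr (1 + \<epsilon>)) z R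
        \<le> ennreal (4 * I powr (1 + \<epsilon>) * vol z (r0 / 5) powr (- \<epsilon>))"
    proof (rule A1_reverse_Hoelder[OF w(1) r0 C \<epsilon> _ I(2,1)])
      fix x r assume xr: "x \<in> ball z (2 * R)" "0 < r" "r \<le> r0"
      have "r \<le> c * \<rho> z * (1 + 2 * R / \<rho> z) powr (- k)" using xr(3) by (simp add: r0_def)
      also have "\<dots> \<le> c * \<rho> z * (1 + dist z x / \<rho> z) powr (- k)"
      proof (intro mult_left_mono powr_mono2')
        show "1 + dist z x / \<rho> z \<le> 1 + 2 * R / \<rho> z"
          using xr(1) rho_pos[of z] by (simp add: divide_right_mono less_imp_le)
        have "0 \<le> dist z x / \<rho> z" using rho_pos[of z] by simp
        then show "0 < 1 + dist z x / \<rho> z" by linarith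
      qed (use k c rho_pos[of z] in auto)
      also have "\<dots> \<le> \<rho> x" by (rule slow)
      finally have "1 + r / \<rho> x \<le> 2" using rho_pos[of x] by simp
      then have Psi2: "Psi \<rho> \<theta> x r \<le> 2 powr \<theta>"
        unfolding Psi_def using \<theta> xr(2) rho_pos[of x] by (intro powr_mono2) (auto intro: add_nonneg_nonneg)
      obtain a where a: "0 < a" "mass \<omega> x r = ennreal a"
        using weight_integral_real[OF w(1) xr(2)] by blast
      show "AE y in lebesgue. y \<in> ball x r \<longrightarrow> mass \<omega> x r \<le> ennreal (C * \<omega> y) * emeasure lebesgue (ball x r)"
      proof (rule eventually_mono[OF good], intro impI)
        fix y assume y: "maximal \<rho> \<theta> (\<lambda>x. ennreal (\<omega> x)) y \<le> ennreal CA * ennreal (\<omega> y)" "y \<in> ball x r"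
        define m' where "m' = vol x r"
        have m': "0 < m'" unfolding m'_def by (rule measure_lebesgue_ball_pos[OF xr(2)])
        have D: "0 < Psi \<rho> \<theta> x r * m'" unfolding m'_def by (rule denominator_pos[OF xr(2)])
        have "Psi_average \<rho> \<theta> x r (\<lambda>x. ennreal (\<omega> x)) \<le> ennreal CA * ennreal (\<omega> y)"
          by (rule order_trans[OF maximal_ge[OF xr(2) y(2)] y(1)])
        then have "a / (Psi \<rho> \<theta> x r * m') \<le> CA * \<omega> y"
          unfolding Psi_average_def a(2) m'_def[symmetric]
          using a(1) D CA pos[of y] by (simp add: divide_ennreal flip: ennreal_mult)
        then have "a \<le> CA * \<omega> y * (Psi \<rho> \<theta> x r * m')"
          using D by (simp only: pos_divide_le_eq)
        also have "\<dots> \<le> CA * \<omega> y * (2 powr \<theta> * m')"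
          using Psi2 m' CA pos[of y] by (intro mult_left_mono mult_right_mono) auto
        also have "\<dots> = C * \<omega> y * m'" by (simp add: C_def)
        finally have "ennreal a \<le> ennreal (C * \<omega> y * m')" by (rule ennreal_leI)
        then show "mass \<omega> x r \<le> ennreal (C * \<omega> y) * emeasure lebesgue (ball x r)"
          unfolding a(2) emeasure_lebesgue_ball m'_def[symmetric]
          using C pos[of y] m' by (simp add: ennreal_mult)
      qed
    qed
    also have "4 * I powr (1 + \<epsilon>) * vol z (r0 / 5) powr (- \<epsilon>) \<le> K * \<omega> x powr (1 + \<epsilon>) * (P powr \<theta>' * m)"
    proof -
      define D2 where "D2 = Psi \<rho> \<theta> z (2 * R) * vol z (2 * R)"
      have D2: "0 < D2" unfolding D2_def using R by (intro denominator_pos) simp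
      have D2_le: "D2 \<le> (2 powr \<theta> * 2 ^ ?n) * (P powr \<theta> * m)"
        using denominator_scale[of 2 \<theta> R z] \<theta> R by (simp add: D2_def P_def m_def Psi_def)
      have "Psi_average \<rho> \<theta> z (2 * R) (\<lambda>x. ennreal (\<omega> x)) \<le> ennreal CA * ennreal (\<omega> x)"
        by (rule order_trans[OF maximal_ge x]) (use R xB in auto)
      then have "I / D2 \<le> CA * \<omega> x"
        unfolding Psi_average_def I(2) D2_def[symmetric]
        using I(1) D2 CA pos[of x] by (simp add: divide_ennreal flip: ennreal_mult)
      then have "I \<le> CA * \<omega> x * D2"
        using D2 by (simp only: pos_divide_le_eq)
      also have "\<dots> \<le> CA * \<omega> x * ((2 powr \<theta> * 2 ^ ?n) * (P powr \<theta> * m))"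
        using CA pos[of x] D2_le by (intro mult_left_mono) auto
      finally have I_le: "I \<le> (CA * (2 powr \<theta> * 2 ^ ?n)) * \<omega> x * P powr \<theta> * m"
        by (simp only: mult_ac)
      \<comment> \<open>If r0 is the bound from slow variation, R \<le> P \<rho> z gives one power
        of \<open>P\<close>, and 1 + 2 R / \<rho> z \<le> 2 P gives k more with the constant 2^k /
        c.\<close>
      have "R \<le> \<Gamma> * P powr (k + 1) * r0"
      proof (cases "r0 = R")
        case True
        have "1 * 1 \<le> \<Gamma> * P powr (k + 1)"
          using \<Gamma> P k by (intro mult_mono ge_one_powr_ge_zero) auto
        then show ?thesis using True R mult_right_mono[of 1 "\<Gamma> * P powr (k + 1)" R] by simp
      next
        case False
        then have r0_eq: "r0 = c * \<rho> z * (1 + 2 * R / \<rho> z) powr (- k)"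
          by (auto simp: r0_def min_def)
        have "(1 + 2 * R / \<rho> z) powr k \<le> (2 * P) powr k"
          using k Q by (intro powr_mono2) (auto simp: P_def)
        then have "1 \<le> (2 * P) powr k * (1 + 2 * R / \<rho> z) powr (- k)"
          using Q by (simp add: powr_minus field_simps)
        then have "R * 1 \<le> (P * \<rho> z) * ((2 * P) powr k * (1 + 2 * R / \<rho> z) powr (- k))"
          using R rho_pos[of z] by (intro mult_mono) (auto simp: P_def distrib_right)
        also have "\<dots> = (2 powr k / c) * P powr (k + 1) * r0"
          unfolding r0_eq using c P by (simp add: powr_add powr_mult mult_ac)
        also have "\<dots> \<le> \<Gamma> * P powr (k + 1) * r0"
          using r0 by (intro mult_right_mono) (auto simp: \<Gamma>_def)
        finally show ?thesis by simp
      qed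
      then have "5 * R / r0 \<le> 5 * \<Gamma> * P powr (k + 1)"
        using r0 by (simp add: divide_le_eq mult_ac)
      then have Rr: "(5 * R / r0) powr (real ?n * \<epsilon>) \<le> (5 * \<Gamma> * P powr (k + 1)) powr (real ?n * \<epsilon>)"
        using R r0 \<epsilon> by (intro powr_mono2) auto
      have "vol z (r0 / 5) = (r0 / (5 * R)) ^ ?n * m"
        using measure_lebesgue_ball_scale[of R "r0 / (5 * R)" z z] R r0 by (simp add: m_def)
      also have "\<dots> = (5 * R / r0) powr (- real ?n) * m"
        using R r0 by (simp add: powr_minus powr_realpow power_divide field_simps)
      finally have "vol z (r0 / 5) powr (- \<epsilon>) = (5 * R / r0) powr (real ?n * \<epsilon>) * m powr (- \<epsilon>)"
        by (simp only: powr_mult powr_powr) simp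
      also have "\<dots> \<le> (5 * \<Gamma> * P powr (k + 1)) powr (real ?n * \<epsilon>) * m powr (- \<epsilon>)"
        by (intro mult_right_mono Rr) auto
      finally have ball_le: "vol z (r0 / 5) powr (- \<epsilon>) \<le> (5 * \<Gamma> * P powr (k + 1)) powr (real ?n * \<epsilon>) * m powr (- \<epsilon>)" .
      have "4 * I powr (1 + \<epsilon>) * vol z (r0 / 5) powr (- \<epsilon>)
          \<le> 4 * ((CA * (2 powr \<theta> * 2 ^ ?n)) * \<omega> x * P powr \<theta> * m) powr (1 + \<epsilon>) * ((5 * \<Gamma> * P powr (k + 1)) powr (real ?n * \<epsilon>) * m powr (- \<epsilon>))"
        using I_le I(1) \<epsilon> ball_le by (intro mult_mono mult_left_mono powr_mono2) auto
      also have "\<dots> = K * \<omega> x powr (1 + \<epsilon>) * ((P powr (\<theta> * (1 + \<epsilon>)) * P powr ((k + 1) * (real ?n * \<epsilon>))) * (m powr (1 + \<epsilon>) * m powr (- \<epsilon>)))"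
        by (simp only: K_def powr_mult powr_powr mult_ac)
      also have "P powr (\<theta> * (1 + \<epsilon>)) * P powr ((k + 1) * (real ?n * \<epsilon>)) = P powr \<theta>'"
        by (simp only: \<theta>'_def powr_add)
      also have "m powr (1 + \<epsilon>) * m powr (- \<epsilon>) = m"
        using m by (simp flip: powr_add)
      finally show ?thesis .
    qed
    finally have le: "mass (\<lambda>y. \<omega> y powr (1 + \<epsilon>)) z R \<le> ennreal (K * \<omega> x powr (1 + \<epsilon>) * (P powr \<theta>' * m))"
      by (simp add: ennreal_leI)
    have D: "0 < P powr \<theta>' * m" using P m by simp
    have "mass (\<lambda>y. \<omega> y powr (1 + \<epsilon>)) z R \<le> ennreal (P powr \<theta>' * m) * (ennreal K * ennreal (\<omega> x powr (1 + \<epsilon>)))"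
      using le K D by (simp add: mult_ac flip: ennreal_mult)
    then show ?thesis
      unfolding Psi_average_def Psi_def P_def[symmetric] m_def[symmetric]
      using D by (intro divide_le_posI_ennreal) auto
  qed
  have "(\<lambda>x. \<omega> x powr (1 + \<epsilon>)) \<in> A_class \<rho> 1 \<theta>'"
  proof (rule A1_classI)
    show "AE x in lebesgue. maximal \<rho> \<theta>' (\<lambda>x. ennreal (\<omega> x powr (1 + \<epsilon>))) x \<le> ennreal K * ennreal (\<omega> x powr (1 + \<epsilon>))"
      by (rule eventually_mono[OF good], rule maximal_le, rule main)
    show "0 < \<omega> x powr (1 + \<epsilon>)" for x using pos[of x] by simp
  qed measurable
  then show ?thesis using \<epsilon>(1) \<theta>' by blast
qed

lemma Ap_open:
  assumes \<omega>: "\<omega> \<in> A_class \<rho> p \<theta>" and p: "1 < p" and \<theta>: "0 \<le> \<theta>"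
  shows "\<exists>q. 1 < q \<and> q < p \<and> (\<exists>\<theta>'\<ge>0. \<omega> \<in> A_class \<rho> q \<theta>')"
proof -
  obtain \<theta>1 \<omega>1 \<omega>2 where \<theta>1: "0 \<le> \<theta>1" and \<omega>1: "\<omega>1 \<in> A_class \<rho> 1 \<theta>1" and \<omega>2: "\<omega>2 \<in> A_class \<rho> 1 \<theta>1"
    and eq: "\<omega> = (\<lambda>x. \<omega>1 x * \<omega>2 x powr (1 - p))"
    using Ap_factorization[OF \<omega> p \<theta>] by blast
  obtain \<epsilon> \<theta>2 where \<epsilon>: "0 < \<epsilon>" and \<theta>2: "0 \<le> \<theta>2" "(\<lambda>x. \<omega>2 x powr (1 + \<epsilon>)) \<in> A_class \<rho> 1 \<theta>2"
    using A1_powr_open[OF \<omega>2 \<theta>1] by blast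
  \<comment> \<open>Chosen so that \<omega>2^(1-p) is the power 1 - q of the A_1 weight
    \<omega>2^(1+\<epsilon>).\<close>
  define q where "q = 1 + (p - 1) / (1 + \<epsilon>)"
  have q: "1 < q" "q < p" "(1 + \<epsilon>) * (1 - q) = 1 - p"
    using p \<epsilon> by (simp_all add: q_def field_simps)
  let ?\<theta> = "max \<theta>1 \<theta>2"
  have "(\<lambda>x. \<omega>1 x * (\<omega>2 x powr (1 + \<epsilon>)) powr (1 - q)) \<in> A_class \<rho> q ?\<theta>"
    by (intro A1_mult_A1_powr A_class_1_mono[OF \<omega>1] A_class_1_mono[OF \<theta>2(2)] q) auto
  then have "\<omega> \<in> A_class \<rho> q ?\<theta>"
    by (simp only: eq powr_powr q(3))
  then show ?thesis
    using q \<theta>1 by (intro exI[of _ q] conjI exI[of _ ?\<theta>]) auto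
qed

lemma Ap_inf_factorization_iff:
  assumes p: "1 < p"
  shows "\<omega> \<in> A_class_inf \<rho> p \<longleftrightarrow> (\<exists>\<omega>1 \<omega>2. \<omega>1 \<in> A_class_inf \<rho> 1 \<and> \<omega>2 \<in> A_class_inf \<rho> 1
     \<and> \<omega> = (\<lambda>x. \<omega>1 x * \<omega>2 x powr (1 - p)))" (is "_ \<longleftrightarrow> ?F")
proof
  assume "\<omega> \<in> A_class_inf \<rho> p"
  then obtain \<theta> where \<theta>: "0 \<le> \<theta>" "\<omega> \<in> A_class \<rho> p \<theta>"
    by (auto simp: A_class_inf_def)
  then obtain \<theta>' \<omega>1 \<omega>2 where "0 \<le> \<theta>'" "\<omega>1 \<in> A_class \<rho> 1 \<theta>'" "\<omega>2 \<in> A_class \<rho> 1 \<theta>'"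
    "\<omega> = (\<lambda>x. \<omega>1 x * \<omega>2 x powr (1 - p))"
    using Ap_factorization[OF \<theta>(2) p \<theta>(1)] by blast
  then show ?F unfolding A_class_inf_def by blast
next
  assume ?F
  then obtain \<omega>1 \<omega>2 \<theta>1 \<theta>2 where \<theta>: "0 \<le> \<theta>1" "0 \<le> \<theta>2"
    and \<omega>1: "\<omega>1 \<in> A_class \<rho> 1 \<theta>1" and \<omega>2: "\<omega>2 \<in> A_class \<rho> 1 \<theta>2"
    and eq: "\<omega> = (\<lambda>x. \<omega>1 x * \<omega>2 x powr (1 - p))"
    by (auto simp: A_class_inf_def)
  have "\<omega> \<in> A_class \<rho> p (max \<theta>1 \<theta>2)"
    unfolding eq by (intro A1_mult_A1_powr A_class_1_mono[OF \<omega>1] A_class_1_mono[OF \<omega>2] p) auto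
  then show "\<omega> \<in> A_class_inf \<rho> p"
    using \<theta> by (auto simp: A_class_inf_def intro!: bexI[of _ "max \<theta>1 \<theta>2"])
qed

end

theorem proposition2p1:
  fixes V :: "real ^ 'n \<Rightarrow> real"
    and \<rho> :: "real ^ 'n \<Rightarrow> real"
  assumes dim: "CARD('n) \<ge> 3"
    and V: "V \<in> reverse_holder_class (real CARD('n) / 2)"
    and V_nonzero: "\<not> (AE x in lebesgue. V x = 0)"
    and rho: "\<rho> = critical_radius V"
  shows
    "(\<forall>p1 p2 \<theta>. 1 \<le> p1 \<and> p1 < p2 \<and> 0 \<le> \<theta> \<longrightarrow> A_class \<rho> p1 \<theta> \<subseteq> A_class \<rho> p2 \<theta>)
   \<and> (\<forall>p p' \<theta> \<omega>. 1 < p \<and> 1 / p + 1 / p' = 1 \<and> 0 \<le> \<theta> \<and> (\<forall>x. 0 < \<omega> x) \<longrightarrow>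
        (\<omega> \<in> A_class \<rho> p \<theta> \<longleftrightarrow> (\<lambda>x. \<omega> x powr (- 1 / (p - 1))) \<in> A_class \<rho> p' \<theta>))
   \<and> (\<forall>p \<omega>. 1 < p \<and> \<omega> \<in> A_class_inf \<rho> p \<longrightarrow>
        (\<exists>\<epsilon>>0. 1 \<le> p - \<epsilon> \<and> \<omega> \<in> A_class_inf \<rho> (p - \<epsilon>)))
   \<and> (\<forall>f \<delta> \<theta>. locally_integrable f \<and> 0 < \<delta> \<and> \<delta> < 1 \<and> 0 \<le> \<theta> \<longrightarrow>
        A1_condition \<rho> \<theta> (\<lambda>x. ennreal_powr (maximal \<rho> \<theta> (\<lambda>y. ennreal \<bar>f y\<bar>) x) \<delta>))
   \<and> (\<forall>p \<omega>. 1 < p \<longrightarrow>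
        (\<omega> \<in> A_class_inf \<rho> p \<longleftrightarrow>
          (\<exists>\<omega>1 \<omega>2. \<omega>1 \<in> A_class_inf \<rho> 1 \<and> \<omega>2 \<in> A_class_inf \<rho> 1
             \<and> \<omega> = (\<lambda>x. \<omega>1 x * \<omega>2 x powr (1 - p)))))"
proof -
  interpret schroedinger_potential V
    using assms by unfold_locales simp_all
  interpret slowly_varying_radius \<rho>
    unfolding rho by unfold_locales (rule critical_radius_pos critical_radius_slowly_varying)+
  have "\<exists>\<epsilon>>0. 1 \<le> p - \<epsilon> \<and> \<omega> \<in> A_class_inf \<rho> (p - \<epsilon>)" if p: "1 < p" and \<omega>: "\<omega> \<in> A_class_inf \<rho> p" for p \<omega>
  proof -
    obtain \<theta> where \<theta>: "0 \<le> \<theta>" "\<omega> \<in> A_class \<rho> p \<theta>"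
      using \<omega> by (auto simp: A_class_inf_def)
    obtain q \<theta>' where "1 < q" "q < p" "0 \<le> \<theta>'" "\<omega> \<in> A_class \<rho> q \<theta>'"
      using Ap_open[OF \<theta>(2) p \<theta>(1)] by blast
    then show ?thesis
      by (intro exI[of _ "p - q"]) (auto simp: A_class_inf_def)
  qed
  then show ?thesis
    by (intro conjI allI impI)
      (auto intro: A_class_mono maximal_powr_A1 simp: A_class_dual Ap_inf_factorization_iff simp del: minus_divide_left)
qed

end
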